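(* There is a quantum algorithm with the following guarantee. Let $N=2^L$, let $c=(c_0,\dots,c_{N-1})\in\mathbb{C}^N$ be a unit vector such that the circulant matrix $$C=\begin{pmatrix} c_0&c_1&\cdots&c_{N-1}\\ c_{N-1}&c_0&\cdots&c_{N-2}\\ \vdots&\vdots&\ddots&\vdots\\ c_1&c_2&\cdots&c_0\end{pmatrix}$$ is Hermitian, and suppose $c$ is given through an oracle $O_x$ with $x=c$, i.e. $O_x|0\rangle=\sum_{j=0}^{N-1}c_j|j\rangle$. Let $t>0$ and $\delta\in(0,1)$. Then the simulation of the circulant Hamiltonian, i.e. the operator $e^{-iCt}$, can be performed within error $\delta$, meaning that the operator $\widetilde{e^{-iCt}}$ actually performed by the algorithm satisfies $$\big\|e^{-iCt}-\widetilde{e^{-iCt}}\big\|\le\delta,$$ using $\mathcal{O}\big(\sqrt N\,t(\log N)^2/\delta^{3/2}\big)$ one- or two-qubit gates, as well as $\mathcal{O}\big(\sqrt N\,t/\delta^{3/2}\big)$ calls of controlled-$O_x$ and its inverse.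
   Context: Complexity is measured in the quantum circuit model, by the number of one- or two-qubit gates together with the number of calls to the controlled oracle and its inverse. The constants implied by $\mathcal{O}(\cdot)$ are absolute (independent of $N$, $c$, $O_x$, $t$, $\delta$). The oracle $O_x$ is a unitary on $L=\log_2 N$ qubits with $O_x|0^L\rangle=\sum_{j=0}^{N-1}x_j|j\rangle$, where $|j\rangle$ is the computational basis state holding the binary expansion of $j$; controlled-$O_x$ is $|0\rangle\langle0|\otimes\mathbb{I}+|1\rangle\langle1|\otimes O_x$. The vector $c$ is accessed only through controlled-$O_x$ and its inverse. The operator $e^{-iCt}$ acts on the $N$-dimensional state space of an $L$-qubit register, sending an arbitrary input state $|s\rangle=\sum_{k=0}^{N-1}s_k|k\rangle$ to $e^{-iCt}|s\rangle$. The algorithm may use additional ancilla qubits, which start in $|0\rangle$ and ideally are returned to $|0\rangle$. $\|\cdot\|$ is the operator norm. *)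

theory Defs
  imports
    Complex_Main
    "HOL-Analysis.L2_Norm"
    "Jordan_Normal_Form.Schur_Decomposition"
begin

definition hermitian_mat :: "complex mat \<Rightarrow> bool" where
  "hermitian_mat A \<longleftrightarrow> mat_adjoint A = A"

definition unitary_mat :: "nat \<Rightarrow> complex mat \<Rightarrow> bool" where
  "unitary_mat n U \<longleftrightarrow> U \<in> carrier_mat n n \<and>
     mat_adjoint U * U = 1\<^sub>m n \<and> U * mat_adjoint U = 1\<^sub>m n"

definition vec_l2_norm :: "complex vec \<Rightarrow> real" where
  "vec_l2_norm v = L2_set (\<lambda>i. cmod (v $ i)) {..<dim_vec v}"

text \<open>The supremum is over a nonempty set that is bounded above, since the dimension is finite.\<close>

definition mat_op_norm :: "complex mat \<Rightarrow> real" where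
  "mat_op_norm A =
     (SUP v\<in>{v \<in> carrier_vec (dim_col A). vec_l2_norm v \<le> 1}. vec_l2_norm (A *\<^sub>v v))"

text \<open>The exponential series of a square matrix, summed entrywise (it converges absolutely).\<close>

definition mat_exp :: "complex mat \<Rightarrow> complex mat" where
  "mat_exp A = mat (dim_row A) (dim_row A) (\<lambda>(i, j). \<Sum>k. (A ^\<^sub>m k) $$ (i, j) / fact k)"

definition circulant_mat :: "complex vec \<Rightarrow> complex mat" where
  "circulant_mat c = mat (dim_vec c) (dim_vec c)
     (\<lambda>(i, j). c $ ((dim_vec c + j - i) mod dim_vec c))"

text \<open>
  Conventions: the state space of \<open>n\<close> qubits, numbered from \<open>0\<close> to \<open>n - 1\<close>, has dimension \<open>2 ^ n\<close>,
  and the basis vector with index \<open>k\<close> is the one in which qubit \<open>q\<close> has the value of bit \<open>q\<close>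
  (of weight \<open>2 ^ q\<close>) of \<open>k\<close>.

  The operator \<open>on_qubits n qs U\<close> lets \<open>U\<close> act on the distinct qubits listed in \<open>qs\<close>, and the
  identity act on all other qubits. The qubit \<open>qs ! r\<close> plays the role of qubit \<open>r\<close> for \<open>U\<close>.
\<close>

definition sub_index :: "nat list \<Rightarrow> nat \<Rightarrow> nat" where
  "sub_index qs k = horner_sum of_bool 2 (map (bit k) qs)"

definition on_qubits :: "nat \<Rightarrow> nat list \<Rightarrow> complex mat \<Rightarrow> complex mat" where
  "on_qubits n qs U = mat (2 ^ n) (2 ^ n) (\<lambda>(i, j).
     if \<forall>q<n. q \<notin> set qs \<longrightarrow> bit i q = bit j q
     then U $$ (sub_index qs i, sub_index qs j) else 0)"

text \<open>
  \<open>|0\<rangle>\<langle>0| \<otimes> I + |1\<rangle>\<langle>1| \<otimes> U\<close>; the control is the qubit of highest weight.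
\<close>

definition controlled :: "complex mat \<Rightarrow> complex mat" where
  "controlled U = four_block_mat
     (1\<^sub>m (dim_row U)) (0\<^sub>m (dim_row U) (dim_col U))
     (0\<^sub>m (dim_row U) (dim_col U)) U"

text \<open>
  Circuits refer to the oracle only symbolically: \<open>Call p qs\<close> and \<open>Call_Inv p qs\<close> stand for the
  controlled oracle and its inverse, with control qubit \<open>p\<close> and target qubits \<open>qs\<close>.
\<close>

datatype instr =
    is_Gate: Gate "nat list" "complex mat"
  | is_Call: Call nat "nat list"
  | is_Call_Inv: Call_Inv nat "nat list"

type_synonym circuit = "instr list"

fun wf_instr :: "nat \<Rightarrow> nat \<Rightarrow> instr \<Rightarrow> bool" where
  "wf_instr L n (Gate qs U) \<longleftrightarrow>
     length qs \<in> {1, 2} \<and> distinct qs \<and> set qs \<subseteq> {..<n} \<and> unitary_mat (2 ^ length qs) U"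
| "wf_instr L n (Call p qs) \<longleftrightarrow> length qs = L \<and> distinct (p # qs) \<and> set (p # qs) \<subseteq> {..<n}"
| "wf_instr L n (Call_Inv p qs) \<longleftrightarrow> length qs = L \<and> distinct (p # qs) \<and> set (p # qs) \<subseteq> {..<n}"

text \<open>\<open>L\<close> is the number of qubits of the oracle, \<open>n\<close> the number of qubits of the circuit.\<close>

definition wf_circuit :: "nat \<Rightarrow> nat \<Rightarrow> circuit \<Rightarrow> bool" where
  "wf_circuit L n G \<longleftrightarrow> (\<forall>g\<in>set G. wf_instr L n g)"

definition gate_count :: "circuit \<Rightarrow> nat" where
  "gate_count G = length (filter is_Gate G)"

definition call_count :: "circuit \<Rightarrow> nat" where
  "call_count G = length (filter (\<lambda>g. is_Call g \<or> is_Call_Inv g) G)"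

text \<open>The inverse of the unitary controlled oracle is its adjoint.\<close>

fun instr_op :: "nat \<Rightarrow> complex mat \<Rightarrow> instr \<Rightarrow> complex mat" where
  "instr_op n X (Gate qs U) = on_qubits n qs U"
| "instr_op n X (Call p qs) = on_qubits n (qs @ [p]) (controlled X)"
| "instr_op n X (Call_Inv p qs) = on_qubits n (qs @ [p]) (mat_adjoint (controlled X))"

text \<open>The first instruction of the list is applied first.\<close>

fun circuit_op :: "nat \<Rightarrow> complex mat \<Rightarrow> circuit \<Rightarrow> complex mat" where
  "circuit_op n X [] = 1\<^sub>m (2 ^ n)"
| "circuit_op n X (g # G) = circuit_op n X G * instr_op n X g"

text \<open>
  The isometry \<open>|s\<rangle> \<mapsto> |s\<rangle>|0\<dots>0\<rangle>\<close> that adjoins \<open>a\<close> ancilla qubits, numbered from \<open>L\<close> to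
  \<open>L + a - 1\<close>, to an \<open>L\<close>-qubit register.
\<close>

definition adjoin_ancillas :: "nat \<Rightarrow> nat \<Rightarrow> complex mat" where
  "adjoin_ancillas L a = mat (2 ^ (L + a)) (2 ^ L) (\<lambda>(i, j). if i = j then 1 else 0)"

text \<open>
  The operator that a circuit performs is \<open>|s\<rangle> \<mapsto> G |s\<rangle>|0\<dots>0\<rangle>\<close>, to be compared with
  \<open>|s\<rangle> \<mapsto> (V |s\<rangle>)|0\<dots>0\<rangle>\<close> for the operator \<open>V\<close> that is to be simulated. So the error also accounts
  for ancillas that are not returned to \<open>|0\<dots>0\<rangle>\<close>.
\<close>

definition performed_op :: "nat \<Rightarrow> nat \<Rightarrow> complex mat \<Rightarrow> circuit \<Rightarrow> complex mat" where
  "performed_op L a X G = circuit_op (L + a) X G * adjoin_ancillas L a"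

definition simulation_error ::
    "nat \<Rightarrow> nat \<Rightarrow> complex mat \<Rightarrow> circuit \<Rightarrow> complex mat \<Rightarrow> real" where
  "simulation_error L a X G V = mat_op_norm (adjoin_ancillas L a * V - performed_op L a X G)"

end

theory Submission
  imports Defs "HOL-Computational_Algebra.Fundamental_Theorem_Algebra"
begin

text \<open>
  The Fourier transform diagonalises \<open>C\<close>. For a fixed Fourier mode \<open>k\<close>, the state \<open>|c\<rangle>\<close> prepared by
  the given unitary, followed by the phases \<open>\<omega> ^ (j k)\<close> and by Hadamard gates, has the amplitude
  \<open>x = \<lambda>\<^sub>k / sqrt N\<close> at \<open>|0\<rangle>\<close>. Making this preparation controlled on a qubit and conjugating a bit
  flip of that qubit with it gives a reflection; its product \<open>U\<close> with the reflection about \<open>|0\<rangle>\<close>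
  satisfies \<open>U + U\<inverse> = 2 x\<close> on \<open>|0\<rangle>\<close>.

  Hence \<open>exp (- i T x)\<close> with \<open>T = sqrt N t\<close> is approximated by a truncated exponential series in
  \<open>(U + U\<inverse>) / 2\<close>, i.e. by \<open>U ^ (- D) P(U)\<close> for a polynomial \<open>P\<close> of degree \<open>2 D\<close>, where
  \<open>D = O(T / \<delta> powr (3 / 2))\<close> suffices as soon as \<open>T > \<delta>\<close> (for \<open>T \<le> \<delta>\<close> the empty circuit is good
  enough). After scaling, \<open>|P| < 1\<close> on the unit circle, so that the Fejer--Riesz theorem gives \<open>Q\<close> with
  \<open>|P|\<^sup>2 + |Q|\<^sup>2 = 1\<close>; the pair \<open>(P, Q)\<close> factors into single-qubit rotations interleaved with the
  controlled walk. As the circuit is unitary and its amplitude on clean ancillas is close to one,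
  nothing else has to be known about \<open>Q\<close>.
\<close>

section \<open>The action of circuits on amplitude functions\<close>

text \<open>The circuit may depend on L, t and \<delta> only, never on c or on the oracle. This is
  possible because a Fourier mode enters the walk only through the number x, which Cauchy-Schwarz
  confines to [-1, 1] (the source of the factor sqrt N in T), so that one polynomial and one list of
  angles serve all modes in superposition. Controlling the preparation on a qubit in equal
  superposition makes the walk see only the real part of the amplitude; for Hermitian C nothing is
  lost. No invariant subspaces are built: the recurrence \<open>U (U e) + e = 2 x U e\<close> is the
  sole link between walk and polynomial. If the clean amplitude is within \<eta> of the target
  phase, the squared error including the leaked weight is at most 2 \<eta>; hence the accuracy
  \<delta>^2 / 2 demanded of the polynomial. This costs only a logarithm in the degree, which is
  absorbed because T > \<delta> makes T / \<delta> powr (3 / 2) exceed 1 / sqrt \<delta>. Scaling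
  strictly below 1 keeps the zeros of 1 - |P|^2 off the unit circle, where the factorisation would
  have to deal with double roots.\<close>

text \<open>States are functions on assignments to infinitely many qubits, so that the action of a gate does
  not mention the number of qubits of the circuit.\<close>

type_synonym state = "(nat \<Rightarrow> bool) \<Rightarrow> complex"

definition reg :: "nat list \<Rightarrow> (nat \<Rightarrow> bool) \<Rightarrow> nat" where
  "reg qs b = horner_sum of_bool 2 (map b qs)"

fun upd :: "nat list \<Rightarrow> nat \<Rightarrow> (nat \<Rightarrow> bool) \<Rightarrow> nat \<Rightarrow> bool" where
  "upd [] j b = b"
| "upd (q # qs) j b = (upd qs (j div 2) b)(q := odd j)"

text \<open>The sparse form of \<open>on_qubits\<close>: an entry vanishes unless both indices agree
  outside the list, so only the assignments \<open>upd qs j b\<close> contribute to the amplitude at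
  b.\<close>

definition app :: "nat list \<Rightarrow> complex mat \<Rightarrow> state \<Rightarrow> state" where
  "app qs U f b = (\<Sum>j<2 ^ length qs. U $$ (reg qs b, j) * f (upd qs j b))"

fun instr_sem :: "complex mat \<Rightarrow> instr \<Rightarrow> state \<Rightarrow> state" where
  "instr_sem X (Gate qs U) = app qs U"
| "instr_sem X (Call p qs) = app (qs @ [p]) (controlled X)"
| "instr_sem X (Call_Inv p qs) = app (qs @ [p]) (mat_adjoint (controlled X))"

fun sem :: "complex mat \<Rightarrow> circuit \<Rightarrow> state \<Rightarrow> state" where
  "sem X [] f = f"
| "sem X (g # G) f = sem X G (instr_sem X g f)"

lemma sem_append: "sem X (G @ H) f = sem X H (sem X G f)"
  by (induction G arbitrary: f) auto

lemma reg_Nil [simp]: "reg [] b = 0"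
  by (simp add: reg_def)

lemma reg_Cons [simp]: "reg (q # qs) b = of_bool (b q) + 2 * reg qs b"
  by (simp add: reg_def)

lemma reg_append: "reg (qs @ rs) b = reg qs b + 2 ^ length qs * reg rs b"
  by (simp add: reg_def horner_sum_append)

lemma reg_less: "reg qs b < 2 ^ length qs"
  unfolding reg_def using horner_sum_bound[of "map b qs"] by simp

lemma reg_cong: "(\<And>q. q \<in> set qs \<Longrightarrow> b q = b' q) \<Longrightarrow> reg qs b = reg qs b'"
  unfolding reg_def by (intro arg_cong[where f = "horner_sum of_bool 2"] map_cong) auto

lemma upd_notin [simp]: "q \<notin> set qs \<Longrightarrow> upd qs j b q = b q"
  by (induction qs arbitrary: j) auto

lemma upd_nth: "distinct qs \<Longrightarrow> i < length qs \<Longrightarrow> upd qs j b (qs ! i) = bit j i"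
proof (induction qs arbitrary: i j)
  case (Cons q qs)
  then show ?case
    by (cases i) (auto simp: bit_0 bit_Suc)
qed simp

lemma reg_upd [simp]:
  assumes "distinct qs" "j < 2 ^ length qs"
  shows "reg qs (upd qs j b) = j"
  using assms
proof (induction qs arbitrary: j)
  case (Cons q qs)
  then have "reg qs (upd (q # qs) j b) = reg qs (upd qs (j div 2) b)"
    by (intro reg_cong) auto
  also have "\<dots> = j div 2"
    using Cons by auto
  finally have "reg (q # qs) (upd (q # qs) j b) = of_bool (odd j) + 2 * (j div 2)"
    unfolding reg_Cons by simp
  also have "\<dots> = j"
    by (cases "even j") (auto elim!: evenE oddE)
  finally show ?case .
qed simp

text \<open>An assignment is determined by its number on the listed qubits and its values elsewhere;
  comparing these two replaces reasoning about nested updates.\<close>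

lemma upd_eqI:
  assumes "distinct qs" "reg qs b' = j" "\<And>q. q \<notin> set qs \<Longrightarrow> b q = b' q"
  shows "upd qs j b = b'"
proof
  fix q
  show "upd qs j b q = b' q"
  proof (cases "q \<in> set qs")
    case True
    then obtain i where i: "i < length qs" "q = qs ! i"
      by (metis in_set_conv_nth)
    then show ?thesis
      using assms(1,2) by (auto simp: upd_nth reg_def bit_horner_sum_bit_iff)
  qed (simp add: assms)
qed

lemma upd_reg [simp]: "distinct qs \<Longrightarrow> upd qs (reg qs b) b = b"
  by (rule upd_eqI) auto

lemma upd_upd [simp]: "distinct qs \<Longrightarrow> j < 2 ^ length qs \<Longrightarrow> upd qs j (upd qs k b) = upd qs j b"
  by (rule upd_eqI) auto

lemma upd_snoc:
  assumes "distinct (qs @ [p])" "j < 2 ^ length qs"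
  shows "upd (qs @ [p]) (j + 2 ^ length qs * of_bool v) b = (upd qs j b)(p := v)"
proof (rule upd_eqI)
  have "reg qs ((upd qs j b)(p := v)) = reg qs (upd qs j b)"
    using assms by (intro reg_cong) auto
  then show "reg (qs @ [p]) ((upd qs j b)(p := v)) = j + 2 ^ length qs * of_bool v"
    using assms by (simp add: reg_append)
qed (use assms in auto)

text \<open>Splits by the most significant bit, which belongs to the last qubit of a list;
  \<open>sum_lessThan_Cons\<close> splits by the least significant one.\<close>

lemma sum_lessThan_snoc:
  fixes f :: "nat \<Rightarrow> 'a :: comm_monoid_add"
  shows "(\<Sum>j<2 ^ Suc m. f j) = (\<Sum>j<2 ^ m. f j) + (\<Sum>j<2 ^ m. f (j + 2 ^ m))"
proof -
  have *: "{..<(2::nat) ^ Suc m} = {0..<2 ^ m + 2 ^ m}"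
    by auto
  show ?thesis
    unfolding * sum.atLeastLessThan_concat[of 0 "2 ^ m" "2 ^ m + 2 ^ m", symmetric, simplified]
    using sum.shift_bounds_nat_ivl[of f 0 "2 ^ m" "2 ^ m"] by (simp add: atLeast0LessThan)
qed

lemma sum_lessThan_Cons:
  fixes f :: "nat \<Rightarrow> 'a :: comm_monoid_add"
  shows "(\<Sum>j<2 ^ Suc m. f j) = (\<Sum>j<2 ^ m. f (2 * j) + f (2 * j + 1))"
  using sum.nat_group[of f 2 "2 ^ m"] by (simp add: eval_nat_numeral mult.commute)

section \<open>Adjoints and controlled unitaries\<close>

lemma mat_adjoint_dim [simp]: "dim_row (mat_adjoint A) = dim_col A" "dim_col (mat_adjoint A) = dim_row A"
  by (auto simp: mat_adjoint_def)

lemma mat_adjoint_carrier [simp]: "A \<in> carrier_mat n m \<Longrightarrow> mat_adjoint A \<in> carrier_mat m n"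
  by (auto intro!: carrier_matI)

lemma mat_adjoint_index [simp]:
  "i < dim_col A \<Longrightarrow> j < dim_row A \<Longrightarrow> mat_adjoint A $$ (i, j) = cnj (A $$ (j, i))"
  by (simp add: mat_adjoint_def mat_of_rows_def)

lemma mat_adjoint_adjoint [simp]: "mat_adjoint (mat_adjoint (A :: complex mat)) = A"
  by (rule eq_matI) auto

lemma mat_adjoint_controlled:
  assumes "U \<in> carrier_mat n n"
  shows "mat_adjoint (controlled U) = controlled (mat_adjoint U)"
proof (rule eq_matI)
  fix i j assume "i < dim_row (controlled (mat_adjoint U))" "j < dim_col (controlled (mat_adjoint U))"
  then show "mat_adjoint (controlled U) $$ (i, j) = controlled (mat_adjoint U) $$ (i, j)"
    using assms by (auto simp: controlled_def)
qed (use assms in \<open>auto simp: controlled_def\<close>)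

lemma controlled_carrier: "U \<in> carrier_mat n n \<Longrightarrow> controlled U \<in> carrier_mat (2 * n) (2 * n)"
  by (auto simp: controlled_def)

lemma unitary_mat_adjoint: "unitary_mat n U \<Longrightarrow> unitary_mat n (mat_adjoint U)"
  by (auto simp: unitary_mat_def)

lemma unitary_mat_controlled:
  assumes "unitary_mat n U"
  shows "unitary_mat (2 * n) (controlled U)"
proof -
  have C: "U \<in> carrier_mat n n" "mat_adjoint U \<in> carrier_mat n n"
    using assms by (auto simp: unitary_mat_def)
  have one: "four_block_mat (1\<^sub>m n) (0\<^sub>m n n) (0\<^sub>m n n) (1\<^sub>m n) = (1\<^sub>m (2 * n) :: complex mat)"
    by (rule eq_matI) auto
  have *: "controlled A * controlled B = 1\<^sub>m (2 * n)"
    if "A \<in> carrier_mat n n" "B \<in> carrier_mat n n" "A * B = 1\<^sub>m n" for A B :: "complex mat"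
    unfolding controlled_def using that
    by (subst mult_four_block_mat[where ?nr1.0 = n and ?nr2.0 = n and ?n1.0 = n and ?n2.0 = n and ?nc1.0 = n and ?nc2.0 = n])
       (auto simp: one)
  show ?thesis
    using assms C * by (auto simp: unitary_mat_def mat_adjoint_controlled[OF C(1)] controlled_carrier)
qed

text \<open>The control is the last listed qubit and thus the top bit of every index: the two halves
  of the sum are the two block columns, and the value of the control in b selects the block
  row.\<close>

lemma app_controlled:
  assumes "U \<in> carrier_mat (2 ^ length qs) (2 ^ length qs)" "distinct (qs @ [p])"
  shows "app (qs @ [p]) (controlled U) f b = (if b p then app qs U f b else f b)"
proof -
  let ?m = "2 ^ length qs :: nat"
  have L: "(\<Sum>j<?m. controlled U $$ (reg (qs @ [p]) b, j) * f (upd (qs @ [p]) j b)) =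
      (if b p then 0 else f b)"
  proof (cases "b p")
    case False
    have "(\<Sum>j<?m. controlled U $$ (reg (qs @ [p]) b, j) * f (upd (qs @ [p]) j b)) =
        (\<Sum>j<?m. if j = reg qs b then f b else 0)"
    proof (rule sum.cong)
      fix j assume "j \<in> {..<?m}"
      then show "controlled U $$ (reg (qs @ [p]) b, j) * f (upd (qs @ [p]) j b) =
          (if j = reg qs b then f b else 0)"
        using assms False reg_less[of qs b] upd_snoc[of qs p j False b]
        by (auto simp: controlled_def reg_append fun_upd_idem)
    qed simp
    then show ?thesis
      using False reg_less[of qs b] by simp
  qed (use assms reg_less[of qs b] in \<open>auto simp: controlled_def reg_append\<close>)
  have R: "(\<Sum>j<?m. controlled U $$ (reg (qs @ [p]) b, j + ?m) * f (upd (qs @ [p]) (j + ?m) b)) =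
      (if b p then app qs U f b else 0)"
  proof (cases "b p")
    case True
    have "controlled U $$ (reg (qs @ [p]) b, j + ?m) * f (upd (qs @ [p]) (j + ?m) b) =
        U $$ (reg qs b, j) * f (upd qs j b)" if "j < ?m" for j
    proof -
      have "upd (qs @ [p]) (j + ?m) b = upd qs j b"
        using upd_snoc[of qs p j True b] assms that True by (simp add: fun_upd_idem)
      then show ?thesis
        using True assms reg_less[of qs b] that by (auto simp: controlled_def reg_append)
    qed
    then show ?thesis
      using True by (simp add: app_def)
  qed (use assms reg_less[of qs b] in \<open>auto simp: controlled_def reg_append\<close>)
  show ?thesis
    unfolding app_def[of "qs @ [p]"] length_append_singleton sum_lessThan_snoc L R by simp
qed

lemma app_mult:
  assumes "A \<in> carrier_mat (2 ^ length qs) (2 ^ length qs)" "B \<in> carrier_mat (2 ^ length qs) (2 ^ length qs)"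
    and "distinct qs"
  shows "app qs A (app qs B f) b = app qs (A * B) f b"
proof -
  let ?m = "2 ^ length qs :: nat"
  have "app qs A (app qs B f) b = (\<Sum>j<?m. \<Sum>k<?m. A $$ (reg qs b, j) * B $$ (j, k) * f (upd qs k b))"
    using assms by (simp add: app_def sum_distrib_left mult.assoc)
  also have "\<dots> = (\<Sum>k<?m. \<Sum>j<?m. A $$ (reg qs b, j) * B $$ (j, k) * f (upd qs k b))"
    by (rule sum.swap)
  also have "\<dots> = app qs (A * B) f b"
    using assms reg_less[of qs b]
    by (simp add: app_def scalar_prod_def sum_distrib_right atLeast0LessThan)
  finally show ?thesis .
qed

lemma app_one: "distinct qs \<Longrightarrow> app qs (1\<^sub>m (2 ^ length qs)) f b = f b"
proof -
  assume *: "distinct qs"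
  have "app qs (1\<^sub>m (2 ^ length qs)) f b = (\<Sum>j<2 ^ length qs. if j = reg qs b then f b else 0)"
    unfolding app_def using * reg_less[of qs b] by (intro sum.cong) auto
  then show ?thesis
    using reg_less[of qs b] by simp
qed

lemma app_adjoint:
  assumes "unitary_mat (2 ^ length qs) U" "distinct qs"
  shows "app qs (mat_adjoint U) (app qs U f) = f"
  using assms by (auto simp: app_mult app_one unitary_mat_def)

section \<open>Inverse circuits\<close>

fun inv_instr :: "instr \<Rightarrow> instr" where
  "inv_instr (Gate qs U) = Gate qs (mat_adjoint U)"
| "inv_instr (Call p qs) = Call_Inv p qs"
| "inv_instr (Call_Inv p qs) = Call p qs"

definition inv_circuit :: "circuit \<Rightarrow> circuit" where
  "inv_circuit G = rev (map inv_instr G)"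

lemma inv_instr_inv [simp]: "inv_instr (inv_instr g) = g"
  by (cases g) auto

lemma inv_circuit_inv [simp]: "inv_circuit (inv_circuit G) = G"
  by (simp add: inv_circuit_def rev_map comp_def)

lemma wf_inv_instr [simp]: "wf_instr L n (inv_instr g) \<longleftrightarrow> wf_instr L n g"
  by (cases g) (use unitary_mat_adjoint in fastforce)+

lemma wf_inv_circuit [simp]: "wf_circuit L n (inv_circuit G) \<longleftrightarrow> wf_circuit L n G"
  by (auto simp: wf_circuit_def inv_circuit_def)

lemma wf_circuit_simps [simp]:
  "wf_circuit L n []"
  "wf_circuit L n (g # G) \<longleftrightarrow> wf_instr L n g \<and> wf_circuit L n G"
  "wf_circuit L n (G @ H) \<longleftrightarrow> wf_circuit L n G \<and> wf_circuit L n H"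
  by (auto simp: wf_circuit_def)

lemma is_inv_instr [simp]:
  "is_Gate (inv_instr g) = is_Gate g" "is_Call (inv_instr g) = is_Call_Inv g"
  "is_Call_Inv (inv_instr g) = is_Call g"
  by (cases g; simp)+

lemma count_simps [simp]:
  "gate_count [] = 0" "call_count [] = 0"
  "gate_count (g # G) = of_bool (is_Gate g) + gate_count G"
  "call_count (g # G) = of_bool (is_Call g \<or> is_Call_Inv g) + call_count G"
  "gate_count (G @ H) = gate_count G + gate_count H"
  "call_count (G @ H) = call_count G + call_count H"
  by (auto simp: gate_count_def call_count_def)

lemma count_inv_circuit [simp]:
  "gate_count (inv_circuit G) = gate_count G" "call_count (inv_circuit G) = call_count G"
  by (induction G) (auto simp: inv_circuit_def)

lemma instr_sem_inv:
  assumes "wf_instr L n g" "unitary_mat (2 ^ L) X"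
  shows "instr_sem X (inv_instr g) (instr_sem X g f) = f"
proof (cases g)
  case (Gate qs U)
  then show ?thesis using assms by (simp add: app_adjoint)
next
  case (Call p qs)
  then show ?thesis
    using assms app_adjoint[of "qs @ [p]" "controlled X"] unitary_mat_controlled[of "2 ^ L" X] by simp
next
  case (Call_Inv p qs)
  then show ?thesis
    using assms app_adjoint[of "qs @ [p]" "mat_adjoint (controlled X)"]
      unitary_mat_adjoint[OF unitary_mat_controlled[of "2 ^ L" X]] by simp
qed

lemma sem_inv:
  assumes "wf_circuit L n G" "unitary_mat (2 ^ L) X"
  shows "sem X (inv_circuit G) (sem X G f) = f"
  using assms(1)
proof (induction G arbitrary: f)
  case (Cons g G)
  then have "instr_sem X (inv_instr g) (instr_sem X g f) = f"
    using instr_sem_inv[OF _ assms(2), where n = n] by simp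
  then show ?case
    using Cons by (simp add: inv_circuit_def sem_append)
qed (simp add: inv_circuit_def)

text \<open>Inverse circuits are evaluated by exhibiting a preimage under the forward circuit
  instead of unfolding the adjoint of each gate.\<close>

lemma sem_inv_eqI:
  assumes "wf_circuit L n G" "unitary_mat (2 ^ L) X" "sem X G h = f"
  shows "sem X (inv_circuit G) f = h"
  unfolding assms(3)[symmetric] by (rule sem_inv[OF assms(1,2)])

lemma sem_inv':
  assumes "wf_circuit L n G" "unitary_mat (2 ^ L) X"
  shows "sem X G (sem X (inv_circuit G) f) = f"
  using sem_inv[of L n "inv_circuit G" X f] assms by simp

section \<open>Linearity and untouched qubits\<close>

lemma app_linear: "app qs U (\<lambda>b. x * f b + y * g b) b = x * app qs U f b + y * app qs U g b"
  by (simp add: app_def sum_distrib_left algebra_simps sum.distrib)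

lemma instr_sem_linear:
  "instr_sem X I (\<lambda>b. x * f b + y * g b) = (\<lambda>b. x * instr_sem X I f b + y * instr_sem X I g b)"
  by (cases I) (auto simp: app_linear)

lemma sem_linear:
  "sem X G (\<lambda>b. x * f b + y * g b) = (\<lambda>b. x * sem X G f b + y * sem X G g b)"
  by (induction G arbitrary: f g) (auto simp: instr_sem_linear)

fun qubits :: "instr \<Rightarrow> nat set" where
  "qubits (Gate qs U) = set qs"
| "qubits (Call p qs) = insert p (set qs)"
| "qubits (Call_Inv p qs) = insert p (set qs)"

lemma qubits_inv_instr [simp]: "qubits (inv_instr g) = qubits g"
  by (cases g) auto

lemma qubits_inv_circuit [simp]: "\<Union> (qubits ` set (inv_circuit G)) = \<Union> (qubits ` set G)"
  by (auto simp: inv_circuit_def)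

lemma app_local:
  assumes "set qs \<subseteq> S" "\<And>b b'. (\<And>q. q \<notin> S \<Longrightarrow> b q = b' q) \<Longrightarrow> \<alpha> b = \<alpha> b'"
  shows "app qs U (\<lambda>b. \<alpha> b * f b) b = \<alpha> b * app qs U f b"
proof -
  have "\<alpha> (upd qs j b) = \<alpha> b" for j
    using assms(1) by (intro assms(2) upd_notin) auto
  then show ?thesis
    by (simp add: app_def sum_distrib_left algebra_simps)
qed

text \<open>A factor that depends only on qubits outside S is constant along every sum performed by
  the gates. With an indicator as the factor, this restricts a state to one value of an untouched
  qubit.\<close>

lemma sem_local:
  assumes "\<Union> (qubits ` set G) \<subseteq> S" "\<And>b b'. (\<And>q. q \<notin> S \<Longrightarrow> b q = b' q) \<Longrightarrow> \<alpha> b = \<alpha> b'"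
  shows "sem X G (\<lambda>b. \<alpha> b * f b) = (\<lambda>b. \<alpha> b * sem X G f b)"
  using assms(1)
proof (induction G arbitrary: f)
  case (Cons g G)
  have "app qs U (\<lambda>b. \<alpha> b * f b) = (\<lambda>b. \<alpha> b * app qs U f b)" if "set qs \<subseteq> S" for qs U
    by (rule ext, rule app_local[OF that]) (rule assms(2))
  then have "instr_sem X g (\<lambda>b. \<alpha> b * f b) = (\<lambda>b. \<alpha> b * instr_sem X g f b)"
    using Cons.prems by (cases g) simp_all
  then show ?case
    using Cons by simp
qed simp

lemma app_shift:
  assumes "q \<notin> set qs"
  shows "app qs U (\<lambda>b. f (b(q := v))) b = app qs U f (b(q := v))"
proof -
  have "(upd qs j b)(q := v) = upd qs j (b(q := v))" for j
    using assms by (induction qs arbitrary: j) (auto simp: fun_upd_twist)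
  moreover have "reg qs (b(q := v)) = reg qs b"
    using assms by (intro reg_cong) auto
  ultimately show ?thesis
    by (simp add: app_def)
qed

lemma sem_shift:
  assumes "q \<notin> \<Union> (qubits ` set G)"
  shows "sem X G (\<lambda>b. f (b(q := v))) = (\<lambda>b. sem X G f (b(q := v)))"
  using assms
proof (induction G arbitrary: f)
  case (Cons g G)
  have "app qs U (\<lambda>b. f (b(q := v))) = (\<lambda>b. app qs U f (b(q := v)))" if "q \<notin> set qs" for qs U
    by (rule ext, rule app_shift[OF that])
  then have "instr_sem X g (\<lambda>b. f (b(q := v))) = (\<lambda>b. instr_sem X g f (b(q := v)))"
    using Cons.prems by (cases g) (simp_all del: fun_upd_apply)
  then show ?case
    using Cons by (simp del: fun_upd_apply)
qed simp

section \<open>From amplitude functions to vectors and matrices\<close>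

definition rep :: "nat \<Rightarrow> complex vec \<Rightarrow> state \<Rightarrow> bool" where
  "rep n v f \<longleftrightarrow> v \<in> carrier_vec (2 ^ n) \<and> (\<forall>i<2 ^ n. v $ i = f (bit i))"

lemma bit_reg_upt:
  assumes "b ` {n..} \<subseteq> {False}"
  shows "bit (reg [0..<n] b) = b"
proof (rule ext)
  fix q show "bit (reg [0..<n] b) q = b q"
    using assms by (cases "q < n") (auto simp: reg_def bit_horner_sum_bit_iff image_subset_iff)
qed

lemma bit_ge: "(i :: nat) < 2 ^ n \<Longrightarrow> n \<le> q \<Longrightarrow> \<not> bit i q"
proof -
  assume "i < 2 ^ n" "n \<le> q"
  then have "i < 2 ^ q"
    by (meson less_le_trans one_le_numeral power_increasing)
  then show "\<not> bit i q"
    by (simp add: bit_iff_odd)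
qed

text \<open>In row i the only columns that can contribute are those that agree with i outside qs,
  and reading the listed qubits maps them bijectively onto the local indices; \<open>?e\<close> is
  the inverse of that map.\<close>

lemma rep_on_qubits:
  assumes "rep n v f" "set qs \<subseteq> {..<n}" "distinct qs"
  shows "rep n (on_qubits n qs U *\<^sub>v v) (app qs U f)"
  unfolding rep_def
proof (intro conjI allI impI)
  show "on_qubits n qs U *\<^sub>v v \<in> carrier_vec (2 ^ n)"
    by (intro carrier_vecI) (simp add: on_qubits_def)
next
  fix i :: nat assume i: "i < 2 ^ n"
  let ?P = "\<lambda>j :: nat. \<forall>q<n. q \<notin> set qs \<longrightarrow> bit i q = bit j q"
  let ?e = "\<lambda>j. reg [0..<n] (upd qs j (bit i))"
  have v: "dim_vec v = 2 ^ n" "\<And>j. j < 2 ^ n \<Longrightarrow> v $ j = f (bit j)"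
    using assms by (auto simp: rep_def)
  have e: "bit (?e j) = upd qs j (bit i)" for j
  proof (rule bit_reg_upt)
    show "upd qs j (bit i) ` {n..} \<subseteq> {False}"
    proof
      fix x assume "x \<in> upd qs j (bit i) ` {n..}"
      then obtain q where q: "q \<ge> n" "x = upd qs j (bit i) q" by auto
      moreover have "q \<notin> set qs"
        using assms q(1) by auto
      ultimately show "x \<in> {False}"
        using bit_ge[OF i q(1)] by simp
    qed
  qed
  have "(on_qubits n qs U *\<^sub>v v) $ i =
      (\<Sum>j<2 ^ n. if ?P j then U $$ (reg qs (bit i), reg qs (bit j)) * f (bit j) else 0)"
    using i v unfolding on_qubits_def mult_mat_vec_def scalar_prod_def sub_index_def reg_def
      atLeast0LessThan by simp (rule sum.cong, auto)
  also have "\<dots> = (\<Sum>j\<in>{j. j < 2 ^ n \<and> ?P j}. U $$ (reg qs (bit i), reg qs (bit j)) * f (bit j))"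
    by (simp add: sum.If_cases Int_def)
  also have "\<dots> = (\<Sum>j<2 ^ length qs. U $$ (reg qs (bit i), j) * f (upd qs j (bit i)))"
  proof (rule sum.reindex_bij_witness[of _ ?e "\<lambda>j. reg qs (bit j)"])
    fix j assume j: "j \<in> {j. j < 2 ^ n \<and> ?P j}"
    have "upd qs (reg qs (bit j)) (bit i) = bit j"
    proof (rule upd_eqI)
      fix q assume "q \<notin> set qs"
      then show "bit i q = bit j q"
        using j i bit_ge[of _ n q] by (cases "q < n") auto
    qed (use assms in auto)
    then show "?e (reg qs (bit j)) = j"
      using j by (simp add: reg_def horner_sum_bit_eq_take_bit take_bit_nat_eq_self_iff)
    show "U $$ (reg qs (bit i), reg qs (bit j)) * f (upd qs (reg qs (bit j)) (bit i)) =
        U $$ (reg qs (bit i), reg qs (bit j)) * f (bit j)"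
      using \<open>upd qs (reg qs (bit j)) (bit i) = bit j\<close> by simp
  next
    fix j :: nat assume j: "j \<in> {..<2 ^ length qs}"
    show "?e j \<in> {j. j < 2 ^ n \<and> ?P j}"
      using reg_less[of "[0..<n]" "upd qs j (bit i)"] by (simp add: e)
    show "reg qs (bit (?e j)) = j"
      using j assms(3) by (simp add: e)
  next
    fix j assume "j \<in> {j. j < 2 ^ n \<and> ?P j}"
    show "reg qs (bit j) \<in> {..<2 ^ length qs}"
      using reg_less by simp
  qed
  finally show "(on_qubits n qs U *\<^sub>v v) $ i = app qs U f (bit i)"
    by (simp add: app_def)
qed

lemma on_qubits_carrier [simp]: "on_qubits n qs U \<in> carrier_mat (2 ^ n) (2 ^ n)"
  by (simp add: on_qubits_def)

lemma instr_op_carrier [simp]: "instr_op n X g \<in> carrier_mat (2 ^ n) (2 ^ n)"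
  by (cases g) auto

lemma circuit_op_carrier [simp]: "circuit_op n X G \<in> carrier_mat (2 ^ n) (2 ^ n)"
  by (induction G) (auto intro!: mult_carrier_mat[where n = "2 ^ n"])

lemma rep_circuit_op:
  assumes "rep n v f" "wf_circuit L n G"
  shows "rep n (circuit_op n X G *\<^sub>v v) (sem X G f)"
  using assms
proof (induction G arbitrary: v f)
  case (Cons g G)
  have v: "v \<in> carrier_vec (2 ^ n)"
    using Cons.prems by (simp add: rep_def)
  have "rep n (instr_op n X g *\<^sub>v v) (instr_sem X g f)"
    using Cons.prems by (cases g) (auto intro!: rep_on_qubits)
  then show ?case
    using Cons v by (auto simp: assoc_mult_mat_vec[where n\<^sub>1 = "2 ^ n" and n\<^sub>2 = "2 ^ n" and n\<^sub>3 = "2 ^ n"])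
qed (auto simp: rep_def)

lemma mat_adjoint_on_qubits:
  assumes "U \<in> carrier_mat (2 ^ length qs) (2 ^ length qs)"
  shows "mat_adjoint (on_qubits n qs U) = on_qubits n qs (mat_adjoint U)"
proof (rule eq_matI)
  fix i j assume "i < dim_row (on_qubits n qs (mat_adjoint U))" "j < dim_col (on_qubits n qs (mat_adjoint U))"
  moreover have "sub_index qs k < 2 ^ length qs" for k
    using reg_less[of qs "bit k"] by (simp add: sub_index_def reg_def)
  ultimately show "mat_adjoint (on_qubits n qs U) $$ (i, j) = on_qubits n qs (mat_adjoint U) $$ (i, j)"
    using assms by (auto simp: on_qubits_def)
qed (auto simp: on_qubits_def)

lemma mat_adjoint_mult:
  assumes "A \<in> carrier_mat n m" "B \<in> carrier_mat m k"
  shows "mat_adjoint (A * B :: complex mat) = mat_adjoint B * mat_adjoint A"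
  using assms by (intro eq_matI) (auto simp: scalar_prod_def mult.commute)

lemma mat_adjoint_one [simp]: "mat_adjoint (1\<^sub>m n :: complex mat) = 1\<^sub>m n"
  by (rule eq_matI) auto

lemma mat_adjoint_instr_op:
  assumes "wf_instr L n g" "X \<in> carrier_mat (2 ^ L) (2 ^ L)"
  shows "mat_adjoint (instr_op n X g) = instr_op n X (inv_instr g)"
  using assms controlled_carrier[of X "2 ^ L"] 
  by (cases g) (auto simp: mat_adjoint_on_qubits unitary_mat_def)

lemma circuit_op_append: "circuit_op n X (G @ H) = circuit_op n X H * circuit_op n X G"
proof (induction G)
  case Nil
  show ?case
    using right_mult_one_mat[OF circuit_op_carrier] by simp
next
  case (Cons g G)
  then show ?case
    using assoc_mult_mat[OF circuit_op_carrier circuit_op_carrier instr_op_carrier, of n X H X G X g]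
    by simp
qed

lemma mat_adjoint_circuit_op:
  assumes "wf_circuit L n G" "X \<in> carrier_mat (2 ^ L) (2 ^ L)"
  shows "mat_adjoint (circuit_op n X G) = circuit_op n X (inv_circuit G)"
  using assms(1)
proof (induction G)
  case (Cons g G)
  have "mat_adjoint (circuit_op n X (g # G)) = mat_adjoint (instr_op n X g) * mat_adjoint (circuit_op n X G)"
    by (simp add: mat_adjoint_mult[where n = "2 ^ n" and m = "2 ^ n" and k = "2 ^ n"])
  then show ?case
    using Cons mat_adjoint_instr_op[OF _ assms(2)]
    by (simp add: inv_circuit_def circuit_op_append left_mult_one_mat[OF instr_op_carrier])
qed (simp add: inv_circuit_def)

lemma rep_vec: "v \<in> carrier_vec (2 ^ n) \<Longrightarrow> rep n v (\<lambda>b. v $ reg [0..<n] b)"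
  by (auto simp: rep_def reg_def horner_sum_bit_eq_take_bit take_bit_nat_eq_self)

lemma rep_unique: "rep n v f \<Longrightarrow> rep n w f \<Longrightarrow> v = w"
  by (auto simp: rep_def)

lemma mat_eqI_mult_vec:
  assumes "A \<in> carrier_mat m n" "B \<in> carrier_mat m n"
    "\<And>v. v \<in> carrier_vec n \<Longrightarrow> A *\<^sub>v v = B *\<^sub>v (v :: complex vec)"
  shows "A = B"
proof (rule eq_matI)
  fix i j assume ij: "i < dim_row B" "j < dim_col B"
  then have "(A *\<^sub>v unit_vec n j) $ i = (B *\<^sub>v unit_vec n j) $ i"
    using assms(3)[of "unit_vec n j"] by simp
  then show "A $$ (i, j) = B $$ (i, j)"
    using assms(1,2) ij by auto
qed (use assms in auto)

text \<open>Obtained from the semantics: a circuit followed by its inverse fixes every amplitude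
  function, hence every vector, and agreement on all vectors gives equality of matrices. Products of
  \<open>on_qubits\<close> matrices are never expanded.\<close>

lemma circuit_op_unitary:
  assumes "wf_circuit L n G" "unitary_mat (2 ^ L) X"
  shows "unitary_mat (2 ^ n) (circuit_op n X G)"
proof -
  have X: "X \<in> carrier_mat (2 ^ L) (2 ^ L)"
    using assms by (simp add: unitary_mat_def)
  have *: "circuit_op n X (inv_circuit G) * circuit_op n X G = 1\<^sub>m (2 ^ n)" if wf: "wf_circuit L n G" for G
  proof (rule mat_eqI_mult_vec)
    fix v :: "complex vec" assume v: "v \<in> carrier_vec (2 ^ n)"
    let ?f = "\<lambda>b. v $ reg [0..<n] b"
    have "rep n (circuit_op n X (G @ inv_circuit G) *\<^sub>v v) (sem X (G @ inv_circuit G) ?f)"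
      using v wf by (intro rep_circuit_op rep_vec) auto
    moreover have "sem X (G @ inv_circuit G) ?f = ?f"
      using sem_inv[OF wf assms(2)] by (simp add: sem_append)
    ultimately have "circuit_op n X (G @ inv_circuit G) *\<^sub>v v = v"
      using rep_unique rep_vec[OF v] by metis
    then show "circuit_op n X (inv_circuit G) * circuit_op n X G *\<^sub>v v = 1\<^sub>m (2 ^ n) *\<^sub>v v"
      using v by (simp add: circuit_op_append)
  qed (auto intro!: mult_carrier_mat[where n = "2 ^ n"])
  show ?thesis
    using *[OF assms(1)] *[of "inv_circuit G"] assms(1) mat_adjoint_circuit_op[OF assms(1) X]
    by (simp add: unitary_mat_def)
qed

section \<open>Fejer--Riesz factorisation and signal processing sequences\<close>

lemma infinite_unit_circle: "infinite {z :: complex. cmod z = 1}"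
proof
  assume "finite {z :: complex. cmod z = 1}"
  then have "finite (Re ` {z :: complex. cmod z = 1})"
    by (rule finite_imageI)
  moreover have "{-1..1} \<subseteq> Re ` {z :: complex. cmod z = 1}"
  proof
    fix x :: real assume "x \<in> {-1..1}"
    then have "x\<^sup>2 \<le> 1"
      by (simp add: abs_square_le_1 abs_le_iff)
    then have "cmod (Complex x (sqrt (1 - x\<^sup>2))) = 1"
      by (simp add: cmod_def)
    then show "x \<in> Re ` {z :: complex. cmod z = 1}"
      by (intro image_eqI[where x = "Complex x (sqrt (1 - x\<^sup>2))"]) auto
  qed
  ultimately have "finite {-1..1::real}"
    by (rule finite_subset[rotated])
  then show False
    using infinite_Icc[of "-1::real" 1] by simp
qed

text \<open>Lets identities between absolute values on the circle be compared
  coefficientwise.\<close>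

lemma poly_eq_on_unit_circle:
  fixes p q :: "complex poly"
  assumes "\<And>z. cmod z = 1 \<Longrightarrow> poly p z = poly q z"
  shows "p = q"
proof (rule ccontr)
  assume "p \<noteq> q"
  then have "finite {z. poly (p - q) z = 0}"
    by (intro poly_roots_finite) simp
  moreover have "{z. cmod z = 1} \<subseteq> {z. poly (p - q) z = 0}"
    using assms by auto
  ultimately show False
    using infinite_unit_circle finite_subset by blast
qed

lemma cnj_unit: "cmod z = 1 \<Longrightarrow> cnj z * z = 1" "cmod z = 1 \<Longrightarrow> z * cnj z = 1"
  by (simp_all add: complex_norm_square[symmetric] mult.commute)

text \<open>For degree at most n this is the reciprocal polynomial
  \<open>z ^ n * cnj (p (1 / cnj z))\<close>. On the unit circle \<open>1 / cnj z = z\<close>, so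
  complex conjugation becomes a polynomial operation there.\<close>

definition conj_reflect :: "nat \<Rightarrow> complex poly \<Rightarrow> complex poly" where
  "conj_reflect n p = (\<Sum>i\<le>n. monom (cnj (coeff p i)) (n - i))"

lemma poly_eq_sum_le:
  fixes p :: "'a :: comm_semiring_1 poly"
  assumes "degree p \<le> n"
  shows "poly p z = (\<Sum>i\<le>n. coeff p i * z ^ i)"
  by (subst poly_as_sum_of_monoms'[OF assms, symmetric]) (simp add: poly_sum poly_monom)

lemma poly_conj_reflect:
  assumes "degree p \<le> n" "z \<noteq> 0"
  shows "poly (conj_reflect n p) z = z ^ n * cnj (poly p (1 / cnj z))"
proof -
  have "poly (conj_reflect n p) z = (\<Sum>i\<le>n. cnj (coeff p i) * z ^ (n - i))"
    by (simp add: conj_reflect_def poly_sum poly_monom)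
  also have "\<dots> = (\<Sum>i\<le>n. z ^ n * (cnj (coeff p i) * (1 / z) ^ i))"
    using assms by (intro sum.cong) (auto simp: power_diff power_divide)
  also have "\<dots> = z ^ n * cnj (poly p (1 / cnj z))"
    by (simp add: poly_eq_sum_le[OF assms(1)] sum_distrib_left)
  finally show ?thesis .
qed

lemma poly_conj_reflect_unit:
  assumes "degree p \<le> n" "cmod z = 1"
  shows "poly (conj_reflect n p) z = z ^ n * cnj (poly p z)"
proof -
  have "z \<noteq> 0" using assms by auto
  moreover have "1 / cnj z = z"
    using cnj_unit(1)[OF assms(2)] \<open>z \<noteq> 0\<close> by (simp add: field_simps)
  ultimately show ?thesis
    using poly_conj_reflect[OF assms(1)] by simp
qed

lemma degree_conj_reflect: "degree (conj_reflect n p) \<le> n"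
  unfolding conj_reflect_def
  by (intro degree_sum_le) (auto intro: order_trans[OF degree_monom_le])

lemma coeff_conj_reflect: "k \<le> n \<Longrightarrow> coeff (conj_reflect n p) k = cnj (coeff p (n - k))"
proof -
  assume "k \<le> n"
  have "coeff (conj_reflect n p) k = (\<Sum>i\<le>n. if i = n - k then cnj (coeff p i) else 0)"
    unfolding conj_reflect_def coeff_sum using \<open>k \<le> n\<close> by (intro sum.cong) auto
  then show ?thesis
    by simp
qed

text \<open>A real trigonometric polynomial times z ^ n is its own reciprocal polynomial, so its
  nonzero roots come in pairs w and \<open>1 / cnj w\<close>. Strict positivity keeps them off the
  circle and thus the partners distinct; splitting off a pair removes the factor
  \<open>|z - w|^2 z\<close> and leaves a positive polynomial for the next smaller n.\<close>

lemma fejer_riesz: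
  assumes "degree S \<le> 2 * n"
    and "\<And>z. cmod z = 1 \<Longrightarrow> \<exists>r>0. poly S z = of_real r * z ^ n"
  shows "\<exists>Q. degree Q \<le> n \<and> (\<forall>z. cmod z = 1 \<longrightarrow> poly S z = of_real ((cmod (poly Q z))\<^sup>2) * z ^ n)"
  using assms
proof (induction n arbitrary: S)
  case 0
  then obtain c where S: "S = [:c:]"
    by (auto elim: degree_eq_zeroE)
  obtain r where r: "r > 0" "c = of_real r"
    using 0(2)[of 1] S by auto
  show ?case
    using S r by (intro exI[where x = "[:of_real (sqrt r):]"]) auto
next
  case (Suc n)
  let ?m = "Suc n"
  have unit: "z \<noteq> 0" if "cmod z = 1" for z :: complex
    using that by auto
  have self: "conj_reflect (2 * ?m) S = S"
  proof (rule poly_eq_on_unit_circle)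
    fix z :: complex assume z: "cmod z = 1"
    obtain r where r: "poly S z = of_real r * z ^ ?m"
      using Suc.prems(2)[OF z] by auto
    have "poly (conj_reflect (2 * ?m) S) z = z ^ (2 * ?m) * (of_real r * cnj z ^ ?m)"
      using poly_conj_reflect_unit[OF Suc.prems(1) z] r by simp
    also have "\<dots> = of_real r * z ^ ?m * (z * cnj z) ^ ?m"
      by (simp only: mult_2 power_add power_mult_distrib) (simp add: ac_simps)
    finally show "poly (conj_reflect (2 * ?m) S) z = poly S z"
      using r cnj_unit(2)[OF z] by simp
  qed
  show ?case
  proof (cases "coeff S 0 = 0")
    \<comment> \<open>Self-reciprocity makes the top coefficient vanish together with the bottom
      one, so division by z lowers the degree bound by two.\<close>
    case True
    obtain S1 where S1: "S = pCons 0 S1"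
      using True by (cases S) auto
    have "coeff S (2 * ?m) = 0"
      using coeff_conj_reflect[of "2 * ?m" "2 * ?m" S] self True by simp
    then have "coeff S1 (Suc (2 * n)) = 0"
      by (simp add: S1)
    moreover have "degree S1 \<le> Suc (2 * n)"
      using Suc.prems(1) S1 by (cases "S1 = 0") auto
    ultimately have "degree S1 \<le> 2 * n"
      by (metis degree_0 le_SucE leading_coeff_0_iff le0)
    moreover have "\<exists>r>0. poly S1 z = of_real r * z ^ n" if z: "cmod z = 1" for z
      using Suc.prems(2)[OF z] unit[OF z] by (auto simp: S1)
    ultimately obtain Q where Q: "degree Q \<le> n"
      "\<And>z. cmod z = 1 \<Longrightarrow> poly S1 z = of_real ((cmod (poly Q z))\<^sup>2) * z ^ n"
      using Suc.IH by blast
    then show ?thesis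
      by (intro exI[where x = Q]) (auto simp: S1)
  next
    case False
    have "coeff S (2 * ?m) \<noteq> 0"
      using coeff_conj_reflect[of "2 * ?m" "2 * ?m" S] self False by simp
    then have deg: "degree S = 2 * ?m"
      using Suc.prems(1) le_degree le_antisym by blast
    then obtain w where w: "poly S w = 0"
      using fundamental_theorem_of_algebra[of S] by (auto simp: constant_degree)
    have w0: "w \<noteq> 0"
      using w False by (auto simp: poly_0_coeff_0)
    have w1: "cmod w \<noteq> 1"
      using Suc.prems(2)[of w] w w0 by auto
    let ?w = "1 / cnj w"
    have "poly S ?w = ?w ^ (2 * ?m) * cnj (poly S w)"
      using poly_conj_reflect[OF Suc.prems(1), of ?w] self w0 by simp
    then have w': "poly S ?w = 0"
      using w by simp
    have "?w \<noteq> w"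
    proof
      assume "?w = w"
      then have "w * cnj w = 1"
        using w0 by (simp add: field_simps)
      then have "(cmod w)\<^sup>2 = 1"
        by (metis complex_norm_square of_real_eq_1_iff)
      then show False
        using w1 by (smt (verit) norm_ge_zero power2_eq_1_iff)
    qed
    obtain A where A: "S = [:-w, 1:] * A"
      using w by (auto simp: poly_eq_0_iff_dvd dvd_def)
    then have "poly S ?w = (?w - w) * poly A ?w"
      unfolding A by (simp add: algebra_simps)
    then have "poly A ?w = 0"
      using w' \<open>?w \<noteq> w\<close> by simp
    then obtain B where B: "A = [:-?w, 1:] * B"
      by (auto simp: poly_eq_0_iff_dvd dvd_def)
    \<comment> \<open>Rescaled so that the partner root appears through the factor
      \<open>1 - cnj w * z\<close>, which on the circle equals
      \<open>z * cnj (z - w)\<close>.\<close>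
    define C where "C = smult (- ?w) B"
    have "[:-?w, 1:] = smult (- ?w) [:1, - cnj w:]"
      using w0 by simp
    then have "[:-?w, 1:] * B = [:1, - cnj w:] * C"
      by (simp only: C_def mult_smult_left mult_smult_right)
    then have S: "S = [:-w, 1:] * [:1, - cnj w:] * C"
      using A B by (simp only: mult.assoc)
    have "C \<noteq> 0"
      using deg S by auto
    then have "degree S = 2 + degree C"
      unfolding S using w0 by (subst degree_mult_eq; simp)+
    then have "degree C \<le> 2 * n"
      using deg by simp
    have fac: "poly S z = of_real ((cmod (z - w))\<^sup>2) * z * poly C z" "cmod (z - w) > 0" if z: "cmod z = 1" for z
    proof -
      have "(z - w) * (1 - cnj w * z) = (z - w) * (cnj z * z - cnj w * z)"
        using cnj_unit[OF z] by simp
      also have "\<dots> = of_real ((cmod (z - w))\<^sup>2) * z"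
        by (simp add: complex_norm_square algebra_simps del: of_real_power)
      finally have "(z - w) * (1 - cnj w * z) = of_real ((cmod (z - w))\<^sup>2) * z" .
      moreover have "poly S z = (z - w) * (1 - cnj w * z) * poly C z"
        by (simp add: S algebra_simps)
      ultimately show "poly S z = of_real ((cmod (z - w))\<^sup>2) * z * poly C z"
        by (simp only:)
      show "cmod (z - w) > 0"
        using w1 z by auto
    qed
    have "\<exists>r>0. poly C z = of_real r * z ^ n" if z: "cmod z = 1" for z
    proof -
      obtain r where r: "r > 0" "poly S z = of_real r * z ^ ?m"
        using Suc.prems(2)[OF z] by auto
      have "poly C z = of_real (r / (cmod (z - w))\<^sup>2) * z ^ n"
        using r fac[OF z] unit[OF z] by (simp add: field_simps)
      then show ?thesis
        using r fac[OF z] by (intro exI[where x = "r / (cmod (z - w))\<^sup>2"]) simp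
    qed
    then obtain Q where Q: "degree Q \<le> n"
      "\<And>z. cmod z = 1 \<Longrightarrow> poly C z = of_real ((cmod (poly Q z))\<^sup>2) * z ^ n"
      using Suc.IH[OF \<open>degree C \<le> 2 * n\<close>] by blast
    have "degree ([:-w, 1:] * Q) \<le> Suc n"
      using degree_mult_le[of "[:-w, 1:]" Q] Q(1) by simp
    moreover have "poly S z = of_real ((cmod (poly ([:-w, 1:] * Q) z))\<^sup>2) * z ^ ?m" if z: "cmod z = 1" for z
    proof -
      have "poly ([:-w, 1:] * Q) z = (z - w) * poly Q z"
        by (simp add: algebra_simps)
      then show ?thesis
        unfolding fac(1)[OF z] Q(2)[OF z] by (simp add: norm_mult power_mult_distrib)
    qed
    ultimately show ?thesis
      by blast
  qed
qed

section \<open>Complementary polynomials and layer stripping\<close>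

definition unit_pair :: "complex poly \<Rightarrow> complex poly \<Rightarrow> bool" where
  "unit_pair P Q \<longleftrightarrow> (\<forall>z. cmod z = 1 \<longrightarrow> (cmod (poly P z))\<^sup>2 + (cmod (poly Q z))\<^sup>2 = 1)"

lemma complementary_poly:
  assumes "degree P \<le> n" "\<And>z. cmod z = 1 \<Longrightarrow> cmod (poly P z) < 1"
  shows "\<exists>Q. degree Q \<le> n \<and> unit_pair P Q"
proof -
  \<comment> \<open>On the circle this is \<open>(1 - |P|^2) z ^ n\<close>, a positive input for
    \<open>fejer_riesz\<close>.\<close>
  define S where "S = monom 1 n - P * conj_reflect n P"
  have S: "poly S z = of_real (1 - (cmod (poly P z))\<^sup>2) * z ^ n" if "cmod z = 1" for z
    unfolding S_def using poly_conj_reflect_unit[OF assms(1) that]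
    by (simp add: poly_monom algebra_simps complex_norm_square del: of_real_power)
  have "degree S \<le> 2 * n"
    unfolding S_def using assms(1) degree_conj_reflect[of n P] degree_mult_le[of P "conj_reflect n P"]
    by (intro degree_diff_le order_trans[OF degree_monom_le]) auto
  moreover have "\<exists>r>0. poly S z = of_real r * z ^ n" if "cmod z = 1" for z
    using assms(2)[OF that] S[OF that]
    by (intro exI[where x = "1 - (cmod (poly P z))\<^sup>2"]) (simp add: power_less_one_iff)
  ultimately obtain Q where Q: "degree Q \<le> n"
    "\<And>z. cmod z = 1 \<Longrightarrow> poly S z = of_real ((cmod (poly Q z))\<^sup>2) * z ^ n"
    using fejer_riesz by blast
  have "(cmod (poly P z))\<^sup>2 + (cmod (poly Q z))\<^sup>2 = 1" if z: "cmod z = 1" for z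
  proof -
    have "z ^ n \<noteq> 0" using z by auto
    then have "complex_of_real (1 - (cmod (poly P z))\<^sup>2) = of_real ((cmod (poly Q z))\<^sup>2)"
      using S[OF z] Q(2)[OF z] by (metis mult_right_cancel)
    then show ?thesis
      unfolding of_real_eq_iff by simp
  qed
  then show ?thesis
    using Q(1) by (auto simp: unit_pair_def)
qed

text \<open>A step applies the controlled walk, which multiplies the second component by the
  indeterminate, followed by the rotation with first column \<open>(\<alpha>, \<beta>)\<close>.\<close>

fun qsp_polys :: "(complex \<times> complex) list \<Rightarrow> complex poly \<times> complex poly" where
  "qsp_polys [] = (1, 0)"
| "qsp_polys ((\<alpha>, \<beta>) # xs) = (let (P, Q) = qsp_polys xs in
     (smult \<alpha> P - smult (cnj \<beta>) (pCons 0 Q), smult \<beta> P + smult (cnj \<alpha>) (pCons 0 Q)))"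

text \<open>Compares constant coefficients in \<open>|P|^2 + |Q|^2 = 1\<close>, rewritten with
  reciprocal polynomials: the vectors of lowest and of highest coefficients are orthogonal in C^2.
  This is what lets a single rotation clear both ends of the pair.\<close>

lemma unit_pair_edge_coeffs:
  assumes "unit_pair P Q" "degree P \<le> Suc n" "degree Q \<le> Suc n"
  shows "coeff P 0 * cnj (coeff P (Suc n)) + coeff Q 0 * cnj (coeff Q (Suc n)) = 0"
proof -
  let ?r = "conj_reflect (Suc n)"
  have "P * ?r P + Q * ?r Q = monom 1 (Suc n)"
  proof (rule poly_eq_on_unit_circle)
    fix z :: complex assume z: "cmod z = 1"
    have "poly (P * ?r P + Q * ?r Q) z =
        z ^ Suc n * of_real ((cmod (poly P z))\<^sup>2 + (cmod (poly Q z))\<^sup>2)"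
      using poly_conj_reflect_unit[OF assms(2) z] poly_conj_reflect_unit[OF assms(3) z]
      by (simp add: complex_norm_square algebra_simps del: of_real_power)
    also have "(cmod (poly P z))\<^sup>2 + (cmod (poly Q z))\<^sup>2 = 1"
      using assms(1) z by (simp add: unit_pair_def)
    finally show "poly (P * ?r P + Q * ?r Q) z = poly (monom 1 (Suc n)) z"
      by (simp add: poly_monom)
  qed
  then have "coeff (P * ?r P + Q * ?r Q) 0 = 0"
    by simp
  then show ?thesis
    by (simp add: coeff_mult coeff_conj_reflect)
qed

text \<open>Take the unit vector parallel to (a, b); orthogonality then annihilates (c, d). If (a,
  b) = 0, a unit vector orthogonal to (c, d) does it.\<close>

lemma unit_vector_killing:
  fixes a b c d :: complex
  assumes "a * cnj c + b * cnj d = 0"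
  shows "\<exists>\<alpha> \<beta>. (cmod \<alpha>)\<^sup>2 + (cmod \<beta>)\<^sup>2 = 1 \<and> \<alpha> * b = \<beta> * a \<and> cnj \<alpha> * c + cnj \<beta> * d = 0"
proof -
  have normalize: "\<exists>\<nu>>0. (cmod (x / of_real \<nu>))\<^sup>2 + (cmod (y / of_real \<nu>))\<^sup>2 = 1" if "x \<noteq> 0 \<or> y \<noteq> 0" for x y :: complex
  proof -
    let ?\<nu> = "sqrt ((cmod x)\<^sup>2 + (cmod y)\<^sup>2)"
    have "(cmod x)\<^sup>2 + (cmod y)\<^sup>2 > 0"
      using that by (simp add: sum_power2_gt_zero_iff)
    then show ?thesis
      by (intro exI[where x = ?\<nu>])
         (auto simp: norm_divide power_divide add_divide_distrib[symmetric])
  qed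
  consider "a \<noteq> 0 \<or> b \<noteq> 0" | "a = 0" "b = 0" "c \<noteq> 0 \<or> d \<noteq> 0" | "a = 0" "b = 0" "c = 0" "d = 0"
    by auto
  then show ?thesis
  proof cases
    case 1
    obtain \<nu> where \<nu>: "\<nu> > 0" "(cmod (a / of_real \<nu>))\<^sup>2 + (cmod (b / of_real \<nu>))\<^sup>2 = 1"
      using normalize[OF 1] by auto
    have "cnj (a * cnj c + b * cnj d) = 0"
      using assms by simp
    then have "cnj a * c + cnj b * d = 0"
      by simp
    then show ?thesis
      using \<nu> by (intro exI[where x = "a / of_real \<nu>"] exI[where x = "b / of_real \<nu>"])
        (simp add: add_divide_distrib[symmetric])
  next
    case 2
    obtain \<nu> where \<nu>: "\<nu> > 0" "(cmod (- cnj d / of_real \<nu>))\<^sup>2 + (cmod (cnj c / of_real \<nu>))\<^sup>2 = 1"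
      using normalize[of "- cnj d" "cnj c"] 2 by auto
    then show ?thesis
      using 2 by (intro exI[where x = "- cnj d / of_real \<nu>"] exI[where x = "cnj c / of_real \<nu>"]) simp
  next
    case 3
    then show ?thesis
      by - (rule exI[of _ 1], rule exI[of _ 0], simp)
  qed
qed

text \<open>The inverse rotation is chosen such that the second component loses its constant
  coefficient, so that the controlled walk can be undone by dividing by the indeterminate, and the
  first component loses its leading coefficient. Both degree bounds drop by one; the constant pair
  at the end costs one more rotation, whence \<open>Suc n\<close>.\<close>

lemma qsp_polys_complete:
  assumes "unit_pair P Q" "degree P \<le> n" "degree Q \<le> n"
  shows "\<exists>xs. length xs = Suc n \<and> (\<forall>(\<alpha>, \<beta>)\<in>set xs. (cmod \<alpha>)\<^sup>2 + (cmod \<beta>)\<^sup>2 = 1) \<and> qsp_polys xs = (P, Q)"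
  using assms
proof (induction n arbitrary: P Q)
  case 0
  then obtain a b where ab: "P = [:a:]" "Q = [:b:]"
    by (metis degree_eq_zeroE le_zero_eq)
  then have "(cmod a)\<^sup>2 + (cmod b)\<^sup>2 = 1"
    using 0(1) by (auto simp: unit_pair_def dest!: spec[of _ 1])
  then show ?case
    using ab by (intro exI[where x = "[(a, b)]"]) (simp add: one_pCons)
next
  case (Suc n)
  obtain \<alpha> \<beta> where u: "(cmod \<alpha>)\<^sup>2 + (cmod \<beta>)\<^sup>2 = 1"
    and k: "\<alpha> * coeff Q 0 = \<beta> * coeff P 0" "cnj \<alpha> * coeff P (Suc n) + cnj \<beta> * coeff Q (Suc n) = 0"
    using unit_vector_killing[OF unit_pair_edge_coeffs[OF Suc.prems]] by auto
  define P' where "P' = smult (cnj \<alpha>) P + smult (cnj \<beta>) Q"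
  define Q' where "Q' = smult \<alpha> Q - smult \<beta> P"
  have "coeff P' (Suc n) = 0"
    using k(2) by (simp add: P'_def)
  moreover have "degree P' \<le> Suc n"
    unfolding P'_def using Suc.prems by (intro degree_add_le order_trans[OF degree_smult_le])
  ultimately have degP: "degree P' \<le> n"
    by (metis degree_0 le_SucE leading_coeff_0_iff le0)
  have "coeff Q' 0 = 0"
    using k(1) by (simp add: Q'_def)
  then obtain Q1 where Q1: "Q' = pCons 0 Q1"
    by (cases Q') auto
  have "degree Q' \<le> Suc n"
    unfolding Q'_def using Suc.prems by (intro degree_diff_le order_trans[OF degree_smult_le])
  then have degQ: "degree Q1 \<le> n"
    using Q1 by (cases "Q1 = 0") auto
  have u': "\<alpha> * cnj \<alpha> + \<beta> * cnj \<beta> = 1"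
    using arg_cong[OF u, of complex_of_real] by (simp add: complex_norm_square del: of_real_power)
  have "unit_pair P' Q1"
    unfolding unit_pair_def
  proof (intro allI impI)
    fix z :: complex assume z: "cmod z = 1"
    let ?p = "poly P z" and ?q = "poly Q z"
    have "cmod (poly Q' z) = cmod (poly Q1 z)"
      using z by (simp add: Q1 norm_mult)
    moreover have "complex_of_real ((cmod (poly P' z))\<^sup>2 + (cmod (poly Q' z))\<^sup>2) =
        (\<alpha> * cnj \<alpha> + \<beta> * cnj \<beta>) * of_real ((cmod ?p)\<^sup>2 + (cmod ?q)\<^sup>2)"
      by (simp add: P'_def Q'_def complex_norm_square algebra_simps del: of_real_power)
    moreover have "(cmod ?p)\<^sup>2 + (cmod ?q)\<^sup>2 = 1"
      using Suc.prems(1) z by (simp add: unit_pair_def)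
    ultimately show "(cmod (poly P' z))\<^sup>2 + (cmod (poly Q1 z))\<^sup>2 = 1"
      unfolding u' by (metis mult_1 of_real_eq_iff)
  qed
  then obtain xs where xs: "length xs = Suc n" "\<forall>(\<alpha>, \<beta>)\<in>set xs. (cmod \<alpha>)\<^sup>2 + (cmod \<beta>)\<^sup>2 = 1"
    "qsp_polys xs = (P', Q1)"
    using Suc.IH[OF _ degP degQ] by blast
  have "smult \<alpha> P' - smult (cnj \<beta>) Q' = smult (\<alpha> * cnj \<alpha> + \<beta> * cnj \<beta>) P"
    by (simp add: P'_def Q'_def smult_add_right smult_diff_right smult_add_left mult.commute)
  moreover have "smult \<beta> P' + smult (cnj \<alpha>) Q' = smult (\<alpha> * cnj \<alpha> + \<beta> * cnj \<beta>) Q"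
    by (simp add: P'_def Q'_def smult_add_right smult_diff_right smult_add_left mult.commute)
  ultimately have "qsp_polys ((\<alpha>, \<beta>) # xs) = (P, Q)"
    using xs(3) u' by (simp add: Q1)
  then show ?case
    using xs u by (intro exI[where x = "(\<alpha>, \<beta>) # xs"]) auto
qed

section \<open>Polynomials in the walk operator\<close>

definition lin :: "(('a \<Rightarrow> complex) \<Rightarrow> 'a \<Rightarrow> complex) \<Rightarrow> bool" where
  "lin U \<longleftrightarrow> (\<forall>x y f g. U (\<lambda>b. x * f b + y * g b) = (\<lambda>b. x * U f b + y * U g b))"

lemma linD: "lin U \<Longrightarrow> U (\<lambda>b. x * f b + y * g b) = (\<lambda>b. x * U f b + y * U g b)"
  by (simp add: lin_def)

lemma lin_scale: "lin U \<Longrightarrow> U (\<lambda>b. x * f b) = (\<lambda>b. x * U f b)"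
  using linD[of U x f 0 f] by simp

lemma lin_sum: "lin U \<Longrightarrow> U (\<lambda>b. \<Sum>i\<in>A. c i * f i b) = (\<lambda>b. \<Sum>i\<in>A. c i * U (f i) b)"
proof (induction A rule: infinite_finite_induct)
  case (insert i A)
  then show ?case
    using linD[of U "c i" "f i" 1 "\<lambda>b. \<Sum>i\<in>A. c i * f i b"] by simp
qed (use lin_scale[of U 0 "\<lambda>b. 0"] in auto)

lemma lin_funpow: "lin U \<Longrightarrow> lin (U ^^ n)"
  by (induction n) (simp_all add: lin_def)

definition op_poly :: "(('a \<Rightarrow> complex) \<Rightarrow> 'a \<Rightarrow> complex) \<Rightarrow> complex poly \<Rightarrow> ('a \<Rightarrow> complex) \<Rightarrow> 'a \<Rightarrow> complex" where
  "op_poly U p f = (\<lambda>b. \<Sum>i\<le>degree p. coeff p i * (U ^^ i) f b)"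

lemma op_poly_le:
  assumes "degree p \<le> n"
  shows "op_poly U p f = (\<lambda>b. \<Sum>i\<le>n. coeff p i * (U ^^ i) f b)"
  unfolding op_poly_def using assms
  by (intro ext sum.mono_neutral_left) (auto simp: coeff_eq_0)

lemma op_poly_0 [simp]: "op_poly U 0 f = (\<lambda>b. 0)"
  by (simp add: op_poly_def)

lemma op_poly_1 [simp]: "op_poly U 1 f = f"
  by (simp add: op_poly_def)

lemma op_poly_add: "op_poly U (p + q) f = (\<lambda>b. op_poly U p f b + op_poly U q f b)"
proof -
  let ?n = "max (degree p) (degree q)"
  have "degree (p + q) \<le> ?n" "degree p \<le> ?n" "degree q \<le> ?n"
    using degree_add_le_max by auto
  then show ?thesis
    by (simp add: op_poly_le[where n = ?n] sum.distrib algebra_simps)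
qed

lemma op_poly_smult: "op_poly U (smult c p) f = (\<lambda>b. c * op_poly U p f b)"
  using op_poly_le[OF degree_smult_le[of c p], of U f]
  by (simp add: op_poly_def sum_distrib_left mult.assoc)

lemma op_poly_diff: "op_poly U (p - q) f = (\<lambda>b. op_poly U p f b - op_poly U q f b)"
  using op_poly_add[of U p "smult (-1) q" f] op_poly_smult[of U "-1" q f] by simp

lemma op_poly_sum: "op_poly U (\<Sum>i\<in>A. p i) f = (\<lambda>b. \<Sum>i\<in>A. op_poly U (p i) f b)"
  by (induction A rule: infinite_finite_induct) (simp_all add: op_poly_add)

lemma op_poly_pCons_0:
  assumes "lin U"
  shows "op_poly U (pCons 0 p) f = U (op_poly U p f)"
proof -
  have "op_poly U (pCons 0 p) f = (\<lambda>b. \<Sum>i\<le>Suc (degree p). coeff (pCons 0 p) i * (U ^^ i) f b)"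
    by (rule op_poly_le) (rule degree_pCons_le)
  also have "\<dots> = (\<lambda>b. \<Sum>i\<le>degree p. coeff p i * U ((U ^^ i) f) b)"
    by (simp add: sum.atMost_Suc_shift del: sum.atMost_Suc)
  also have "\<dots> = U (op_poly U p f)"
    by (simp add: op_poly_def lin_sum[OF assms])
  finally show ?thesis .
qed

lemma op_poly_monom_mult:
  assumes "lin U"
  shows "op_poly U (monom 1 n * p) f = (U ^^ n) (op_poly U p f)"
proof (induction n)
  case (Suc n)
  have "monom 1 (Suc n) * p = pCons 0 (monom 1 n * p)"
    by (simp add: monom_Suc)
  then show ?case
    using Suc op_poly_pCons_0[OF assms] by simp
qed (simp add: one_pCons[symmetric])

text \<open>On e the relation replaces \<open>1 + U^2\<close> by \<open>2 x U\<close>; as powers of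
  U commute with this, each further factor contributes another \<open>2 x U\<close>.\<close>

lemma op_poly_cosine_power:
  assumes "lin U" "\<And>b. U (U e) b + e b = 2 * x * U e b"
  shows "op_poly U ([:1, 0, 1:] ^ k) e = (\<lambda>b. (2 * x) ^ k * (U ^^ k) e b)"
proof (induction k)
  case (Suc k)
  have "[:1, 0, 1:] ^ Suc k = ([:1, 0, 1:] ^ k + pCons 0 (pCons 0 ([:1, 0, 1:] ^ k)) :: complex poly)"
    by simp
  then have "op_poly U ([:1, 0, 1:] ^ Suc k) e =
      (\<lambda>b. (2 * x) ^ k * ((U ^^ k) e b + U (U ((U ^^ k) e)) b))"
    using Suc by (simp only: op_poly_add op_poly_pCons_0[OF assms(1)] lin_scale[OF assms(1)])
      (simp add: algebra_simps)
  also have "\<dots> = (\<lambda>b. (2 * x) ^ k * (U ^^ k) (\<lambda>b. 1 * e b + 1 * U (U e) b) b)"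
    unfolding linD[OF lin_funpow[OF assms(1)]] by (simp add: funpow_swap1)
  also have "(\<lambda>b. 1 * e b + 1 * U (U e) b) = (\<lambda>b. 2 * x * U e b)"
    using assms(2) by (simp add: add.commute)
  also have "(U ^^ k) (\<lambda>b. 2 * x * U e b) = (\<lambda>b. 2 * x * (U ^^ Suc k) e b)"
    unfolding lin_scale[OF lin_funpow[OF assms(1)]] by (simp add: funpow_swap1)
  finally show ?case
    by (simp add: algebra_simps)
qed simp

text \<open>\<open>z ^ n\<close> times the polynomial \<open>\<Sum>k\<le>n. a k * x ^ k\<close> in \<open>x = (z + 1 / z) / 2\<close>.\<close>

definition cosine_poly :: "nat \<Rightarrow> (nat \<Rightarrow> complex) \<Rightarrow> complex poly" where
  "cosine_poly n a = (\<Sum>k\<le>n. smult (a k / 2 ^ k) (monom 1 (n - k) * [:1, 0, 1:] ^ k))"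

lemma degree_cosine_poly: "degree (cosine_poly n a) \<le> 2 * n"
  unfolding cosine_poly_def
proof (intro degree_sum_le order_trans[OF degree_smult_le])
  fix k assume "k \<in> {..n}"
  have "degree ([:1, 0, 1:] ^ k :: complex poly) \<le> 2 * k"
    using degree_power_le[of "[:1, 0, 1:] :: complex poly" k] by simp
  moreover have "degree (monom 1 (n - k) :: complex poly) \<le> n - k"
    by (rule degree_monom_le)
  ultimately show "degree (monom 1 (n - k) * [:1, 0, 1:] ^ k :: complex poly) \<le> 2 * n"
    using degree_mult_le[of "monom 1 (n - k)" "[:1, 0, 1:] ^ k :: complex poly"] \<open>k \<in> {..n}\<close> by auto
qed simp

text \<open>On the circle \<open>1 + z^2 = 2 (Re z) z\<close>, the scalar counterpart of the walk
  relation with x = Re z. This evaluation serves to bound the polynomial, whereas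
  \<open>op_poly_cosine_poly\<close> tells what it does to the walk.\<close>

lemma poly_cosine_poly:
  assumes "cmod z = 1"
  shows "poly (cosine_poly n a) z = z ^ n * (\<Sum>k\<le>n. a k * of_real (Re z) ^ k)"
proof -
  have "cnj z + z = of_real (2 * Re z)"
    using complex_add_cnj[of z] by (simp add: add.commute)
  then have "of_real (2 * Re z) * z = 1 + z\<^sup>2"
    using cnj_unit(1)[OF assms] by (metis distrib_right power2_eq_square)
  then have *: "poly [:1, 0, 1:] z = 2 * of_real (Re z) * z"
    by (simp add: power2_eq_square)
  have "poly (cosine_poly n a) z =
      (\<Sum>k\<le>n. a k / 2 ^ k * (z ^ (n - k) * (2 * of_real (Re z) * z) ^ k))"
    unfolding cosine_poly_def poly_sum poly_smult poly_mult poly_power poly_monom * by simp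
  also have "\<dots> = (\<Sum>k\<le>n. z ^ n * (a k * of_real (Re z) ^ k))"
  proof (rule sum.cong)
    fix k assume "k \<in> {..n}"
    then have "z ^ n = z ^ (n - k) * z ^ k"
      by (simp flip: power_add)
    then show "a k / 2 ^ k * (z ^ (n - k) * (2 * of_real (Re z) * z) ^ k) =
        z ^ n * (a k * of_real (Re z) ^ k)"
      by (simp add: power_mult_distrib)
  qed simp
  finally show ?thesis
    by (simp add: sum_distrib_left)
qed

lemma op_poly_cosine_poly:
  assumes "lin U" "\<And>b. U (U e) b + e b = 2 * x * U e b"
  shows "op_poly U (cosine_poly n a) e = (\<lambda>b. (\<Sum>k\<le>n. a k * x ^ k) * (U ^^ n) e b)"
proof
  fix b
  have "op_poly U (cosine_poly n a) e b =
      (\<Sum>k\<le>n. a k / 2 ^ k * (U ^^ (n - k)) (\<lambda>b. (2 * x) ^ k * (U ^^ k) e b) b)"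
    unfolding cosine_poly_def op_poly_sum op_poly_smult op_poly_monom_mult[OF assms(1)]
      op_poly_cosine_power[OF assms] ..
  also have "\<dots> = (\<Sum>k\<le>n. a k * x ^ k * (U ^^ n) e b)"
  proof (rule sum.cong)
    fix k assume "k \<in> {..n}"
    then have "U ^^ n = U ^^ (n - k) \<circ> U ^^ k"
      by (simp flip: funpow_add)
    then show "a k / 2 ^ k * (U ^^ (n - k)) (\<lambda>b. (2 * x) ^ k * (U ^^ k) e b) b = a k * x ^ k * (U ^^ n) e b"
      unfolding lin_scale[OF lin_funpow[OF assms(1)]] by (simp add: power_mult_distrib)
  qed simp
  finally show "op_poly U (cosine_poly n a) e b = (\<Sum>k\<le>n. a k * x ^ k) * (U ^^ n) e b"
    by (simp add: sum_distrib_right)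
qed

text \<open>Term number m > n of the tail is enlarged by the factor exp (m - n), which is at least
  1; this turns the tail into exp (- n) times a part of the series of exp (e T). A degree linear in
  T and in the logarithm of the accuracy therefore suffices.\<close>

lemma exp_taylor_error:
  fixes y :: complex
  assumes "cmod y \<le> T"
  shows "cmod ((\<Sum>k\<le>n. y ^ k / fact k) - exp y) \<le> exp (exp 1 * T - n)"
proof -
  let ?f = "\<lambda>k. y ^ k / fact k"
  let ?g = "\<lambda>k. exp (- real n) * ((exp 1 * T) ^ k / fact k)"
  have T: "0 \<le> T"
    using assms norm_ge_zero order_trans by blast
  have f: "?f sums exp y"
    using exp_converges[of y] by (simp add: scaleR_conv_of_real divide_inverse mult.commute)
  have g: "?g sums (exp (- real n) * exp (exp 1 * T))"
    using exp_converges[of "exp 1 * T"] by (intro sums_mult) (simp add: divide_inverse mult.commute)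
  have le: "cmod (?f (k + Suc n)) \<le> ?g (k + Suc n)" for k
  proof -
    have "cmod (?f m) \<le> T ^ m / fact m" for m
      using assms by (simp add: norm_divide norm_power divide_right_mono power_mono)
    then have "cmod (?f (k + Suc n)) \<le> T ^ (k + Suc n) / fact (k + Suc n)" .
    also have "\<dots> \<le> exp (real (Suc k)) * (T ^ (k + Suc n) / fact (k + Suc n))"
      using mult_right_mono[of 1 "exp (real (Suc k))" "T ^ (k + Suc n) / fact (k + Suc n)"] T
      by (simp del: fact_Suc power_Suc)
    also have "exp (real (Suc k)) = exp (- real n) * exp 1 ^ (k + Suc n)"
      by (simp add: exp_of_nat_mult[symmetric] exp_add[symmetric] del: power_Suc)
    finally have "cmod (?f (k + Suc n)) \<le> exp (- real n) * exp 1 ^ (k + Suc n) * (T ^ (k + Suc n) / fact (k + Suc n))" .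
    moreover have "exp 1 ^ m * (T ^ m / fact m) = (exp 1 * T) ^ m / fact m" for m
      by (simp add: power_mult_distrib)
    ultimately show ?thesis
      by (metis mult.assoc)
  qed
  have gs: "summable (\<lambda>k. ?g (k + Suc n))"
    using g by (intro summable_ignore_initial_segment) (rule sums_summable)
  have "exp y = (\<Sum>k. ?f (k + Suc n)) + (\<Sum>k<Suc n. ?f k)"
    using suminf_split_initial_segment[OF sums_summable[OF f], of "Suc n"] sums_unique[OF f] by simp
  then have "cmod ((\<Sum>k\<le>n. ?f k) - exp y) = cmod (\<Sum>k. ?f (k + Suc n))"
    by (simp add: lessThan_Suc_atMost norm_minus_commute del: fact_Suc power_Suc sum.lessThan_Suc)
  also have "\<dots> \<le> (\<Sum>k. ?g (k + Suc n))"
    using le gs by (rule norm_suminf_le)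
  also have "\<dots> \<le> (\<Sum>k. ?g (k + Suc n)) + (\<Sum>k<Suc n. ?g k)"
    using T by (intro add_increasing2 sum_nonneg) auto
  also have "\<dots> = exp (- real n) * exp (exp 1 * T)"
    using suminf_split_initial_segment[OF sums_summable[OF g], of "Suc n"] sums_unique[OF g] by simp
  finally show ?thesis
    by (simp add: exp_add[symmetric])
qed

text \<open>The quantifiers over x, U and e come after the choice of the angles and of g, so one
  sequence serves all Fourier modes and all oracles.\<close>

lemma evolution_angles:
  assumes "0 < \<delta>" "\<delta> < 1" "\<delta> < T" "16 * (T / \<delta> powr (3 / 2)) \<le> real D"
  shows "\<exists>xs g. length xs = Suc (2 * D) \<and> (\<forall>(\<alpha>, \<beta>)\<in>set xs. (cmod \<alpha>)\<^sup>2 + (cmod \<beta>)\<^sup>2 = 1) \<and>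
    (\<forall>x. \<bar>x\<bar> \<le> 1 \<longrightarrow> cmod (g x - exp (- \<i> * of_real (T * x))) \<le> \<delta>\<^sup>2 / 2) \<and>
    (\<forall>(U :: ('a \<Rightarrow> complex) \<Rightarrow> 'a \<Rightarrow> complex) e x. lin U \<longrightarrow> (\<forall>b. U (U e) b + e b = 2 * of_real x * U e b) \<longrightarrow>
      op_poly U (fst (qsp_polys xs)) e = (\<lambda>b. g x * (U ^^ D) e b))"
proof -
  \<comment> \<open>81 is 3 ^ 4, from the estimate \<open>(3 * ?B) ^ 4 \<le> exp (12 * ?B)\<close>
    below; the total error 3 \<epsilon> then stays below \<delta>^2 / 2.\<close>
  define \<epsilon> where "\<epsilon> = \<delta>\<^sup>2 / 81"
  define S where "S = (\<lambda>x::real. \<Sum>k\<le>D. (- \<i> * of_real T) ^ k / fact k * of_real x ^ k)"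
  \<comment> \<open>On [-1, 1] the truncated series is bounded by 1 + \<epsilon>, so division by 1 +
    2 \<epsilon> makes it strictly smaller than 1.\<close>
  define a where "a = (\<lambda>k. (- \<i> * of_real T) ^ k / fact k / of_real (1 + 2 * \<epsilon>))"
  define g where "g = (\<lambda>x::real. \<Sum>k\<le>D. a k * of_real x ^ k)"
  have \<epsilon>: "\<epsilon> > 0"
    using assms by (simp add: \<epsilon>_def)
  have g: "g x = S x / of_real (1 + 2 * \<epsilon>)" for x
    by (simp add: g_def a_def S_def sum_divide_distrib)
  let ?B = "T / \<delta> powr (3 / 2)"
  have pw: "\<delta> powr (3 / 2) = \<delta> * sqrt \<delta>"
    using assms powr_add[of \<delta> 1 "1/2"] by (simp add: powr_half_sqrt)
  have "sqrt \<delta> \<le> 1"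
    using assms by simp
  then have "\<delta> powr (3 / 2) \<le> 1"
    using assms by (simp add: pw mult_le_one)
  then have BT: "T \<le> ?B"
    using assms by (simp add: le_divide_eq mult_left_le)
  \<comment> \<open>Here \<delta> < T enters: it makes \<open>?B\<close> large for small \<delta>,
    so that its fourth power dominates 1 / \<delta>^2.\<close>
  have "1 / sqrt \<delta> \<le> ?B"
    using assms by (simp add: pw divide_simps)
  then have "(1 / sqrt \<delta>) ^ 4 \<le> ?B ^ 4"
    using assms by (intro power_mono) auto
  moreover have "sqrt \<delta> ^ 4 = \<delta>\<^sup>2"
    using assms power_mult[of "sqrt \<delta>" 2 2] by simp
  ultimately have B4: "1 / \<delta>\<^sup>2 \<le> ?B ^ 4"
    by (simp add: power_divide)
  have "3 * ?B \<le> exp (3 * ?B)"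
    using exp_ge_add_one_self[of "3 * ?B"] by linarith
  then have "(3 * ?B) ^ 4 \<le> exp (3 * ?B) ^ 4"
    using assms by (intro power_mono) auto
  moreover have "exp (3 * ?B) ^ 4 = exp (12 * ?B)"
    by (simp add: exp_of_nat_mult[symmetric])
  moreover have "(3 * ?B) ^ 4 = 81 * ?B ^ 4"
    by (simp only: power_mult_distrib) simp
  ultimately have "81 * ?B ^ 4 \<le> exp (12 * ?B)"
    by simp
  then have "81 / \<delta>\<^sup>2 \<le> exp (12 * ?B)"
    using B4 by linarith
  then have "exp (- (12 * ?B)) \<le> \<epsilon>"
    using assms by (simp add: \<epsilon>_def exp_minus field_simps)
  \<comment> \<open>As e \<le> 3, the growth of the series costs 3 ?B and the accuracy 12 ?B, which
    the 16 ?B of the assumption cover.\<close>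
  moreover have "exp 1 * T - D \<le> - (12 * ?B)"
  proof -
    have "exp 1 * T \<le> 3 * ?B"
      using exp_le BT assms by (intro mult_mono) auto
    then show ?thesis
      using assms(4) BT assms(1,3) by linarith
  qed
  ultimately have tail: "exp (exp 1 * T - D) \<le> \<epsilon>"
    using order_trans exp_le_cancel_iff by metis
  have S: "cmod (S x - exp (- \<i> * of_real (T * x))) \<le> \<epsilon>" if "\<bar>x\<bar> \<le> 1" for x
  proof -
    let ?y = "- \<i> * of_real (T * x)"
    have "cmod ?y \<le> T"
      using that assms by (simp add: norm_mult abs_mult mult_left_le)
    moreover have y: "?y = (- \<i> * of_real T) * of_real x"
      by simp
    have "?y ^ k = (- \<i> * of_real T) ^ k * of_real x ^ k" for k
      unfolding y by (rule power_mult_distrib)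
    then have "S x = (\<Sum>k\<le>D. ?y ^ k / fact k)"
      unfolding S_def by (intro sum.cong refl) (metis times_divide_eq_left)
    ultimately show ?thesis
      using exp_taylor_error[of ?y T D] tail by simp
  qed
  have nexp: "cmod (exp (- \<i> * of_real y)) = 1" for y
    by (simp add: norm_exp_eq_Re)
  have "cmod (poly (cosine_poly D a) z) < 1" if z: "cmod z = 1" for z
  proof -
    have "\<bar>Re z\<bar> \<le> 1"
      using abs_Re_le_cmod[of z] z by simp
    then have "cmod (S (Re z)) \<le> 1 + \<epsilon>"
      using S[of "Re z"] nexp[of "T * Re z"] norm_triangle_ineq2[of "S (Re z)"] by (smt (verit))
    then show ?thesis
      using z \<epsilon> poly_cosine_poly[OF z, of D a] g[of "Re z"]
      by (simp add: g_def norm_mult norm_power norm_divide del: of_real_add of_real_mult)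
  qed
  then obtain Q where "degree Q \<le> 2 * D" "unit_pair (cosine_poly D a) Q"
    using complementary_poly[OF degree_cosine_poly] by blast
  then obtain xs where xs: "length xs = Suc (2 * D)" "\<forall>(\<alpha>, \<beta>)\<in>set xs. (cmod \<alpha>)\<^sup>2 + (cmod \<beta>)\<^sup>2 = 1"
    "qsp_polys xs = (cosine_poly D a, Q)"
    using qsp_polys_complete[OF _ degree_cosine_poly] by blast
  have "cmod (g x - exp (- \<i> * of_real (T * x))) \<le> \<delta>\<^sup>2 / 2" if "\<bar>x\<bar> \<le> 1" for x
  proof -
    let ?e = "exp (- \<i> * of_real (T * x))"
    have "g x - ?e = ((S x - ?e) - of_real (2 * \<epsilon>) * ?e) / of_real (1 + 2 * \<epsilon>)"
      using \<epsilon> by (simp add: g field_simps del: of_real_add of_real_mult) (simp add: algebra_simps)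
    then have "cmod (g x - ?e) = cmod ((S x - ?e) - of_real (2 * \<epsilon>) * ?e) / (1 + 2 * \<epsilon>)"
      using \<epsilon> by (simp add: norm_divide del: of_real_add of_real_mult)
    also have "\<dots> \<le> cmod ((S x - ?e) - of_real (2 * \<epsilon>) * ?e)"
      using \<epsilon> mult_left_mono[of 1 "1 + 2 * \<epsilon>", OF _ norm_ge_zero]
      by (subst pos_divide_le_eq) auto
    also have "\<dots> \<le> \<epsilon> + 2 * \<epsilon>"
      using S[OF that] \<epsilon> norm_triangle_ineq4[of "S x - ?e" "of_real (2 * \<epsilon>) * ?e"]
      by (simp add: norm_mult nexp del: of_real_add of_real_mult)
    finally show ?thesis
      using zero_le_power2[of \<delta>] unfolding \<epsilon>_def by linarith
  qed
  moreover have "op_poly U (fst (qsp_polys xs)) e = (\<lambda>b. g x * (U ^^ D) e b)"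
    if "lin U" "\<forall>b. U (U e) b + e b = 2 * of_real x * U e b"
    for U :: "('a \<Rightarrow> complex) \<Rightarrow> 'a \<Rightarrow> complex" and e x
    using op_poly_cosine_poly[OF that(1), of e "of_real x" D a] that(2) xs(3) by (simp add: g_def)
  ultimately show ?thesis
    using xs(1,2) by blast
qed

section \<open>Elementary gates\<close>

definition mat2 :: "complex \<Rightarrow> complex \<Rightarrow> complex \<Rightarrow> complex \<Rightarrow> complex mat" where
  "mat2 a b c d = mat 2 2 (\<lambda>(i, j). if i = 0 then if j = 0 then a else b else if j = 0 then c else d)"

lemma mat2_carrier [simp]: "mat2 a b c d \<in> carrier_mat 2 2"
  by (simp add: mat2_def)

lemma less_2_iff: "(i :: nat) < 2 \<longleftrightarrow> i = 0 \<or> i = 1"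
  by auto

lemma mat_adjoint_mat2 [simp]: "mat_adjoint (mat2 a b c d) = mat2 (cnj a) (cnj c) (cnj b) (cnj d)"
  by (rule eq_matI) (auto simp: mat2_def)

lemma mat2_mult: "mat2 a b c d * mat2 a' b' c' d' =
    mat2 (a * a' + b * c') (a * b' + b * d') (c * a' + d * c') (c * b' + d * d')"
  by (rule eq_matI) (auto simp: mat2_def scalar_prod_def less_2_iff numeral_2_eq_2)

lemma mat2_one: "1\<^sub>m 2 = mat2 1 0 0 1"
  by (rule eq_matI) (auto simp: mat2_def)

lemma unitary_mat2:
  assumes "cnj a * a + cnj c * c = 1" "cnj b * b + cnj d * d = 1" "cnj a * b + cnj c * d = 0"
    "a * cnj a + b * cnj b = 1" "c * cnj c + d * cnj d = 1" "a * cnj c + b * cnj d = 0"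
  shows "unitary_mat 2 (mat2 a b c d)"
proof -
  have "cnj b * a + cnj d * c = 0" "c * cnj a + d * cnj b = 0"
    using arg_cong[OF assms(3), of cnj] arg_cong[OF assms(6), of cnj] by (simp_all add: mult.commute)
  then show ?thesis
    using assms by (simp add: unitary_mat_def mat2_mult mat2_one)
qed

definition "x_mat = mat2 0 1 1 0"
definition "z_mat = mat2 1 0 0 (-1)"
definition "h_mat = mat2 (1 / of_real (sqrt 2)) (1 / of_real (sqrt 2)) (1 / of_real (sqrt 2)) (- 1 / of_real (sqrt 2))"
definition "sqrt_x_mat = mat2 ((1 + \<i>) / 2) ((1 - \<i>) / 2) ((1 - \<i>) / 2) ((1 + \<i>) / 2)"
definition "phase_mat \<theta> = mat2 1 0 0 (cis \<theta>)"
definition "rot_mat \<alpha> \<beta> = mat2 \<alpha> (- cnj \<beta>) \<beta> (cnj \<alpha>)"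

lemma sqrt2_sq: "complex_of_real (sqrt 2) * complex_of_real (sqrt 2) = 2"
  by (simp flip: of_real_mult)

lemma gate_unitary [simp]:
  "unitary_mat 2 x_mat" "unitary_mat 2 z_mat" "unitary_mat 2 h_mat" "unitary_mat 2 sqrt_x_mat"
  "unitary_mat 2 (phase_mat \<theta>)"
  unfolding x_mat_def z_mat_def h_mat_def sqrt_x_mat_def phase_mat_def
  by (intro unitary_mat2; simp add: sqrt2_sq field_simps cis_cnj cis_mult; fail)+

lemma rot_unitary:
  assumes "(cmod \<alpha>)\<^sup>2 + (cmod \<beta>)\<^sup>2 = 1"
  shows "unitary_mat 2 (rot_mat \<alpha> \<beta>)"
proof -
  have "\<alpha> * cnj \<alpha> + \<beta> * cnj \<beta> = 1"
    using arg_cong[OF assms, of complex_of_real] by (simp add: complex_norm_square del: of_real_power)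
  then show ?thesis
    unfolding rot_mat_def by (intro unitary_mat2) (simp_all add: mult.commute add.commute)
qed

abbreviation gate :: "nat \<Rightarrow> complex mat \<Rightarrow> instr" where
  "gate q U \<equiv> Gate [q] U"

abbreviation cgate :: "nat \<Rightarrow> nat \<Rightarrow> complex mat \<Rightarrow> instr" where
  "cgate p q U \<equiv> Gate [q, p] (controlled U)"

lemma wf_cgate: "p \<noteq> q \<Longrightarrow> p < n \<Longrightarrow> q < n \<Longrightarrow> unitary_mat 2 U \<Longrightarrow> wf_instr L n (cgate p q U)"
  using unitary_mat_controlled[of 2 U] by (simp add: power2_eq_square)

lemma app_mat2: "app [q] (mat2 x y z u) f b =
   (if b q then z * f (b(q := False)) + u * f (b(q := True))
    else x * f (b(q := False)) + y * f (b(q := True)))"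
  by (simp add: app_def mat2_def numeral_2_eq_2)

lemma app_cgate:
  "p \<noteq> q \<Longrightarrow> U \<in> carrier_mat 2 2 \<Longrightarrow> app [q, p] (controlled U) f b = (if b p then app [q] U f b else f b)"
  using app_controlled[of U "[q]" p f b] by simp

lemma sem_x: "instr_sem X (gate q x_mat) f = (\<lambda>b. f (b(q := \<not> b q)))"
  by (rule ext) (simp add: x_mat_def app_mat2)

lemma sem_z: "instr_sem X (gate q z_mat) f = (\<lambda>b. (if b q then -1 else 1) * f b)"
  by (rule ext) (simp add: z_mat_def app_mat2 fun_upd_idem)

lemma sem_h: "instr_sem X (gate q h_mat) f =
    (\<lambda>b. (f (b(q := False)) + (if b q then -1 else 1) * f (b(q := True))) / of_real (sqrt 2))"
  by (rule ext) (simp add: h_mat_def app_mat2 add_divide_distrib diff_divide_distrib)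

lemma sem_cx: "p \<noteq> q \<Longrightarrow> instr_sem X (cgate p q x_mat) f = (\<lambda>b. f (b(q := (b q \<noteq> b p))))"
  by (rule ext) (auto simp: app_cgate x_mat_def app_mat2 fun_upd_idem)

lemma sem_cz: "p \<noteq> q \<Longrightarrow> instr_sem X (cgate p q z_mat) f = (\<lambda>b. (if b p \<and> b q then -1 else 1) * f b)"
  by (rule ext) (auto simp: app_cgate z_mat_def app_mat2 fun_upd_idem)

lemma sem_cphase: "p \<noteq> q \<Longrightarrow>
    instr_sem X (cgate p q (phase_mat \<theta>)) f = (\<lambda>b. (if b p \<and> b q then cis \<theta> else 1) * f b)"
  by (rule ext) (auto simp: app_cgate phase_mat_def app_mat2 fun_upd_idem)

lemma sem_ch: "p \<noteq> q \<Longrightarrow> instr_sem X (cgate p q h_mat) f =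
    (\<lambda>b. if b p then (f (b(q := False)) + (if b q then -1 else 1) * f (b(q := True))) / of_real (sqrt 2)
      else f b)"
  by (rule ext) (auto simp: app_cgate h_mat_def app_mat2 add_divide_distrib diff_divide_distrib)

section \<open>Circuits of controlled phases\<close>

definition phases :: "(nat \<times> nat \<times> real) list \<Rightarrow> circuit" where
  "phases ps = map (\<lambda>(p, q, \<theta>). cgate p q (phase_mat \<theta>)) ps"

definition total_phase :: "(nat \<times> nat \<times> real) list \<Rightarrow> (nat \<Rightarrow> bool) \<Rightarrow> real" where
  "total_phase ps b = (\<Sum>(p, q, \<theta>)\<leftarrow>ps. of_bool (b p) * of_bool (b q) * \<theta>)"

lemma sem_phases:
  assumes "\<forall>(p, q, \<theta>)\<in>set ps. p \<noteq> q"
  shows "sem X (phases ps) f = (\<lambda>b. cis (total_phase ps b) * f b)"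
  using assms
proof (induction ps arbitrary: f)
  case (Cons x ps)
  obtain p q \<theta> where x: "x = (p, q, \<theta>)"
    by (cases x)
  have "sem X (phases (x # ps)) f = sem X (phases ps) (\<lambda>b. (if b p \<and> b q then cis \<theta> else 1) * f b)"
    using Cons.prems x sem_cphase[of p q] by (simp add: phases_def)
  also have "\<dots> = (\<lambda>b. cis (total_phase ps b) * ((if b p \<and> b q then cis \<theta> else 1) * f b))"
    using Cons by simp
  also have "\<dots> = (\<lambda>b. cis (total_phase (x # ps) b) * f b)"
    by (auto simp: x total_phase_def cis_mult[symmetric])
  finally show ?case .
qed (simp add: phases_def total_phase_def)

lemma wf_phases:
  assumes "\<And>p q \<theta>. (p, q, \<theta>) \<in> set ps \<Longrightarrow> p \<noteq> q \<and> p < n \<and> q < n"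
  shows "wf_circuit L n (phases ps)"
  unfolding wf_circuit_def
proof
  fix g assume "g \<in> set (phases ps)"
  then obtain p q \<theta> where "(p, q, \<theta>) \<in> set ps" and g: "g = cgate p q (phase_mat \<theta>)"
    by (auto simp: phases_def)
  then show "wf_instr L n g"
    unfolding g using assms gate_unitary(5) by (intro wf_cgate) blast+
qed

lemma sem_inv_phases:
  assumes "unitary_mat (2 ^ L) X" "\<And>p q \<theta>. (p, q, \<theta>) \<in> set ps \<Longrightarrow> p \<noteq> q \<and> p < n \<and> q < n"
  shows "sem X (inv_circuit (phases ps)) f = (\<lambda>b. cis (- total_phase ps b) * f b)"
proof -
  have "sem X (phases ps) (\<lambda>b. cis (- total_phase ps b) * f b) = f"
    using assms(2) by (subst sem_phases) (auto simp: mult.assoc[symmetric] cis_mult)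
  then show ?thesis
    using sem_inv_eqI[OF wf_phases[where L = L and n = n and ps = ps] assms(1)] assms(2) by blast
qed

lemma count_phases [simp]: "gate_count (phases ps) = length ps" "call_count (phases ps) = 0"
  by (induction ps) (auto simp: phases_def)

lemma qubits_phases: "\<Union> (qubits ` set (phases ps)) = (\<Union>(p, q, \<theta>)\<in>set ps. {p, q})"
  by (auto simp: phases_def)

text \<open>The square root of \<open>X\<close> is applied to \<open>t\<close> once for each of \<open>q\<close>, \<open>p \<noteq> q\<close> and \<open>p\<close> that holds:
  either never or exactly twice.\<close>

definition or_gate :: "nat \<Rightarrow> nat \<Rightarrow> nat \<Rightarrow> circuit" where
  "or_gate p q t = [cgate q t sqrt_x_mat, cgate p q x_mat, cgate q t sqrt_x_mat,
     cgate p q x_mat, cgate p t sqrt_x_mat]"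

lemma sem_sqrt_x: "p \<noteq> q \<Longrightarrow> instr_sem X (cgate p q sqrt_x_mat) f =
    (\<lambda>b. if b p then (1 + \<i>) / 2 * f b + (1 - \<i>) / 2 * f (b(q := \<not> b q)) else f b)"
  by (rule ext) (auto simp: app_cgate sqrt_x_mat_def app_mat2 fun_upd_idem)

lemma sem_or_gate:
  assumes "distinct [p, q, t]"
  shows "sem X (or_gate p q t) f = (\<lambda>b. f (b(t := (b t \<noteq> (b p \<or> b q)))))"
proof
  fix b
  define fl where "fl = (\<lambda>b :: nat \<Rightarrow> bool. b(t := \<not> b t))"
  define cn where "cn = (\<lambda>b :: nat \<Rightarrow> bool. b(q := (b q \<noteq> b p)))"
  have pqt: "q \<noteq> t" "p \<noteq> q" "p \<noteq> t" "t \<noteq> q"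
    using assms by auto
  have fl: "fl (fl b) = b" "cn (cn b) = b" "cn (fl b) = fl (cn b)"
    "fl b p = b p" "fl b q = b q" "cn b p = b p" "cn b q = (b q \<noteq> b p)" for b
    using pqt by (auto simp: fl_def cn_def fun_eq_iff)
  \<comment> \<open>The entries of \<open>sqrt_x_mat\<close>; the identities \<open>uu\<close> say
    that its square is the bit flip.\<close>
  define u v where "u = (1 + \<i>) / 2" and "v = (1 - \<i>) / 2"
  have uu: "u * u + v * v = 0" "2 * (u * v) = 1"
    by (simp_all add: u_def v_def algebra_simps add_divide_distrib[symmetric])
  have "u * (u * x + v * y) + v * (u * y + v * x) = (u * u + v * v) * x + 2 * (u * v) * y" for x y
    by (simp add: algebra_simps)
  then have uv: "u * (u * x + v * y) + v * (u * y + v * x) = y" for x y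
    unfolding uu by simp
  have V: "instr_sem X (cgate p t sqrt_x_mat) f = (\<lambda>b. if b p then u * f b + v * f (fl b) else f b)"
    if "p \<noteq> t" for f p
    unfolding fl_def u_def v_def by (rule sem_sqrt_x[OF that])
  have C: "instr_sem X (cgate p q x_mat) f = (\<lambda>b. f (cn b))" for f
    unfolding cn_def by (rule sem_cx[OF pqt(2)])
  have "sem X (or_gate p q t) f b = (if b p \<or> b q then f (fl b) else f b)"
    unfolding or_gate_def sem.simps V[OF pqt(1)] V[OF pqt(3)] C fl
    by (cases "b p"; cases "b q") (simp_all add: fl uv)
  also have "\<dots> = f (b(t := (b t \<noteq> (b p \<or> b q))))"
    by (auto simp: fl_def fun_upd_idem)
  finally show "sem X (or_gate p q t) f b = f (b(t := (b t \<noteq> (b p \<or> b q))))" .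
qed

lemma wf_or_gate: "distinct [p, q, t] \<Longrightarrow> p < n \<Longrightarrow> q < n \<Longrightarrow> t < n \<Longrightarrow> wf_circuit L n (or_gate p q t)"
  by (simp add: or_gate_def wf_cgate del: wf_instr.simps)

text \<open>A carry chain: ancilla \<open>Suc c\<close> receives the disjunction of ancilla c and
  the next listed qubit. This builds a test of many qubits from two-qubit gates, with one fresh
  ancilla for each listed qubit.\<close>

fun ladder :: "nat \<Rightarrow> nat list \<Rightarrow> circuit" where
  "ladder c [] = []"
| "ladder c (q # qs) = or_gate c q (Suc c) @ ladder (Suc c) qs"

fun ladder_bits :: "nat \<Rightarrow> nat list \<Rightarrow> (nat \<Rightarrow> bool) \<Rightarrow> nat \<Rightarrow> bool" where
  "ladder_bits c [] b = b"
| "ladder_bits c (q # qs) b = ladder_bits (Suc c) qs (b(Suc c := (b (Suc c) \<noteq> (b c \<or> b q))))"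

lemma wf_ladder:
  assumes "\<And>q. q \<in> set qs \<Longrightarrow> q < c" "c + length qs < n"
  shows "wf_circuit L n (ladder c qs)"
  using assms
proof (induction qs arbitrary: c)
  case (Cons q qs)
  have "wf_circuit L n (ladder (Suc c) qs)"
    using Cons.prems by (intro Cons.IH) (auto simp: less_Suc_eq)
  moreover have "q < c"
    using Cons.prems(1)[of q] by simp
  ultimately show ?case
    using Cons.prems(2) wf_or_gate[of c q "Suc c" n L] by simp
qed simp

text \<open>Each disjunction gate acts on amplitude functions as the pullback along an involution,
  and pulling back reverses the order of composition. The inverse ladder therefore corresponds to
  the forward map on assignments.\<close>

lemma sem_inv_ladder:
  assumes "unitary_mat (2 ^ L) X" "\<And>q. q \<in> set qs \<Longrightarrow> q < c"
  shows "sem X (inv_circuit (ladder c qs)) f = (\<lambda>b. f (ladder_bits c qs b))"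
  using assms(2)
proof (induction qs arbitrary: c f)
  case (Cons q qs)
  let ?t = "\<lambda>b. b(Suc c := (b (Suc c) \<noteq> (b c \<or> b q)))"
  have d: "distinct [c, q, Suc c]"
    using Cons.prems[of q] by auto
  have inv: "inv_circuit (ladder c (q # qs)) = inv_circuit (ladder (Suc c) qs) @ inv_circuit (or_gate c q (Suc c))"
    by (simp add: inv_circuit_def)
  have or_inv: "sem X (inv_circuit (or_gate c q (Suc c))) g = (\<lambda>b. g (?t b))" for g
  proof -
    have "sem X (or_gate c q (Suc c)) (\<lambda>b. g (?t b)) = g"
      unfolding sem_or_gate[OF d] using d by (intro ext arg_cong[where f = g]) (auto simp: fun_eq_iff)
    moreover have "wf_circuit L (c + q + 2) (or_gate c q (Suc c))"
      using d by (intro wf_or_gate) auto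
    ultimately show ?thesis
      using sem_inv_eqI[OF _ assms(1)] by blast
  qed
  have "sem X (inv_circuit (ladder (Suc c) qs)) f = (\<lambda>b. f (ladder_bits (Suc c) qs b))"
    using Cons.prems by (intro Cons.IH) (auto simp: less_Suc_eq)
  then show ?case
    unfolding inv sem_append or_inv by simp
qed (simp add: inv_circuit_def)

text \<open>On a clean ancilla, the exclusive or with a disjunction simply stores the disjunction;
  ancilla c seeds the chain.\<close>

lemma ladder_bits_flag:
  assumes "\<And>q. q \<in> set qs \<Longrightarrow> q < c" "\<And>q. c < q \<Longrightarrow> q \<le> c + length qs \<Longrightarrow> \<not> b q"
  shows "ladder_bits c qs b (c + length qs) \<longleftrightarrow> b c \<or> (\<exists>q\<in>set qs. b q)"
  using assms
proof (induction qs arbitrary: c b)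
  case (Cons q qs)
  let ?b = "b(Suc c := (b (Suc c) \<noteq> (b c \<or> b q)))"
  have "ladder_bits (Suc c) qs ?b (Suc c + length qs) \<longleftrightarrow> ?b (Suc c) \<or> (\<exists>q\<in>set qs. ?b q)"
    using Cons.prems by (intro Cons.IH) (auto simp: less_Suc_eq)
  moreover have "\<not> b (Suc c)"
    using Cons.prems(2)[of "Suc c"] by simp
  moreover have "?b q' = b q'" if "q' \<in> set qs" for q'
    using Cons.prems(1)[of q'] that by auto
  ultimately show ?case
    by auto
qed simp

lemma count_ladder [simp]: "gate_count (ladder c qs) = 5 * length qs" "call_count (ladder c qs) = 0"
  by (induction qs arbitrary: c) (auto simp: or_gate_def)

lemma qubits_ladder: "\<Union> (qubits ` set (ladder c qs)) \<subseteq> set qs \<union> {c..c + length qs}"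
  by (induction qs arbitrary: c) (fastforce simp: or_gate_def)+

section \<open>The controlled walk\<close>

text \<open>Labelling the Fourier modes by reversed indices saves the swaps at the end of the usual circuit
  for the Fourier transform.\<close>

definition rev_reg :: "nat \<Rightarrow> (nat \<Rightarrow> bool) \<Rightarrow> nat" where
  "rev_reg L b = (\<Sum>p<L. of_bool (b p) * 2 ^ (L - 1 - p))"

lemma reg_shift_eq_sum: "reg [m..<m + L] b = (\<Sum>l<L. of_bool (b (m + l)) * 2 ^ l)"
proof (induction L)
  case (Suc L)
  have "[m..<m + Suc L] = [m..<m + L] @ [m + L]"
    by simp
  then show ?case
    using Suc by (simp add: reg_append)
qed simp

text \<open>At an assignment where the qubits are zero every Hadamard contributes with positive
  sign, so the amplitude is the plain sum over the register.\<close>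

lemma sem_ch_zero:
  assumes "distinct (w # qs)" "b w" "\<And>q. q \<in> set qs \<Longrightarrow> \<not> b q"
  shows "sem X (map (\<lambda>q. cgate w q h_mat) qs) f b =
    (\<Sum>j<2 ^ length qs. f (upd qs j b)) / of_real (sqrt 2) ^ length qs"
  using assms
proof (induction qs arbitrary: f)
  case (Cons q qs)
  have wq: "w \<noteq> q"
    using Cons.prems by auto
  have A: "sem X (map (\<lambda>q. cgate w q h_mat) (q # qs)) f b =
      (\<Sum>j<2 ^ length qs. instr_sem X (cgate w q h_mat) f (upd qs j b)) / of_real (sqrt 2) ^ length qs"
    using Cons.prems by (simp add: Cons.IH del: instr_sem.simps)
  have B: "instr_sem X (cgate w q h_mat) f (upd qs j b) =
      (f (upd (q # qs) (2 * j) b) + f (upd (q # qs) (2 * j + 1) b)) / of_real (sqrt 2)" for j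
    using Cons.prems unfolding sem_ch[OF wq] by simp
  show ?case
    unfolding A B length_Cons sum_lessThan_Cons by (simp add: sum_divide_distrib[symmetric] mult.commute)
qed simp

text \<open>The transpose of \<open>sem_ch_zero\<close>: a state supported at zero becomes uniform
  over the register.\<close>

lemma sem_ch_support:
  assumes "distinct (w # qs)" "b w" "\<And>b q. b w \<Longrightarrow> q \<in> set qs \<Longrightarrow> b q \<Longrightarrow> f b = 0"
  shows "sem X (map (\<lambda>q. cgate w q h_mat) qs) f b = f (upd qs 0 b) / of_real (sqrt 2) ^ length qs"
  using assms
proof (induction qs arbitrary: f)
  case (Cons q qs)
  have wq: "w \<noteq> q"
    using Cons.prems by auto
  let ?g = "instr_sem X (cgate w q h_mat) f"
  have g: "?g b' = f (b'(q := False)) / of_real (sqrt 2)" if "b' w" for b'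
  proof -
    have "f (b'(q := True)) = 0"
      by (rule Cons.prems(3)) (use that wq in auto)
    then show ?thesis
      unfolding sem_ch[OF wq] using that by simp
  qed
  have "sem X (map (\<lambda>q. cgate w q h_mat) (q # qs)) f b = ?g (upd qs 0 b) / of_real (sqrt 2) ^ length qs"
  proof -
    have "?g b' = 0" if "b' w" "q' \<in> set qs" "b' q'" for b' q'
    proof -
      have "f (b'(q := False)) = 0"
        by (rule Cons.prems(3)[of _ q']) (use Cons.prems(1) that wq in auto)
      then show ?thesis
        using g[of b', OF that(1)] by simp
    qed
    then show ?thesis
      using Cons.prems(1,2) by (simp add: Cons.IH del: instr_sem.simps)
  qed
  also have "?g (upd qs 0 b) = f (upd (q # qs) 0 b) / of_real (sqrt 2)"
    using Cons.prems by (subst g) auto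
  finally show ?case
    by (simp add: mult.commute del: upd.simps)
qed simp

lemma sem_ch_off:
  assumes "\<not> b w" "w \<notin> set qs"
  shows "sem X (map (\<lambda>q. cgate w q h_mat) qs) f b = f b"
  using assms
proof (induction qs arbitrary: f)
  case (Cons q qs)
  have wq: "w \<noteq> q"
    using Cons.prems by auto
  show ?case
    using Cons by (simp add: sem_ch[OF wq] del: instr_sem.simps)
qed simp

section \<open>States split by a control qubit\<close>

definition indep :: "nat \<Rightarrow> state \<Rightarrow> bool" where
  "indep q f \<longleftrightarrow> (\<forall>b v. f (b(q := v)) = f b)"

lemma sem_indep:
  assumes "q \<notin> \<Union> (qubits ` set G)" "indep q f"
  shows "indep q (sem X G f)"
proof -
  have "(\<lambda>b. f (b(q := v))) = f" for v
    using assms(2) by (auto simp: indep_def)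
  then have "sem X G f (b(q := v)) = sem X G f b" for b v
    using sem_shift[OF assms(1), of X f v] by metis
  then show ?thesis
    by (simp add: indep_def)
qed

definition sel :: "nat \<Rightarrow> state \<Rightarrow> state \<Rightarrow> state" where
  "sel s g0 g1 = (\<lambda>b. if b s then g1 b else g0 b)"

text \<open>Linearity separates the two components, and the indicator of each value of s passes
  through the circuit by \<open>sem_local\<close>.\<close>

lemma sem_sel:
  assumes "s \<notin> \<Union> (qubits ` set G)"
  shows "sem X G (sel s g0 g1) = sel s (sem X G g0) (sem X G g1)"
proof -
  have l: "sem X G (\<lambda>b. of_bool (P (b s)) * f b) = (\<lambda>b. of_bool (P (b s)) * sem X G f b)" for P f
    by (rule sem_local[where S = "- {s}"]) (use assms in auto)
  have "sel s g0 g1 = (\<lambda>b. 1 * (of_bool (\<not> b s) * g0 b) + 1 * (of_bool (b s) * g1 b))"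
    by (auto simp: sel_def)
  then have "sem X G (sel s g0 g1) = (\<lambda>b. 1 * sem X G (\<lambda>b. of_bool (\<not> b s) * g0 b) b +
      1 * sem X G (\<lambda>b. of_bool (b s) * g1 b) b)"
    by (simp only: sem_linear)
  then show ?thesis
    unfolding l[of Not] l[of "\<lambda>x. x"] by (auto simp: sel_def)
qed

lemma sem_rot_sel:
  assumes "indep s g0" "indep s g1"
  shows "instr_sem X (gate s (rot_mat \<alpha> \<beta>)) (sel s g0 g1) =
    sel s (\<lambda>b. \<alpha> * g0 b - cnj \<beta> * g1 b) (\<lambda>b. \<beta> * g0 b + cnj \<alpha> * g1 b)"
  using assms by (intro ext) (simp add: sel_def rot_mat_def app_mat2 indep_def)

locale black_box =
  fixes L :: nat and X :: "complex mat"
  assumes unitary_X: "unitary_mat (2 ^ L) X"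
begin

text \<open>The qubits below \<open>L\<close> hold the Fourier mode. The ladder occupies the ancillas \<open>2 * L + 2, \<dots>, 3 * L + 3\<close>,
  and its last qubit is the flag.\<close>

definition "regM = [L..<2 * L]"
definition "walk_bit = 2 * L"
definition "sig = 2 * L + 1"
definition "flag = 3 * L + 3"
definition "width = 3 * L + 4"

text \<open>One gate for each pair of a mode bit, of reversed weight \<open>2 ^ (L - 1 - p)\<close>,
  and a register bit of weight \<open>2 ^ l\<close>: the product of the two numbers is bilinear in
  their bits.\<close>

definition "phase_list =
  concat (map (\<lambda>p. map (\<lambda>l. (p, L + l, 2 * pi * 2 ^ (L - 1 - p) * 2 ^ l / 2 ^ L)) [0..<L]) [0..<L])"

definition "had_circuit = map (\<lambda>q. cgate walk_bit q h_mat) regM"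

text \<open>The phases are not controlled on \<open>walk_bit\<close>, which keeps them two-qubit
  gates: starting from a cleared register, the branch where that qubit is off still has register 0,
  and there they multiply by 1.\<close>

definition "prep = [gate walk_bit h_mat, Call walk_bit regM] @ phases phase_list @ had_circuit"

definition "flip_circuit = prep @ [gate walk_bit x_mat] @ inv_circuit prep"
definition "cflip_circuit = prep @ [cgate sig walk_bit x_mat] @ inv_circuit prep"
definition "zero_ladder = ladder (2 * L + 2) (regM @ [walk_bit])"
definition "refl_circuit = zero_ladder @ [gate flag z_mat] @ inv_circuit zero_ladder"
definition "crefl_circuit = zero_ladder @ [cgate sig flag z_mat] @ inv_circuit zero_ladder"
definition "walk = flip_circuit @ refl_circuit"
definition "cwalk = cflip_circuit @ crefl_circuit"

lemmas layout = regM_def walk_bit_def sig_def flag_def width_def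

lemma length_regM [simp]: "length regM = L" "distinct regM"
  by (simp_all add: regM_def)

lemma set_regM: "set regM = {L..<2 * L}"
  by (simp add: regM_def)

lemma phase_list_mem:
  assumes "(p, q, \<theta>) \<in> set phase_list"
  shows "p < L \<and> q \<in> {L..<2 * L}"
  using assms by (auto simp: phase_list_def)

lemma phase_list_ok: "(p, q, \<theta>) \<in> set phase_list \<Longrightarrow> p \<noteq> q \<and> p < width \<and> q < width"
  using phase_list_mem[of p q \<theta>] by (auto simp: width_def)

lemma wf_prep: "wf_circuit L width prep"
proof -
  have "wf_circuit L width had_circuit"
    unfolding wf_circuit_def had_circuit_def by (auto simp: layout intro!: wf_cgate simp del: wf_instr.simps)
  then show ?thesis
    unfolding prep_def using wf_phases[of phase_list width L] phase_list_ok
    by (auto simp: layout)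
qed

lemma wf_zero_ladder: "wf_circuit L width zero_ladder"
  unfolding zero_ladder_def by (rule wf_ladder) (auto simp: layout)

lemma wf_walk: "wf_circuit L width walk" "wf_circuit L width cwalk"
proof -
  have "wf_circuit L width flip_circuit"
    using wf_prep by (simp add: flip_circuit_def layout)
  moreover have "wf_circuit L width refl_circuit"
    using wf_zero_ladder by (simp add: refl_circuit_def layout)
  moreover have "wf_circuit L width cflip_circuit"
    using wf_prep wf_cgate[of sig walk_bit width x_mat L] by (simp add: cflip_circuit_def layout del: wf_instr.simps)
  moreover have "wf_circuit L width crefl_circuit"
    using wf_zero_ladder wf_cgate[of sig flag width z_mat L] by (simp add: crefl_circuit_def layout del: wf_instr.simps)
  ultimately show "wf_circuit L width walk" "wf_circuit L width cwalk"
    by (simp_all add: walk_def cwalk_def)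
qed

lemma gate_count_prep: "gate_count prep = 1 + L * L + L" "call_count prep = 1"
proof -
  have "gate_count (map (\<lambda>q. cgate walk_bit q h_mat) xs) = length xs"
    "call_count (map (\<lambda>q. cgate walk_bit q h_mat) xs) = 0" for xs
    by (induction xs) auto
  moreover have "length phase_list = L * L"
    by (simp add: phase_list_def length_concat comp_def sum_list_triv)
  ultimately show "gate_count prep = 1 + L * L + L" "call_count prep = 1"
    by (simp_all add: prep_def had_circuit_def)
qed

text \<open>Two copies of \<open>prep\<close>, two ladders of \<open>5 * (L + 1)\<close> gates and
  two middle gates; the quadratic term comes from the phases.\<close>

lemma count_walk:
  "gate_count walk = 14 + 12 * L + 2 * L * L" "call_count walk = 2"
  "gate_count cwalk = 14 + 12 * L + 2 * L * L" "call_count cwalk = 2"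
  by (simp_all add: walk_def cwalk_def flip_circuit_def cflip_circuit_def refl_circuit_def
      crefl_circuit_def zero_ladder_def gate_count_prep)

lemma qubits_prep: "\<Union> (qubits ` set prep) \<subseteq> {..2 * L}"
proof -
  have "\<Union> (qubits ` set (phases phase_list)) \<subseteq> {..2 * L}"
    unfolding qubits_phases using phase_list_mem by fastforce
  then show ?thesis
    by (auto simp: prep_def had_circuit_def layout)
qed

lemma qubits_zero_ladder: "\<Union> (qubits ` set zero_ladder) \<subseteq> - {sig}"
  unfolding zero_ladder_def using qubits_ladder[of "2 * L + 2" "regM @ [walk_bit]"] by (auto simp: layout)

lemma sig_notin:
  "sig \<notin> \<Union> (qubits ` set prep)" "sig \<notin> \<Union> (qubits ` set (inv_circuit prep))"
  "sig \<notin> \<Union> (qubits ` set zero_ladder)" "sig \<notin> \<Union> (qubits ` set (inv_circuit zero_ladder))"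
  using qubits_prep qubits_zero_ladder unfolding qubits_inv_circuit by (auto simp: sig_def)

lemma sig_notin_walk:
  "sig \<notin> \<Union> (qubits ` set flip_circuit)" "sig \<notin> \<Union> (qubits ` set walk)"
  "sig \<notin> \<Union> (qubits ` set (inv_circuit walk))"
proof -
  show f: "sig \<notin> \<Union> (qubits ` set flip_circuit)"
    using sig_notin by (auto simp: flip_circuit_def layout simp del: qubits_inv_circuit)
  show w: "sig \<notin> \<Union> (qubits ` set walk)"
    using sig_notin f by (auto simp: walk_def refl_circuit_def layout)
  show "sig \<notin> \<Union> (qubits ` set (inv_circuit walk))"
    using w unfolding qubits_inv_circuit .
qed

lemma sem_inv_prep [simp]: "sem X (inv_circuit prep) (sem X prep f) = f" "sem X prep (sem X (inv_circuit prep) f) = f"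
  using sem_inv[OF wf_prep unitary_X] sem_inv'[OF wf_prep unitary_X] by auto

lemma sem_inv_zero_ladder [simp]: "sem X (inv_circuit zero_ladder) (sem X zero_ladder f) = f"
  using sem_inv[OF wf_zero_ladder unitary_X] by auto

text \<open>In a conjugation only the middle gate has to be controlled: with \<open>sig\<close> off,
  the outer circuits cancel.\<close>

lemma sem_cwalk: "sem X cwalk (sel sig g0 g1) = sel sig g0 (sem X walk g1)"
proof -
  have x: "instr_sem X (cgate sig walk_bit x_mat) (sel sig f0 f1) = sel sig f0 (instr_sem X (gate walk_bit x_mat) f1)" for f0 f1
    using sem_cx[of sig walk_bit X] by (auto simp: sem_x sel_def layout simp del: instr_sem.simps)
  have z: "instr_sem X (cgate sig flag z_mat) (sel sig f0 f1) = sel sig f0 (instr_sem X (gate flag z_mat) f1)" for f0 f1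
    using sem_cz[of sig flag X] by (auto simp: sem_z sel_def layout simp del: instr_sem.simps)
  show ?thesis
    by (simp only: cwalk_def walk_def cflip_circuit_def flip_circuit_def crefl_circuit_def refl_circuit_def
        sem_append sem.simps x z sem_inv_prep sem_inv_zero_ladder
        sem_sel[OF sig_notin(1)] sem_sel[OF sig_notin(2)] sem_sel[OF sig_notin(3)] sem_sel[OF sig_notin(4)])
qed

fun qsp_circuit :: "(complex \<times> complex) list \<Rightarrow> circuit" where
  "qsp_circuit [] = []"
| "qsp_circuit ((\<alpha>, \<beta>) # xs) = qsp_circuit xs @ cwalk @ [gate sig (rot_mat \<alpha> \<beta>)]"

lemma wf_qsp_circuit:
  "\<forall>(\<alpha>, \<beta>)\<in>set xs. (cmod \<alpha>)\<^sup>2 + (cmod \<beta>)\<^sup>2 = 1 \<Longrightarrow> wf_circuit L width (qsp_circuit xs)"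
proof (induction xs)
  case (Cons x xs)
  then show ?case
    using wf_walk rot_unitary by (cases x) (auto simp: layout)
qed simp

lemma count_qsp_circuit:
  "gate_count (qsp_circuit xs) = (15 + 12 * L + 2 * L * L) * length xs"
  "call_count (qsp_circuit xs) = 2 * length xs"
  by (induction xs rule: qsp_circuit.induct) (simp_all add: count_walk algebra_simps)

lemma lin_walk: "lin (sem X walk)"
  by (simp add: lin_def sem_linear)

lemma indep_op_poly: "indep sig e \<Longrightarrow> indep sig (op_poly (sem X walk) p e)"
proof -
  assume e: "indep sig e"
  have "indep sig ((sem X walk ^^ i) e)" for i
    by (induction i) (use e sem_indep[OF sig_notin_walk(2)] in auto)
  then show ?thesis
    by (simp add: indep_def op_poly_def)
qed

text \<open>The invariant of the sequence: the components at \<open>sig\<close> are P(U) e and Q(U)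
  e. The controlled walk multiplies Q by the indeterminate, and the rotation is the matrix in the
  recursion of \<open>qsp_polys\<close>.\<close>

lemma sem_qsp_circuit:
  assumes "indep sig e"
  shows "sem X (qsp_circuit xs) (sel sig e (\<lambda>b. 0)) =
    sel sig (op_poly (sem X walk) (fst (qsp_polys xs)) e) (op_poly (sem X walk) (snd (qsp_polys xs)) e)"
proof (induction xs rule: qsp_circuit.induct)
  case (2 \<alpha> \<beta> xs)
  obtain P Q where PQ: "qsp_polys xs = (P, Q)"
    by (cases "qsp_polys xs")
  have "sem X (qsp_circuit ((\<alpha>, \<beta>) # xs)) (sel sig e (\<lambda>b. 0)) =
      instr_sem X (gate sig (rot_mat \<alpha> \<beta>)) (sel sig (op_poly (sem X walk) P e) (op_poly (sem X walk) (pCons 0 Q) e))"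
    using 2 PQ by (simp add: sem_append sem_cwalk op_poly_pCons_0[OF lin_walk] del: instr_sem.simps)
  also have "\<dots> = sel sig (op_poly (sem X walk) (fst (qsp_polys ((\<alpha>, \<beta>) # xs))) e)
      (op_poly (sem X walk) (snd (qsp_polys ((\<alpha>, \<beta>) # xs))) e)"
    by (simp only: sem_rot_sel indep_op_poly assms qsp_polys.simps PQ Let_def prod.case fst_conv snd_conv
        op_poly_add op_poly_diff op_poly_smult)
  finally show ?case .
qed simp

text \<open>\<open>cosine_poly\<close> carries a factor z ^ D that makes it a polynomial; the D
  inverse walks remove it. They run uncontrolled, since the result is read off only where
  \<open>sig\<close> is off.\<close>

definition "core D xs = qsp_circuit xs @ concat (replicate D (inv_circuit walk))"

lemma sem_core:
  assumes "indep sig e" "op_poly (sem X walk) (fst (qsp_polys xs)) e = (\<lambda>b. g * (sem X walk ^^ D) e b)" "\<not> b sig"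
  shows "sem X (core D xs) (sel sig e (\<lambda>b. 0)) b = g * e b"
proof -
  let ?Ui = "sem X (inv_circuit walk)"
  have rep: "sem X (concat (replicate D (inv_circuit walk))) = ?Ui ^^ D"
    by (induction D) (auto simp: sem_append fun_eq_iff funpow_swap1)
  have sel: "(?Ui ^^ D) (sel sig g0 g1) = sel sig ((?Ui ^^ D) g0) ((?Ui ^^ D) g1)" for g0 g1
    by (induction D) (auto simp: sem_sel[OF sig_notin_walk(3)])
  have inv: "(?Ui ^^ D) ((sem X walk ^^ D) e) = e"
  proof (induction D)
    case (Suc D)
    have "(?Ui ^^ Suc D) ((sem X walk ^^ Suc D) e) = (?Ui ^^ D) (?Ui (sem X walk ((sem X walk ^^ D) e)))"
      by (simp add: funpow_swap1)
    then show ?case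
      using Suc sem_inv[OF wf_walk(1) unitary_X] by simp
  qed simp
  have "lin ?Ui"
    by (simp add: lin_def sem_linear)
  then have "(?Ui ^^ D) (\<lambda>b. g * (sem X walk ^^ D) e b) = (\<lambda>b. g * e b)"
    using lin_scale[OF lin_funpow] inv by metis
  then have "sem X (core D xs) (sel sig e (\<lambda>b. 0)) = sel sig (\<lambda>b. g * e b)
      ((?Ui ^^ D) (op_poly (sem X walk) (snd (qsp_polys xs)) e))"
    by (simp only: core_def sem_append rep sem_qsp_circuit[OF assms(1)] sel assms(2))
  then show ?thesis
    using assms(3) by (simp add: sel_def)
qed

end

section \<open>The walk relation\<close>

lemma reg_eq_0_iff: "reg qs b = 0 \<longleftrightarrow> (\<forall>q\<in>set qs. \<not> b q)"
  by (induction qs) auto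

lemma mat_adjoint_h [simp]: "mat_adjoint h_mat = h_mat"
  by (simp add: h_mat_def)

lemma mat_adjoint_ch [simp]: "mat_adjoint (controlled h_mat) = controlled h_mat"
  by (subst mat_adjoint_controlled[where n = 2]) (auto simp: h_mat_def)

lemma sum_list_concat_map: "sum_list (map f (concat (map g xs))) = (\<Sum>x\<leftarrow>xs. sum_list (map f (g x)))"
  for f :: "'b \<Rightarrow> 'c :: monoid_add"
  by (induction xs) auto

context black_box
begin

lemma total_phase_list: "total_phase phase_list b = 2 * pi * real (reg regM b * rev_reg L b) / 2 ^ L"
proof -
  have "total_phase phase_list b =
      (\<Sum>p<L. \<Sum>l<L. of_bool (b p) * of_bool (b (L + l)) * (2 * pi * 2 ^ (L - 1 - p) * 2 ^ l / 2 ^ L))"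
    by (simp add: total_phase_def phase_list_def sum_list_concat_map comp_def
        interv_sum_list_conv_sum_set_nat atLeast0LessThan)
  also have "\<dots> = (\<Sum>p<L. \<Sum>l<L. 2 * pi / 2 ^ L * (of_bool (b p) * 2 ^ (L - 1 - p) * (of_bool (b (L + l)) * 2 ^ l)))"
    by (intro sum.cong refl) simp
  also have "\<dots> = 2 * pi / 2 ^ L * ((\<Sum>p<L. of_bool (b p) * 2 ^ (L - 1 - p)) * (\<Sum>l<L. of_bool (b (L + l)) * 2 ^ l))"
    unfolding sum_product by (simp only: sum_distrib_left)
  also have "(\<Sum>p<L. of_bool (b p) * 2 ^ (L - 1 - p)) = real (rev_reg L b)"
    by (simp add: rev_reg_def)
  also have "(\<Sum>l<L. of_bool (b (L + l)) * 2 ^ l) = real (reg regM b)"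
    using reg_shift_eq_sum[of L L b] by (simp add: regM_def mult_2)
  finally show ?thesis
    by simp
qed

text \<open>The qubit \<open>sig\<close> is left free in \<open>basis k\<close>, since \<open>sel sig\<close> combines one state for each of its values.\<close>

definition basis :: "nat \<Rightarrow> state" where
  "basis k = (\<lambda>b. of_bool (\<forall>q. q \<noteq> sig \<longrightarrow> b q = bit k q))"

text \<open>The factor of \<open>basis k\<close> on the mode qubits and the ladder ancillas; the
  preparation passes it through unchanged.\<close>

definition rest :: "nat \<Rightarrow> state" where
  "rest k = (\<lambda>b. of_bool (\<forall>q. q \<notin> insert sig (insert walk_bit (set regM)) \<longrightarrow> b q = bit k q))"

text \<open>The amplitude at zero of the oracle state after the phases of mode k and the Hadamards.
  It is an eigenvalue of C divided by sqrt N, see \<open>amp_eq_circulant_eig\<close>.\<close>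

definition amp :: "nat \<Rightarrow> complex" where
  "amp k = (\<Sum>j<2 ^ L. X $$ (j, 0) * cis (2 * pi * real (j * rev_reg L (bit k)) / 2 ^ L)) / of_real (sqrt 2) ^ L"

lemma basis_eq:
  assumes "k < 2 ^ L"
  shows "basis k b = rest k b * of_bool (\<not> b walk_bit \<and> reg regM b = 0)"
proof -
  have "\<not> bit k q" if "q \<ge> L" for q
    using bit_ge[OF assms that] .
  then show ?thesis
    unfolding basis_def rest_def reg_eq_0_iff set_regM by (auto simp: walk_bit_def sig_def)
qed

lemma rest_upd [simp]: "rest k (upd regM j b) = rest k b" "rest k (b(walk_bit := v)) = rest k b"
proof -
  have "upd regM j b q = b q" if "q \<notin> set regM" for q
    using that by simp
  then show "rest k (upd regM j b) = rest k b"
    unfolding rest_def by (metis (no_types, lifting) insertCI)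
  show "rest k (b(walk_bit := v)) = rest k b"
    unfolding rest_def by auto
qed

lemma walk_bit_notin [simp]: "walk_bit \<notin> set regM"
  by (auto simp: set_regM walk_bit_def)

lemma reg_regM_walk_bit [simp]: "reg regM (b(walk_bit := v)) = reg regM b"
  by (intro reg_cong) auto

lemma upd_regM_walk_bit [simp]: "upd regM j b walk_bit = b walk_bit"
  by (rule upd_notin) simp

lemma X_carrier: "X \<in> carrier_mat (2 ^ L) (2 ^ L)"
  using unitary_X by (simp add: unitary_mat_def)

lemma sem_call:
  "instr_sem X (Call walk_bit regM) f = (\<lambda>b. if b walk_bit then app regM X f b else f b)"
  "instr_sem X (Call_Inv walk_bit regM) f = (\<lambda>b. if b walk_bit then app regM (mat_adjoint X) f b else f b)"
  using X_carrier by (auto simp: app_controlled mat_adjoint_controlled)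

text \<open>The prepared state just before the controlled Hadamards.\<close>

definition stage :: "nat \<Rightarrow> state" where
  "stage k = (\<lambda>b. cis (total_phase phase_list b) * rest k b *
    (if b walk_bit then X $$ (reg regM b, 0) else of_bool (reg regM b = 0)) / of_real (sqrt 2))"

lemma sem_prep_basis:
  assumes "k < 2 ^ L"
  shows "sem X prep (basis k) = sem X had_circuit (stage k)"
proof -
  have 1: "instr_sem X (gate walk_bit h_mat) (basis k) = (\<lambda>b. rest k b * of_bool (reg regM b = 0) / of_real (sqrt 2))"
    unfolding sem_h by (rule ext) (simp add: basis_eq[OF assms])
  have app: "app regM X (\<lambda>b. rest k b * of_bool (reg regM b = 0) / of_real (sqrt 2)) b =
      rest k b * X $$ (reg regM b, 0) / of_real (sqrt 2)" for b
  proof -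
    have "app regM X (\<lambda>b. rest k b * of_bool (reg regM b = 0) / of_real (sqrt 2)) b =
        (\<Sum>j<(2::nat) ^ L. if j = 0 then X $$ (reg regM b, 0) * (rest k b / of_real (sqrt 2)) else 0)"
      unfolding app_def length_regM by (intro sum.cong) auto
    then show ?thesis
      by simp
  qed
  have 2: "instr_sem X (Call walk_bit regM) (\<lambda>b. rest k b * of_bool (reg regM b = 0) / of_real (sqrt 2)) =
      (\<lambda>b. rest k b * (if b walk_bit then X $$ (reg regM b, 0) else of_bool (reg regM b = 0)) / of_real (sqrt 2))"
    unfolding sem_call app by auto
  have 3: "sem X (phases phase_list) f = (\<lambda>b. cis (total_phase phase_list b) * f b)" for f
    by (rule sem_phases) (use phase_list_ok in auto)
  show ?thesis
    unfolding prep_def sem_append sem.simps 1 2 3 stage_def by (simp add: mult.assoc)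
qed

lemma sem_prep_basis_off:
  assumes "k < 2 ^ L" "\<not> b walk_bit"
  shows "sem X prep (basis k) b = rest k b * of_bool (reg regM b = 0) / of_real (sqrt 2)"
  unfolding sem_prep_basis[OF assms(1)] had_circuit_def sem_ch_off[where b = b and w = walk_bit and qs = regM, OF assms(2) walk_bit_notin]
  by (cases "reg regM b = 0") (simp_all add: stage_def assms(2) total_phase_list)

text \<open>Where \<open>rest k\<close> does not vanish, the mode qubits of b spell k; this is how
  the mode number gets from the assignment into \<open>amp\<close>.\<close>

lemma rest_amp:
  "rest k b * (\<Sum>j<2 ^ L. g j * cis (2 * pi * real (j * rev_reg L b) / 2 ^ L)) =
   rest k b * (\<Sum>j<2 ^ L. g j * cis (2 * pi * real (j * rev_reg L (bit k)) / 2 ^ L))"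
proof (cases "rest k b = 0")
  case False
  then have "\<forall>q. q \<notin> insert sig (insert walk_bit (set regM)) \<longrightarrow> b q = bit k q"
    by (auto simp: rest_def)
  then have "b q = bit k q" if "q < L" for q
    using that by (simp add: set_regM walk_bit_def sig_def)
  then have "rev_reg L b = rev_reg L (bit k)"
    unfolding rev_reg_def by (intro sum.cong) auto
  then show ?thesis
    by simp
qed simp

lemma rev_reg_upd [simp]: "rev_reg L (upd regM j b) = rev_reg L b" "rev_reg L (b(walk_bit := v)) = rev_reg L b"
  unfolding rev_reg_def by (intro sum.cong; auto simp: set_regM walk_bit_def)+

lemma sem_prep_basis_on:
  assumes "k < 2 ^ L" "b walk_bit" "reg regM b = 0"
  shows "sem X prep (basis k) b = rest k b * amp k / of_real (sqrt 2)"
proof -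
  have "sem X prep (basis k) b = (\<Sum>j<2 ^ L. stage k (upd regM j b)) / of_real (sqrt 2) ^ L"
    unfolding sem_prep_basis[OF assms(1)] had_circuit_def
    by (subst sem_ch_zero) (use assms in \<open>auto simp: reg_eq_0_iff\<close>)
  also have "(\<Sum>j<2 ^ L. stage k (upd regM j b)) =
      (\<Sum>j<2 ^ L. rest k b / of_real (sqrt 2) * (X $$ (j, 0) * cis (2 * pi * real (j * rev_reg L b) / 2 ^ L)))"
    by (intro sum.cong refl) (simp add: stage_def total_phase_list assms(2))
  also have "\<dots> = rest k b / of_real (sqrt 2) * (\<Sum>j<2 ^ L. X $$ (j, 0) * cis (2 * pi * real (j * rev_reg L b) / 2 ^ L))"
    by (rule sum_distrib_left[symmetric])
  also have "\<dots> = rest k b * (\<Sum>j<2 ^ L. X $$ (j, 0) * cis (2 * pi * real (j * rev_reg L b) / 2 ^ L)) / of_real (sqrt 2)"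
    by simp
  finally show ?thesis
    unfolding rest_amp amp_def by simp
qed

lemma inv_prep: "inv_circuit prep =
    map (\<lambda>q. cgate walk_bit q h_mat) (rev regM) @ inv_circuit (phases phase_list) @ [Call_Inv walk_bit regM, gate walk_bit h_mat]"
  by (simp add: prep_def inv_circuit_def had_circuit_def rev_map)

text \<open>The bit flip exchanges the two branches. The prepared branch, now with the control off,
  keeps the amplitude \<open>amp k\<close> at zero; the branch left at zero is now unprepared and
  contributes the conjugate. The final Hadamard averages the two into the real part.\<close>

lemma flip_basis:
  assumes "k < 2 ^ L" "\<not> b walk_bit" "reg regM b = 0"
  shows "sem X flip_circuit (basis k) b = of_real (Re (amp k)) * basis k b"
proof -
  define g where "g = instr_sem X (gate walk_bit x_mat) (sem X prep (basis k))"
  define y where "y = sem X (map (\<lambda>q. cgate walk_bit q h_mat) (rev regM)) g"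
  define z where "z = (\<lambda>b. cis (- total_phase phase_list b) * y b)"
  have g_on: "g b = rest k b * of_bool (reg regM b = 0) / of_real (sqrt 2)" if "b walk_bit" for b
    unfolding g_def sem_x using that assms(1) by (simp add: sem_prep_basis_off)
  have g_off: "g b = rest k b * amp k / of_real (sqrt 2)" if "\<not> b walk_bit" "reg regM b = 0" for b
    unfolding g_def sem_x using that assms(1) by (simp add: sem_prep_basis_on)
  have y_off: "y b = g b" if "\<not> b walk_bit" for b
    unfolding y_def by (rule sem_ch_off) (use that in auto)
  have y_on: "y b = rest k b / of_real (sqrt 2) / of_real (sqrt 2) ^ L" if b: "b walk_bit" for b
  proof -
    have "y b = g (upd (rev regM) 0 b) / of_real (sqrt 2) ^ length (rev regM)"
      unfolding y_def
    proof (rule sem_ch_support)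
      fix b q assume "b walk_bit" "q \<in> set (rev regM)" "b q"
      then show "g b = 0"
        using g_on[of b] by (auto simp: reg_eq_0_iff)
    qed (use b in auto)
    also have "upd (rev regM) 0 b = upd regM 0 b"
    proof (rule upd_eqI)
      have "reg regM (upd regM 0 b) = 0"
        by simp
      then show "reg (rev regM) (upd regM 0 b) = 0"
        unfolding reg_eq_0_iff by simp
    qed auto
    finally show ?thesis
      using b g_on[of "upd regM 0 b"] by simp
  qed
  have "sem X flip_circuit (basis k) b =
      (instr_sem X (Call_Inv walk_bit regM) z b + instr_sem X (Call_Inv walk_bit regM) z (b(walk_bit := True))) / of_real (sqrt 2)"
  proof -
    have ph: "sem X (inv_circuit (phases phase_list)) f = (\<lambda>b. cis (- total_phase phase_list b) * f b)" for f
      by (rule sem_inv_phases[OF unitary_X phase_list_ok])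
    have "sem X flip_circuit (basis k) = instr_sem X (gate walk_bit h_mat) (instr_sem X (Call_Inv walk_bit regM) z)"
      unfolding flip_circuit_def inv_prep sem_append sem.simps g_def[symmetric] y_def[symmetric] ph z_def[symmetric] ..
    moreover have "b(walk_bit := False) = b"
      using assms(2) by (simp add: fun_upd_idem)
    ultimately show ?thesis
      unfolding sem_h using assms(2) by simp
  qed
  also have "instr_sem X (Call_Inv walk_bit regM) z b = rest k b * amp k / of_real (sqrt 2)"
    unfolding sem_call using assms by (simp add: z_def y_off g_off total_phase_list)
  also have "instr_sem X (Call_Inv walk_bit regM) z (b(walk_bit := True)) = rest k b * cnj (amp k) / of_real (sqrt 2)"
  proof -
    \<comment> \<open>Only row 0 of the adjoint is read, which is the conjugate of column 0 of X,
      the one column that the oracle specifies.\<close>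
    have "instr_sem X (Call_Inv walk_bit regM) z (b(walk_bit := True)) =
        (\<Sum>j<2 ^ L. cnj (X $$ (j, 0)) * z (upd regM j (b(walk_bit := True))))"
      unfolding sem_call app_def using assms(3) X_carrier by simp
    also have "\<dots> = (\<Sum>j<2 ^ L. (rest k b / of_real (sqrt 2) / of_real (sqrt 2) ^ L) *
        cnj (X $$ (j, 0) * cis (2 * pi * real (j * rev_reg L b) / 2 ^ L)))"
      by (intro sum.cong refl) (simp add: z_def y_on total_phase_list cis_cnj)
    also have "\<dots> = rest k b * cnj (\<Sum>j<2 ^ L. X $$ (j, 0) * cis (2 * pi * real (j * rev_reg L b) / 2 ^ L))
        / of_real (sqrt 2) ^ L / of_real (sqrt 2)"
      unfolding cnj_sum sum_distrib_left[symmetric] by simp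
    also have "rest k b * cnj (\<Sum>j<2 ^ L. X $$ (j, 0) * cis (2 * pi * real (j * rev_reg L b) / 2 ^ L)) =
        cnj (rest k b * (\<Sum>j<2 ^ L. X $$ (j, 0) * cis (2 * pi * real (j * rev_reg L b) / 2 ^ L)))"
      by (simp add: rest_def)
    also have "\<dots> = rest k b * (cnj (amp k) * of_real (sqrt 2) ^ L)"
      unfolding rest_amp amp_def by (simp add: rest_def)
    finally show ?thesis
      by (simp del: fun_upd_apply instr_sem.simps)
  qed
  also have "(rest k b * amp k / of_real (sqrt 2) + rest k b * cnj (amp k) / of_real (sqrt 2)) / of_real (sqrt 2) =
      rest k b * (amp k + cnj (amp k)) / (of_real (sqrt 2) * of_real (sqrt 2))"
    by (simp add: field_simps)
  also have "\<dots> = of_real (Re (amp k)) * basis k b"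
    unfolding sqrt2_sq complex_add_cnj basis_eq[OF assms(1)] using assms by simp
  finally show ?thesis .
qed

text \<open>The ladder computes into \<open>flag\<close> whether the walk bit or the register is
  nonzero, Z turns this into a sign, and the inverse ladder uncomputes it. The hypothesis confines f
  to clean ladder ancillas.\<close>

lemma sem_refl:
  assumes "\<And>b q. q \<in> {2 * L + 2..flag} \<Longrightarrow> b q \<Longrightarrow> f b = 0"
  shows "sem X refl_circuit f b = (if b walk_bit \<or> reg regM b \<noteq> 0 then -1 else 1) * f b"
proof -
  let ?lb = "ladder_bits (2 * L + 2) (regM @ [walk_bit])"
  have inv: "sem X (inv_circuit zero_ladder) h = (\<lambda>b. h (?lb b))" for h
    unfolding zero_ladder_def by (rule sem_inv_ladder[OF unitary_X]) (auto simp: layout)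
  have "sem X zero_ladder f (?lb b) = f b"
    using inv[of "sem X zero_ladder f"] sem_inv_zero_ladder[of f] by metis
  then have 1: "sem X refl_circuit f b = (if ?lb b flag then -1 else 1) * f b"
    unfolding refl_circuit_def sem_append sem.simps inv sem_z by simp
  show ?thesis
  proof (cases "f b = 0")
    case False
    then have clean: "\<not> b q" if "q \<in> {2 * L + 2..flag}" for q
      using assms that by blast
    have lb: "?lb b (2 * L + 2 + length (regM @ [walk_bit])) \<longleftrightarrow> b (2 * L + 2) \<or> (\<exists>q\<in>set (regM @ [walk_bit]). b q)"
      by (rule ladder_bits_flag) (use clean in \<open>auto simp: layout\<close>)
    have "2 * L + 2 + length (regM @ [walk_bit]) = flag"
      by (simp add: flag_def)
    from lb[unfolded this] have "?lb b flag \<longleftrightarrow> b walk_bit \<or> reg regM b \<noteq> 0"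
      using clean[of "2 * L + 2"] by (auto simp: reg_eq_0_iff layout)
    then show ?thesis
      using 1 by simp
  qed (use 1 in simp)
qed

text \<open>Let F be the flip, R the reflection, v = \<open>basis k\<close> and e = F v. As F is an
  involution and R fixes v, U e = v. As e has component x along v, R e = 2 x v - e, that is U v = 2
  x v - e. Applying U once more gives the recurrence.\<close>

lemma walk_relation:
  assumes "k < 2 ^ L"
  shows "sem X walk (sem X walk (basis k)) b + basis k b = 2 * of_real (Re (amp k)) * sem X walk (basis k) b"
proof -
  let ?x = "complex_of_real (Re (amp k))"
  let ?e = "sem X flip_circuit (basis k)"
  have basis_clean: "basis k b = 0" if "q \<in> {2 * L + 2..flag}" "b q" for b q
  proof -
    have "\<not> bit k q" "q \<noteq> sig"
      using that bit_ge[OF assms, of q] by (auto simp: layout)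
    then show ?thesis
      using that by (auto simp: basis_def)
  qed
  \<comment> \<open>The flip acts on qubits up to \<open>2 * L\<close> only, so it cannot populate
    the ladder ancillas: the indicator of a clean ancilla passes through it.\<close>
  have e_clean: "?e b = 0" if q: "q \<in> {2 * L + 2..flag}" "b q" for b q
  proof -
    have "sem X flip_circuit (\<lambda>b. of_bool (\<not> b q) * basis k b) = (\<lambda>b. of_bool (\<not> b q) * ?e b)"
    proof (rule sem_local[where S = "{..2 * L}"])
      have "\<Union> (qubits ` set (inv_circuit prep)) \<subseteq> {..2 * L}"
        using qubits_prep by (simp only: qubits_inv_circuit)
      then show "\<Union> (qubits ` set flip_circuit) \<subseteq> {..2 * L}"
        using qubits_prep by (auto simp: flip_circuit_def walk_bit_def)
      show "of_bool (\<not> b q) = of_bool (\<not> b' q)" if "\<And>q. q \<notin> {..2 * L} \<Longrightarrow> b q = b' q" for b b' :: "nat \<Rightarrow> bool"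
        using that[of q] q by auto
    qed
    moreover have "(\<lambda>b. of_bool (\<not> b q) * basis k b) = basis k"
    proof
      show "of_bool (\<not> b q) * basis k b = basis k b" for b
        using basis_clean[OF q(1), of b] by (cases "b q") auto
    qed
    ultimately have "?e b = of_bool (\<not> b q) * ?e b" for b
      by metis
    then show ?thesis
      using q(2) by (metis mult_zero_left of_bool_eq(1))
  qed
  have "sem X flip_circuit ?e = basis k"
    unfolding flip_circuit_def sem_append sem.simps sem_inv_prep by (simp add: sem_x fun_upd_idem del: instr_sem.simps)
  then have we: "sem X walk ?e = basis k"
  proof -
    have "sem X refl_circuit (basis k) = basis k"
      by (rule ext, subst sem_refl[OF basis_clean]) (auto simp: basis_eq[OF assms])
    then show ?thesis
      using \<open>sem X flip_circuit ?e = basis k\<close> by (simp add: walk_def sem_append)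
  qed
  have wb: "sem X walk (basis k) = (\<lambda>b. 2 * ?x * basis k b + (-1) * ?e b)"
  proof
    fix b
    show "sem X walk (basis k) b = 2 * ?x * basis k b + (-1) * ?e b"
    proof -
      have "sem X refl_circuit ?e b = (if b walk_bit \<or> reg regM b \<noteq> 0 then -1 else 1) * ?e b"
        by (rule sem_refl) (use e_clean in blast)
      then show ?thesis
        unfolding walk_def sem_append
        using flip_basis[OF assms, of b] basis_eq[OF assms, of b] by auto
    qed
  qed
  have "sem X walk (sem X walk (basis k)) = sem X walk (\<lambda>b. 2 * ?x * basis k b + (-1) * ?e b)"
    by (subst wb) simp
  also have "\<dots> = (\<lambda>b. 2 * ?x * sem X walk (basis k) b + (-1) * basis k b)"
    unfolding sem_linear we ..
  finally show ?thesis
    by simp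
qed

end

section \<open>The quantum Fourier transform\<close>

fun qft :: "nat \<Rightarrow> circuit" where
  "qft 0 = []"
| "qft (Suc m) = gate m h_mat # phases (map (\<lambda>p. (p, m, - (pi * 2 ^ p / 2 ^ m))) [0..<m]) @ qft m"

lemma wf_qft: "m \<le> n \<Longrightarrow> wf_circuit L n (qft m)"
  by (induction m) (auto intro!: wf_phases)

lemma count_qft: "gate_count (qft m) \<le> m * m" "call_count (qft m) = 0"
  by (induction m) auto

lemma rev_reg_Suc: "rev_reg (Suc m) b = 2 * rev_reg m b + of_bool (b m)"
proof -
  have "rev_reg (Suc m) b = (\<Sum>p<m. of_bool (b p) * 2 ^ (m - p)) + of_bool (b m)"
    by (simp add: rev_reg_def)
  also have "(\<Sum>p<m. of_bool (b p) * 2 ^ (m - p)) = (\<Sum>p<m. 2 * (of_bool (b p) * 2 ^ (m - 1 - p)) :: nat)"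
  proof (rule sum.cong)
    fix p assume "p \<in> {..<m}"
    then have "m - p = Suc (m - 1 - p)"
      by auto
    then show "of_bool (b p) * 2 ^ (m - p) = (2 * (of_bool (b p) * 2 ^ (m - 1 - p)) :: nat)"
      by simp
  qed simp
  finally show ?thesis
    by (simp only: rev_reg_def sum_distrib_left)
qed

lemma cis_minus_2pi_nat [simp]: "cis (- (2 * pi * real n)) = 1"
  by (simp add: cis_cnj[symmetric])

text \<open>Splits j by its top bit. Replacing j by j + 2 ^ m changes the phase only by a sign,
  given by the lowest bit of the reversed index, which is qubit m: this is the Hadamard. The same
  bit adds the phase \<open>- (pi * j / 2 ^ m)\<close> for the lower part of j: these are the
  controlled phases.\<close>

lemma sem_qft:
  "sem X (qft m) f b =
    (\<Sum>j<2 ^ m. cis (- (2 * pi * real (j * rev_reg m b) / 2 ^ m)) * f (upd [0..<m] j b)) / of_real (sqrt 2) ^ m"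
proof (induction m arbitrary: f)
  case (Suc m)
  let ?ps = "map (\<lambda>p. (p, m, - (pi * 2 ^ p / 2 ^ m))) [0..<m]"
  let ?s = "if b m then -1 else 1 :: complex"
  define \<beta> where "\<beta> = (of_bool (b m) :: nat)"
  define r where "r = rev_reg m b"
  define g where "g = sem X (phases ?ps) (instr_sem X (gate m h_mat) f)"
  have g: "g b' = cis (- (pi * of_bool (b' m) * reg [0..<m] b' / 2 ^ m)) *
      ((f (b'(m := False)) + (if b' m then -1 else 1) * f (b'(m := True))) / of_real (sqrt 2))" for b'
  proof -
    have "total_phase ?ps b' = (\<Sum>p<m. of_bool (b' p) * of_bool (b' m) * - (pi * 2 ^ p / 2 ^ m))"
      by (simp add: total_phase_def comp_def interv_sum_list_conv_sum_set_nat atLeast0LessThan)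
    also have "\<dots> = (\<Sum>p<m. - (pi * of_bool (b' m) / 2 ^ m) * (of_bool (b' p) * 2 ^ p))"
      by (intro sum.cong refl) simp
    also have "\<dots> = - (pi * of_bool (b' m) / 2 ^ m) * (\<Sum>p<m. of_bool (b' p) * 2 ^ p)"
      by (rule sum_distrib_left[symmetric])
    also have "(\<Sum>p<m. of_bool (b' p) * 2 ^ p) = real (reg [0..<m] b')"
      using reg_shift_eq_sum[of 0 m b'] by simp
    finally show ?thesis
      unfolding g_def by (subst sem_phases) (auto simp: sem_h simp del: instr_sem.simps)
  qed
  have gu: "g (upd [0..<m] j b) = cis (- (pi * \<beta> * j / 2 ^ m)) *
      ((f (upd [0..<Suc m] j b) + ?s * f (upd [0..<Suc m] (j + 2 ^ m) b)) / of_real (sqrt 2))"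
    if "j < 2 ^ m" for j
  proof -
    have "upd [0..<Suc m] j b = (upd [0..<m] j b)(m := False)"
      "upd [0..<Suc m] (j + 2 ^ m) b = (upd [0..<m] j b)(m := True)"
      using that upd_snoc[of "[0..<m]" m j False b] upd_snoc[of "[0..<m]" m j True b] by auto
    then show ?thesis
      unfolding g \<beta>_def using that by simp
  qed
  have ph1: "cis (- (2 * pi * real (j * rev_reg (Suc m) b) / 2 ^ Suc m)) =
      cis (- (2 * pi * real (j * r) / 2 ^ m)) * cis (- (pi * \<beta> * j / 2 ^ m))" for j
    unfolding cis_mult rev_reg_Suc r_def[symmetric] \<beta>_def[symmetric]
    by (rule arg_cong[where f = cis]) (simp add: field_simps)
  have ph2: "cis (- (2 * pi * real ((j + 2 ^ m) * rev_reg (Suc m) b) / 2 ^ Suc m)) =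
      cis (- (2 * pi * real (j * rev_reg (Suc m) b) / 2 ^ Suc m)) * ?s" for j
  proof -
    have "- (2 * pi * real ((j + 2 ^ m) * rev_reg (Suc m) b) / 2 ^ Suc m) =
        - (2 * pi * real (j * rev_reg (Suc m) b) / 2 ^ Suc m) + (- (2 * pi * real r) + - (pi * \<beta>))"
      unfolding rev_reg_Suc r_def[symmetric] \<beta>_def[symmetric] by (simp add: field_simps)
    moreover have "cis (- (pi * \<beta>)) = ?s"
      by (simp add: \<beta>_def cis_cnj[symmetric])
    ultimately show ?thesis
      by (simp only: cis_mult[symmetric] cis_minus_2pi_nat mult_1)
  qed
  have "sem X (qft (Suc m)) f b =
      (\<Sum>j<2 ^ m. cis (- (2 * pi * real (j * r) / 2 ^ m)) * g (upd [0..<m] j b)) / of_real (sqrt 2) ^ m"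
    unfolding g_def r_def by (simp add: sem_append Suc.IH del: instr_sem.simps)
  also have "(\<Sum>j<2 ^ m. cis (- (2 * pi * real (j * r) / 2 ^ m)) * g (upd [0..<m] j b)) =
      (\<Sum>j<2 ^ m. (cis (- (2 * pi * real (j * rev_reg (Suc m) b) / 2 ^ Suc m)) * f (upd [0..<Suc m] j b) +
         cis (- (2 * pi * real ((j + 2 ^ m) * rev_reg (Suc m) b) / 2 ^ Suc m)) * f (upd [0..<Suc m] (j + 2 ^ m) b))
       / of_real (sqrt 2))"
  proof (rule sum.cong)
    fix j :: nat assume "j \<in> {..<2 ^ m}"
    then have "j < 2 ^ m" by simp
    show "cis (- (2 * pi * real (j * r) / 2 ^ m)) * g (upd [0..<m] j b) =
      (cis (- (2 * pi * real (j * rev_reg (Suc m) b) / 2 ^ Suc m)) * f (upd [0..<Suc m] j b) +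
         cis (- (2 * pi * real ((j + 2 ^ m) * rev_reg (Suc m) b) / 2 ^ Suc m)) * f (upd [0..<Suc m] (j + 2 ^ m) b))
       / of_real (sqrt 2)"
      unfolding ph2 unfolding ph1 gu[OF \<open>j < 2 ^ m\<close>] by (simp only: times_divide_eq_right distrib_left mult.assoc)
  qed simp
  finally show ?case
    unfolding sum_lessThan_snoc
    by (simp only: sum_divide_distrib[symmetric] sum.distrib divide_divide_eq_left power_Suc)
qed simp

definition qft_mat :: "nat \<Rightarrow> complex mat" where
  "qft_mat L = mat (2 ^ L) (2 ^ L)
     (\<lambda>(k, j). cis (- (2 * pi * real (j * rev_reg L (bit k)) / 2 ^ L)) / of_real (sqrt 2) ^ L)"

lemma qft_mat_carrier [simp]: "qft_mat L \<in> carrier_mat (2 ^ L) (2 ^ L)"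
  by (simp add: qft_mat_def)

lemma adjoin_carrier [simp]: "adjoin_ancillas L a \<in> carrier_mat (2 ^ (L + a)) (2 ^ L)"
  by (simp add: adjoin_ancillas_def)

lemma less_pow_add: "k < 2 ^ L \<Longrightarrow> (k :: nat) < 2 ^ (L + a)"
  by (rule order_less_le_trans[of _ "2 ^ L"]) auto

lemma col_adjoin: "k < 2 ^ L \<Longrightarrow> col (adjoin_ancillas L a) k = unit_vec (2 ^ (L + a)) k"
  using less_pow_add[of k L a] by (intro eq_vecI) (auto simp: adjoin_ancillas_def)

lemma bit_inj: "bit (i :: nat) = bit j \<Longrightarrow> i = j"
  by (metis bit_eq_iff)

lemma rep_unit_vec:
  assumes "k < 2 ^ n"
  shows "rep n (unit_vec (2 ^ n) k) (\<lambda>b. of_bool (b = bit k))"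
  using assms by (auto simp: rep_def dest: bit_inj)

lemma qft_adjoin:
  "circuit_op (L + a) X (qft L) * adjoin_ancillas L a = adjoin_ancillas L a * qft_mat L"
proof (rule eq_matI)
  let ?n = "L + a"
  fix i k assume "i < dim_row (adjoin_ancillas L a * qft_mat L)" "k < dim_col (adjoin_ancillas L a * qft_mat L)"
  then have i: "i < 2 ^ ?n" and k: "k < 2 ^ L"
    by (auto simp: adjoin_ancillas_def qft_mat_def)
  have kn: "k < 2 ^ ?n"
    using k by (rule less_pow_add)
  have rep: "rep ?n (circuit_op ?n X (qft L) *\<^sub>v unit_vec (2 ^ ?n) k) (sem X (qft L) (\<lambda>b. of_bool (b = bit k)))"
    by (rule rep_circuit_op[OF rep_unit_vec[OF kn], where L = L]) (simp add: wf_qft)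
  have "(circuit_op ?n X (qft L) * adjoin_ancillas L a) $$ (i, k) =
      (circuit_op ?n X (qft L) *\<^sub>v col (adjoin_ancillas L a) k) $ i"
    using i k by (simp add: adjoin_ancillas_def carrier_matD[OF circuit_op_carrier])
  also have "\<dots> = sem X (qft L) (\<lambda>b. of_bool (b = bit k)) (bit i)"
    using rep i by (simp add: col_adjoin[OF k] rep_def)
  also have "\<dots> = (if i < 2 ^ L then qft_mat L $$ (i, k) else 0)"
  proof (cases "i < 2 ^ L")
    case True
    have u: "upd [0..<L] j (bit i) = bit j" if "j < 2 ^ L" for j
    proof (rule upd_eqI)
      show "reg [0..<L] (bit j) = j"
        using that by (simp add: reg_def horner_sum_bit_eq_take_bit take_bit_nat_eq_self)
      show "bit i q = bit j q" if "q \<notin> set [0..<L]" for q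
        using bit_ge[OF True] bit_ge[OF \<open>j < 2 ^ L\<close>] that by (auto simp: not_less)
    qed simp
    have "(\<Sum>j<2 ^ L. cis (- (2 * pi * real (j * rev_reg L (bit i)) / 2 ^ L)) * of_bool (upd [0..<L] j (bit i) = bit k)) =
        (\<Sum>j<(2::nat) ^ L. if j = k then cis (- (2 * pi * real (k * rev_reg L (bit i)) / 2 ^ L)) else 0)"
      by (intro sum.cong refl) (auto simp: u dest: bit_inj)
    then show ?thesis
      using True k by (simp add: sem_qft qft_mat_def)
  next
    case False
    \<comment> \<open>Such a bit of i lies beyond the transformed qubits, so no update of these can
      turn i into k.\<close>
    have "\<exists>q\<ge>L. bit i q"
    proof (rule ccontr)
      assume "\<not> ?thesis"
      then have "take_bit L i = i"
        by (intro bit_eqI) (metis bit_take_bit_iff not_le)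
      then show False
        using False by (simp add: take_bit_nat_eq_self_iff)
    qed
    then obtain q where q: "q \<ge> L" "bit i q"
      by auto
    have "upd [0..<L] j (bit i) \<noteq> bit k" for j
      using q bit_ge[OF k q(1)] by (metis atLeastLessThan_iff not_le set_upt upd_notin)
    then show ?thesis
      using False by (simp add: sem_qft)
  qed
  also have "\<dots> = (adjoin_ancillas L a * qft_mat L) $$ (i, k)"
  proof -
    have "(adjoin_ancillas L a * qft_mat L) $$ (i, k) =
        (\<Sum>j<(2::nat) ^ L. adjoin_ancillas L a $$ (i, j) * qft_mat L $$ (j, k))"
      using i k by (simp add: scalar_prod_def carrier_matD[OF adjoin_carrier] carrier_matD[OF qft_mat_carrier]
          atLeast0LessThan)
    also have "\<dots> = (\<Sum>j<(2::nat) ^ L. if j = i then qft_mat L $$ (j, k) else 0)"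
      using i by (intro sum.cong refl) (auto simp: adjoin_ancillas_def)
    finally show ?thesis
      by simp
  qed
  finally show "(circuit_op ?n X (qft L) * adjoin_ancillas L a) $$ (i, k) = (adjoin_ancillas L a * qft_mat L) $$ (i, k)" .
qed (auto simp: carrier_matD[OF circuit_op_carrier] adjoin_ancillas_def qft_mat_def)

lemma adjoin_isometry: "mat_adjoint (adjoin_ancillas L a) * adjoin_ancillas L a = 1\<^sub>m (2 ^ L)"
proof (rule eq_matI)
  fix i j assume "i < dim_row (1\<^sub>m (2 ^ L) :: complex mat)" "j < dim_col (1\<^sub>m (2 ^ L) :: complex mat)"
  then have ij: "i < 2 ^ L" "j < 2 ^ L"
    by auto
  then have "i < 2 ^ (L + a)" "j < 2 ^ (L + a)"
    using less_pow_add by blast+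
  moreover have "(mat_adjoint (adjoin_ancillas L a) * adjoin_ancillas L a) $$ (i, j) =
      (\<Sum>k<(2::nat) ^ (L + a). if k = i then of_bool (i = j) else 0)"
  proof -
    have "(mat_adjoint (adjoin_ancillas L a) * adjoin_ancillas L a) $$ (i, j) =
        (\<Sum>k<(2::nat) ^ (L + a). cnj (adjoin_ancillas L a $$ (k, i)) * adjoin_ancillas L a $$ (k, j))"
      using ij by (simp add: scalar_prod_def carrier_matD[OF adjoin_carrier] atLeast0LessThan)
    also have "\<dots> = (\<Sum>k<(2::nat) ^ (L + a). if k = i then of_bool (i = j) else 0)"
      using ij by (intro sum.cong refl) (auto simp: adjoin_ancillas_def)
    finally show ?thesis .
  qed
  ultimately show "(mat_adjoint (adjoin_ancillas L a) * adjoin_ancillas L a) $$ (i, j) = (1\<^sub>m (2 ^ L)) $$ (i, j)"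
    using ij by simp
qed (auto simp: adjoin_ancillas_def)

text \<open>Avoids sums of roots of unity: without ancillas the matrix is the operator of the
  circuit, taken with the identity as oracle, and circuits are unitary.\<close>

lemma qft_mat_unitary: "unitary_mat (2 ^ L) (qft_mat L)"
proof -
  let ?E = "adjoin_ancillas L 0" and ?Q = "circuit_op (L + 0) (1\<^sub>m (2 ^ L)) (qft L)" and ?F = "qft_mat L"
  have E1: "?E = 1\<^sub>m (2 ^ L)"
    by (rule eq_matI) (auto simp: adjoin_ancillas_def)
  have "?Q * ?E = ?E * ?F"
    by (rule qft_adjoin)
  then have "?Q = ?F"
    unfolding E1 using left_mult_one_mat[OF qft_mat_carrier[of L]]
      right_mult_one_mat[OF circuit_op_carrier[of L "1\<^sub>m (2 ^ L)" "qft L"]] by simp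
  moreover have "unitary_mat (2 ^ L) ?Q"
    using circuit_op_unitary[OF wf_qft[of L L L], of "1\<^sub>m (2 ^ L)"] by (simp add: unitary_mat_def)
  ultimately show ?thesis
    by simp
qed

section \<open>Circulant matrices and the simulation error\<close>

lemma vec_l2_norm_sq: "(vec_l2_norm v)\<^sup>2 = (\<Sum>i<dim_vec v. (cmod (v $ i))\<^sup>2)"
  by (simp add: vec_l2_norm_def L2_set_def sum_nonneg)

lemma vec_l2_norm_nonneg [simp]: "0 \<le> vec_l2_norm v"
  by (simp add: vec_l2_norm_def)

lemma mult_mat_index_sum:
  fixes A B :: "'a :: semiring_0 mat"
  assumes "A \<in> carrier_mat n m" "B \<in> carrier_mat m k" "i < n" "j < k"
  shows "(A * B) $$ (i, j) = (\<Sum>l<m. A $$ (i, l) * B $$ (l, j))"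
  using assms by (simp add: scalar_prod_def atLeast0LessThan)

lemma mult_mat_vec_index_sum:
  fixes A :: "'a :: semiring_0 mat"
  assumes "A \<in> carrier_mat n m" "v \<in> carrier_vec m" "i < n"
  shows "(A *\<^sub>v v) $ i = (\<Sum>l<m. A $$ (i, l) * v $ l)"
  using assms by (simp add: scalar_prod_def atLeast0LessThan)

lemma isometry_norm:
  assumes A: "A \<in> carrier_mat n m" "mat_adjoint A * A = 1\<^sub>m m" and v: "v \<in> carrier_vec m"
  shows "vec_l2_norm (A *\<^sub>v v) = vec_l2_norm v"
proof -
  let ?w = "A *\<^sub>v v"
  have w: "?w $ i = (\<Sum>j<m. A $$ (i, j) * v $ j)" if "i < n" for i
    using that A v by (simp add: scalar_prod_def atLeast0LessThan)
  have "mat_adjoint A *\<^sub>v ?w = v"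
    using assoc_mult_mat_vec[OF mat_adjoint_carrier[OF A(1)] A(1) v] A(2) v by simp
  then have Av: "v $ j = (\<Sum>i<n. cnj (A $$ (i, j)) * ?w $ i)" if "j < m" for j
    using that A v index_mult_mat_vec[of j "mat_adjoint A" ?w]
    by (simp add: scalar_prod_def atLeast0LessThan)
  have "(\<Sum>i<n. cnj (?w $ i) * ?w $ i) = (\<Sum>i<n. \<Sum>j<m. cnj (A $$ (i, j)) * cnj (v $ j) * ?w $ i)"
    by (simp add: w sum_distrib_right)
  also have "\<dots> = (\<Sum>j<m. \<Sum>i<n. cnj (A $$ (i, j)) * cnj (v $ j) * ?w $ i)"
    by (rule sum.swap)
  also have "\<dots> = (\<Sum>j<m. cnj (v $ j) * (\<Sum>i<n. cnj (A $$ (i, j)) * ?w $ i))"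
    by (simp add: sum_distrib_left ac_simps)
  also have "\<dots> = (\<Sum>j<m. cnj (v $ j) * v $ j)"
    by (intro sum.cong refl) (simp add: Av[symmetric])
  finally have "complex_of_real ((vec_l2_norm ?w)\<^sup>2) = complex_of_real ((vec_l2_norm v)\<^sup>2)"
    using A v unfolding vec_l2_norm_sq of_real_sum complex_norm_square by (simp add: mult.commute)
  then show ?thesis
    unfolding of_real_eq_iff by simp
qed

lemma mat_op_norm_le:
  assumes "0 \<le> \<delta>" "\<And>v. v \<in> carrier_vec (dim_col A) \<Longrightarrow> vec_l2_norm (A *\<^sub>v v) \<le> \<delta> * vec_l2_norm v"
  shows "mat_op_norm A \<le> \<delta>"
  unfolding mat_op_norm_def
proof (rule cSUP_least)
  have "vec_l2_norm (0\<^sub>v (dim_col A)) \<le> 1"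
    by (simp add: vec_l2_norm_def L2_set_def)
  then show "{v \<in> carrier_vec (dim_col A). vec_l2_norm v \<le> 1} \<noteq> {}"
    using zero_carrier_vec by blast
  fix v assume "v \<in> {v \<in> carrier_vec (dim_col A). vec_l2_norm v \<le> 1}"
  then show "vec_l2_norm (A *\<^sub>v v) \<le> \<delta>"
    using assms(2)[of v] assms(1) mult_left_mono[of "vec_l2_norm v" 1 \<delta>] by simp
qed

section \<open>Spectrum and exponential of circulant matrices\<close>

definition circulant_eig :: "nat \<Rightarrow> complex vec \<Rightarrow> nat \<Rightarrow> complex" where
  "circulant_eig L c k = (\<Sum>m<2 ^ L. c $ m * cis (2 * pi * real (m * rev_reg L (bit k)) / 2 ^ L))"

lemma cis_root_mod:
  assumes "N > 0"
  shows "cis (- (2 * pi * real (a mod N * r) / real N)) = cis (- (2 * pi * real (a * r) / real N))"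
proof -
  have "real a = real N * real (a div N) + real (a mod N)"
    by (metis mult_div_mod_eq of_nat_add of_nat_mult)
  then have "- (2 * pi * real (a * r) / real N) =
      - (2 * pi * real (a div N * r)) + - (2 * pi * real (a mod N * r) / real N)"
    using assms by (simp add: field_simps)
  then show ?thesis
    by (simp only: cis_mult[symmetric] cis_minus_2pi_nat mult_1)
qed

text \<open>Row k of the transform is a left eigenvector: for fixed j the substitution m = j - i
  modulo N, an involution of the index range, turns the sum into the character at j times the
  eigenvalue.\<close>

lemma qft_circulant:
  assumes c: "c \<in> carrier_vec (2 ^ L)" and kj: "k < 2 ^ L" "j < 2 ^ L"
  shows "(qft_mat L * circulant_mat c) $$ (k, j) = circulant_eig L c k * qft_mat L $$ (k, j)"
proof -
  define N where "N = (2::nat) ^ L"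
  define r where "r = rev_reg L (bit k)"
  define \<omega> where "\<omega> = (\<lambda>i::nat. cis (- (2 * pi * real (i * r) / real N)))"
  have N: "N > 0" "real N = 2 ^ L"
    by (simp_all add: N_def)
  have md: "(N + j - i) mod N = (if i \<le> j then j - i else N + j - i)" if "i < N" for i
  proof (cases "i \<le> j")
    case True
    then have e: "N + j - i = N + (j - i)"
      by simp
    show ?thesis
      unfolding e mod_add_self1 using True kj by (simp add: N_def[symmetric])
  qed (use that kj in \<open>auto simp: N_def[symmetric]\<close>)
  have refl: "(N + j - (N + j - i) mod N) mod N = i" if "i < N" for i
    using that kj by (auto simp: md N_def[symmetric])
  have \<omega>: "\<omega> ((N + j - m) mod N) = \<omega> j * cis (2 * pi * real (m * r) / real N)" if "m < N" for m
  proof -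
    have "\<omega> ((N + j - m) mod N) = \<omega> (N + j - m)"
      unfolding \<omega>_def by (rule cis_root_mod[OF N(1)])
    also have "- (2 * pi * real ((N + j - m) * r) / real N) =
        - (2 * pi * real r) + (- (2 * pi * real (j * r) / real N) + 2 * pi * real (m * r) / real N)"
      using that N(1) by (simp add: of_nat_diff field_simps)
    then have "\<omega> (N + j - m) = \<omega> j * cis (2 * pi * real (m * r) / real N)"
      unfolding \<omega>_def by (simp only: cis_mult[symmetric] cis_minus_2pi_nat mult_1)
    finally show ?thesis .
  qed
  have "(qft_mat L * circulant_mat c) $$ (k, j) =
      (\<Sum>i<N. \<omega> i / of_real (sqrt 2) ^ L * c $ ((N + j - i) mod N))"
    using kj c by (simp add: N_def[symmetric] qft_mat_def circulant_mat_def scalar_prod_def atLeast0LessThan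
        \<omega>_def r_def N(2))
  also have "\<dots> = (\<Sum>m<N. \<omega> ((N + j - m) mod N) / of_real (sqrt 2) ^ L * c $ m)"
    by (rule sum.reindex_bij_witness[of _ "\<lambda>m. (N + j - m) mod N" "\<lambda>m. (N + j - m) mod N"])
      (use N(1) in \<open>auto simp: refl\<close>)
  also have "\<dots> = (\<Sum>m<N. c $ m * cis (2 * pi * real (m * r) / real N) * (\<omega> j / of_real (sqrt 2) ^ L))"
  proof (rule sum.cong)
    fix m assume "m \<in> {..<N}"
    then have "m < N" by simp
    show "\<omega> ((N + j - m) mod N) / of_real (sqrt 2) ^ L * c $ m =
        c $ m * cis (2 * pi * real (m * r) / real N) * (\<omega> j / of_real (sqrt 2) ^ L)"
      unfolding \<omega>[OF \<open>m < N\<close>] by (simp add: ac_simps)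
  qed simp
  also have "\<dots> = circulant_eig L c k * (\<omega> j / of_real (sqrt 2) ^ L)"
    unfolding circulant_eig_def sum_distrib_right r_def N_def by simp
  also have "\<omega> j / of_real (sqrt 2) ^ L = qft_mat L $$ (k, j)"
    using kj by (simp add: \<omega>_def qft_mat_def r_def N(2))
  finally show ?thesis .
qed

text \<open>The eigenvalue is a diagonal entry of C conjugated by the unitary transform, which is
  Hermitian along with C.\<close>

lemma circulant_eig_real:
  assumes c: "c \<in> carrier_vec (2 ^ L)" and herm: "hermitian_mat (circulant_mat c)" and k: "k < 2 ^ L"
  shows "circulant_eig L c k \<in> \<real>"
proof -
  let ?F = "qft_mat L" and ?C = "circulant_mat c" and ?N = "2 ^ L"
  have F: "?F \<in> carrier_mat ?N ?N" "mat_adjoint ?F \<in> carrier_mat ?N ?N" "?F * mat_adjoint ?F = 1\<^sub>m ?N"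
    using qft_mat_unitary[of L] by (auto simp: unitary_mat_def)
  have C: "?C \<in> carrier_mat ?N ?N"
    using c by (simp add: circulant_mat_def)
  let ?M = "?F * ?C * mat_adjoint ?F"
  have "mat_adjoint ?M = ?F * (mat_adjoint ?C * mat_adjoint ?F)"
    by (simp add: mat_adjoint_mult[OF mult_carrier_mat[OF F(1) C] F(2)] mat_adjoint_mult[OF F(1) C])
  also have "\<dots> = ?M"
    using herm F C by (simp add: hermitian_mat_def assoc_mult_mat[of _ ?N ?N _ ?N _ ?N])
  finally have "mat_adjoint ?M $$ (k, k) = ?M $$ (k, k)"
    by simp
  moreover have "?M \<in> carrier_mat ?N ?N"
    by (rule mult_carrier_mat[OF mult_carrier_mat[OF F(1) C] F(2)])
  ultimately have "cnj (?M $$ (k, k)) = ?M $$ (k, k)"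
    using k by (metis carrier_matD mat_adjoint_index)
  moreover have "?M $$ (k, k) = circulant_eig L c k"
  proof -
    have "?M $$ (k, k) = (\<Sum>j<?N. (?F * ?C) $$ (k, j) * mat_adjoint ?F $$ (j, k))"
      by (rule mult_mat_index_sum[OF mult_carrier_mat[OF F(1) C] F(2) k k])
    also have "\<dots> = (\<Sum>j<?N. circulant_eig L c k * (?F $$ (k, j) * mat_adjoint ?F $$ (j, k)))"
      using k by (intro sum.cong refl) (simp add: qft_circulant[OF c])
    also have "\<dots> = circulant_eig L c k * (?F * mat_adjoint ?F) $$ (k, k)"
      unfolding mult_mat_index_sum[OF F(1,2) k k] by (rule sum_distrib_left[symmetric])
    also have "(?F * mat_adjoint ?F) $$ (k, k) = 1"
      unfolding F(3) using k by simp
    finally show ?thesis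
      by (simp only: mult_1_right)
  qed
  ultimately show ?thesis
    by (simp add: Reals_cnj_iff)
qed

text \<open>From F A = diag(d) F follows A^k = F^-1 diag(d)^k F, so every entry of the matrix series
  is a finite combination of scalar exponential series.\<close>

lemma diagonalised_exp:
  assumes F: "unitary_mat n F" and A: "A \<in> carrier_mat n n"
    and d: "\<And>l j. l < n \<Longrightarrow> j < n \<Longrightarrow> (F * A) $$ (l, j) = d l * F $$ (l, j)"
    and lj: "l < n" "j < n"
  shows "(F * mat_exp A) $$ (l, j) = exp (d l) * F $$ (l, j)"
proof -
  have F': "F \<in> carrier_mat n n" "mat_adjoint F \<in> carrier_mat n n" "mat_adjoint F * F = 1\<^sub>m n" "F * mat_adjoint F = 1\<^sub>m n"
    using F by (auto simp: unitary_mat_def)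
  have pow: "(F * A ^\<^sub>m k) $$ (l, j) = d l ^ k * F $$ (l, j)" if "l < n" "j < n" for k l j
    using that
  proof (induction k arbitrary: j)
    case (Suc k)
    have Ak: "A ^\<^sub>m k \<in> carrier_mat n n"
      using A by simp
    have "(F * A ^\<^sub>m Suc k) $$ (l, j) = ((F * A ^\<^sub>m k) * A) $$ (l, j)"
      using F' A Ak by (simp add: assoc_mult_mat[of _ n n _ n _ n])
    also have "\<dots> = (\<Sum>m<n. (F * A ^\<^sub>m k) $$ (l, m) * A $$ (m, j))"
      by (rule mult_mat_index_sum[OF mult_carrier_mat[OF F'(1) Ak] A Suc.prems])
    also have "\<dots> = (\<Sum>m<n. d l ^ k * (F $$ (l, m) * A $$ (m, j)))"
      using Suc by (intro sum.cong refl) simp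
    also have "\<dots> = d l ^ k * (F * A) $$ (l, j)"
      unfolding mult_mat_index_sum[OF F'(1) A Suc.prems] by (rule sum_distrib_left[symmetric])
    finally show ?case
      using d Suc.prems by simp
  qed (use F' A in simp)
  define B where "B = mat n n (\<lambda>(l, j). exp (d l) * F $$ (l, j))"
  have B: "B \<in> carrier_mat n n"
    by (simp add: B_def)
  have "mat_exp A = mat_adjoint F * B"
  proof (rule eq_matI)
    fix i j assume "i < dim_row (mat_adjoint F * B)" "j < dim_col (mat_adjoint F * B)"
    then have ij: "i < n" "j < n"
      using F' B by auto
    have "(A ^\<^sub>m k) $$ (i, j) / fact k = (\<Sum>l<n. cnj (F $$ (l, i)) * F $$ (l, j) * (d l ^ k / fact k))" for k
    proof -
      have Ak: "A ^\<^sub>m k \<in> carrier_mat n n"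
        using A by simp
      have "A ^\<^sub>m k = mat_adjoint F * (F * A ^\<^sub>m k)"
        by (metis F'(3) assoc_mult_mat[OF F'(2,1) Ak] left_mult_one_mat[OF Ak])
      then have "(A ^\<^sub>m k) $$ (i, j) = (mat_adjoint F * (F * A ^\<^sub>m k)) $$ (i, j)"
        by simp
      also have "\<dots> = (\<Sum>l<n. mat_adjoint F $$ (i, l) * (F * A ^\<^sub>m k) $$ (l, j))"
        by (rule mult_mat_index_sum[OF F'(2) mult_carrier_mat[OF F'(1) Ak] ij])
      also have "\<dots> = (\<Sum>l<n. cnj (F $$ (l, i)) * F $$ (l, j) * d l ^ k)"
        using ij F' by (intro sum.cong refl) (simp add: pow)
      finally show ?thesis
        by (simp add: sum_divide_distrib)
    qed
    moreover have "(\<lambda>k. \<Sum>l<n. cnj (F $$ (l, i)) * F $$ (l, j) * (d l ^ k / fact k)) sums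
        (\<Sum>l<n. cnj (F $$ (l, i)) * F $$ (l, j) * exp (d l))"
    proof (intro sums_sum sums_mult)
      show "(\<lambda>k. d l ^ k / fact k) sums exp (d l)" for l
        using exp_converges[of "d l"] by (simp add: scaleR_conv_of_real divide_inverse mult.commute)
    qed
    ultimately have "mat_exp A $$ (i, j) = (\<Sum>l<n. cnj (F $$ (l, i)) * F $$ (l, j) * exp (d l))"
      using ij A by (simp add: mat_exp_def sums_unique[symmetric])
    also have "\<dots> = (mat_adjoint F * B) $$ (i, j)"
      unfolding mult_mat_index_sum[OF F'(2) B ij]
      using ij F' by (intro sum.cong refl) (simp add: B_def)
    finally show "mat_exp A $$ (i, j) = (mat_adjoint F * B) $$ (i, j)" .
  qed (use F' A B in \<open>auto simp: mat_exp_def\<close>)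
  then have "F * mat_exp A = B"
    using assoc_mult_mat[OF F'(1,2) B] F'(4) B by simp
  then show ?thesis
    using lj by (simp add: B_def)
qed

lemma qft_circulant_exp:
  assumes c: "c \<in> carrier_vec (2 ^ L)" and lj: "l < 2 ^ L" "j < 2 ^ L"
  shows "(qft_mat L * mat_exp (z \<cdot>\<^sub>m circulant_mat c)) $$ (l, j) = exp (z * circulant_eig L c l) * qft_mat L $$ (l, j)"
proof (rule diagonalised_exp[OF qft_mat_unitary _ _ lj])
  have C: "circulant_mat c \<in> carrier_mat (2 ^ L) (2 ^ L)"
    using c by (simp add: circulant_mat_def)
  then show "z \<cdot>\<^sub>m circulant_mat c \<in> carrier_mat (2 ^ L) (2 ^ L)"
    by simp
  show "(qft_mat L * (z \<cdot>\<^sub>m circulant_mat c)) $$ (l, j) = z * circulant_eig L c l * qft_mat L $$ (l, j)"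
    if "l < 2 ^ L" "j < 2 ^ L" for l j
    using mult_smult_distrib[OF qft_mat_carrier C, of z] qft_circulant[OF c that] that C
    by (simp add: carrier_matD[OF qft_mat_carrier] del: index_mult_mat(1))
qed

text \<open>Expand \<open>|e - g|^2 = |g|^2 - 1 + 2 Re (cnj e (e - g))\<close>. The term |g|^2 is
  kept on purpose: together with the leaked weight it sums to the total norm, which unitarity
  fixes.\<close>

lemma norm_diff_sq_le:
  fixes e g :: complex
  assumes "cmod e = 1" "cmod (g - e) \<le> \<eta>"
  shows "(cmod (e - g))\<^sup>2 \<le> (cmod g)\<^sup>2 + (2 * \<eta> - 1)"
proof -
  have "Re (cnj e * (e - g)) \<le> cmod (cnj e * (e - g))"
    by (rule complex_Re_le_cmod)
  also have "\<dots> \<le> \<eta>"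
    using assms by (simp add: norm_mult norm_minus_commute)
  finally have "Re e * (Re e - Re g) + Im e * (Im e - Im g) \<le> \<eta>"
    by simp
  moreover have "(Re e)\<^sup>2 + (Im e)\<^sup>2 = 1"
    using assms(1) cmod_power2[of e] by simp
  ultimately show ?thesis
    unfolding cmod_power2 by (simp add: power2_eq_square algebra_simps)
qed

section \<open>Error estimates in the Fourier basis\<close>

lemma adjoin_mult_vec:
  assumes "v \<in> carrier_vec (2 ^ L)" "i < 2 ^ (L + a)"
  shows "(adjoin_ancillas L a *\<^sub>v v) $ i = (if i < 2 ^ L then v $ i else 0)"
proof -
  have "(adjoin_ancillas L a *\<^sub>v v) $ i = (\<Sum>j<(2::nat) ^ L. adjoin_ancillas L a $$ (i, j) * v $ j)"
    using assms by (simp add: scalar_prod_def carrier_matD[OF adjoin_carrier] atLeast0LessThan)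
  also have "\<dots> = (\<Sum>j<(2::nat) ^ L. if j = i then v $ j else 0)"
    using assms by (intro sum.cong refl) (auto simp: adjoin_ancillas_def)
  finally show ?thesis
    by simp
qed

lemma diag_mult_vec:
  fixes e :: "nat \<Rightarrow> complex"
  assumes FV: "\<And>l j. l < n \<Longrightarrow> j < n \<Longrightarrow> (F * V) $$ (l, j) = e l * F $$ (l, j)"
    and F: "F \<in> carrier_mat n n" and V: "V \<in> carrier_mat n n" and v: "v \<in> carrier_vec n" and l: "l < n"
  shows "(F *\<^sub>v (V *\<^sub>v v)) $ l = e l * (F *\<^sub>v v) $ l"
proof -
  have "(F *\<^sub>v (V *\<^sub>v v)) $ l = ((F * V) *\<^sub>v v) $ l"
    by (simp only: assoc_mult_mat_vec[OF F V v])
  also have "\<dots> = (\<Sum>j<n. (F * V) $$ (l, j) * v $ j)"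
    by (rule mult_mat_vec_index_sum[OF mult_carrier_mat[OF F V] v l])
  also have "\<dots> = (\<Sum>j<n. e l * (F $$ (l, j) * v $ j))"
    using FV l by (intro sum.cong refl) simp
  also have "\<dots> = e l * (F *\<^sub>v v) $ l"
    unfolding mult_mat_vec_index_sum[OF F v l] by (rule sum_distrib_left[symmetric])
  finally show ?thesis .
qed

text \<open>Adjoining ancillas and the transform are isometries, so only the distance of the
  diagonal phases from 1 remains.\<close>

lemma simulation_error_trivial:
  assumes V: "V \<in> carrier_mat (2 ^ L) (2 ^ L)"
    and FV: "\<And>l j. l < 2 ^ L \<Longrightarrow> j < 2 ^ L \<Longrightarrow> (qft_mat L * V) $$ (l, j) = e l * qft_mat L $$ (l, j)"
    and e: "\<And>l. l < 2 ^ L \<Longrightarrow> cmod (e l - 1) \<le> \<delta>" and \<delta>: "0 \<le> \<delta>"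
  shows "simulation_error L a X [] V \<le> \<delta>"
  unfolding simulation_error_def performed_op_def
proof (rule mat_op_norm_le[OF \<delta>])
  let ?E = "adjoin_ancillas L a" and ?F = "qft_mat L" and ?n = "L + a"
  let ?D = "?E * V - circuit_op ?n X [] * ?E"
  fix v :: "complex vec" assume "v \<in> carrier_vec (dim_col ?D)"
  then have v: "v \<in> carrier_vec (2 ^ L)"
    using V by (simp add: carrier_matD[OF adjoin_carrier])
  have Vv: "V *\<^sub>v v \<in> carrier_vec (2 ^ L)"
    using V v by simp
  have F: "mat_adjoint ?F * ?F = 1\<^sub>m (2 ^ L)"
    using qft_mat_unitary by (simp add: unitary_mat_def)
  have "?D *\<^sub>v v = ?E *\<^sub>v (V *\<^sub>v v) - ?E *\<^sub>v v"
    using V v assoc_mult_mat_vec[OF adjoin_carrier V v]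
      minus_mult_distrib_mat_vec[of "?E * V" "2 ^ ?n" "2 ^ L" "circuit_op ?n X [] * ?E" v]
      left_mult_one_mat[OF adjoin_carrier] mult_carrier_mat[OF adjoin_carrier V] by simp
  also have "\<dots> = ?E *\<^sub>v (V *\<^sub>v v - v)"
    using mult_minus_distrib_mat_vec[OF adjoin_carrier Vv v] by simp
  finally have "vec_l2_norm (?D *\<^sub>v v) = vec_l2_norm (V *\<^sub>v v - v)"
    using isometry_norm[OF adjoin_carrier adjoin_isometry] Vv v by simp
  also have "\<dots> = vec_l2_norm (?F *\<^sub>v (V *\<^sub>v v - v))"
    using isometry_norm[OF qft_mat_carrier F] Vv v by simp
  also have "?F *\<^sub>v (V *\<^sub>v v - v) = ?F *\<^sub>v (V *\<^sub>v v) - ?F *\<^sub>v v"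
    using mult_minus_distrib_mat_vec[OF qft_mat_carrier Vv v] by simp
  finally have D: "vec_l2_norm (?D *\<^sub>v v) = vec_l2_norm (?F *\<^sub>v (V *\<^sub>v v) - ?F *\<^sub>v v)" .
  have "(vec_l2_norm (?F *\<^sub>v (V *\<^sub>v v) - ?F *\<^sub>v v))\<^sup>2 =
      (\<Sum>l<2 ^ L. (cmod ((?F *\<^sub>v (V *\<^sub>v v)) $ l - (?F *\<^sub>v v) $ l))\<^sup>2)"
    unfolding vec_l2_norm_sq by (simp add: carrier_matD[OF qft_mat_carrier])
  also have "\<dots> \<le> (\<Sum>l<2 ^ L. \<delta>\<^sup>2 * (cmod ((?F *\<^sub>v v) $ l))\<^sup>2)"
  proof (rule sum_mono)
    fix l :: nat assume "l \<in> {..<2 ^ L}"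
    then have l: "l < 2 ^ L" by simp
    have "(?F *\<^sub>v (V *\<^sub>v v)) $ l = e l * (?F *\<^sub>v v) $ l"
      by (rule diag_mult_vec[OF FV qft_mat_carrier V v l])
    then have "(?F *\<^sub>v (V *\<^sub>v v)) $ l - (?F *\<^sub>v v) $ l = (e l - 1) * (?F *\<^sub>v v) $ l"
      by (simp only: left_diff_distrib mult_1)
    then show "(cmod ((?F *\<^sub>v (V *\<^sub>v v)) $ l - (?F *\<^sub>v v) $ l))\<^sup>2 \<le> \<delta>\<^sup>2 * (cmod ((?F *\<^sub>v v) $ l))\<^sup>2"
      using e[OF l] by (simp add: norm_mult power_mult_distrib mult_right_mono power_mono)
  qed
  also have "\<dots> = (\<delta> * vec_l2_norm (?F *\<^sub>v v))\<^sup>2"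
    unfolding power_mult_distrib vec_l2_norm_sq by (simp add: sum_distrib_left carrier_matD[OF qft_mat_carrier])
  also have "vec_l2_norm (?F *\<^sub>v v) = vec_l2_norm v"
    by (rule isometry_norm[OF qft_mat_carrier F v])
  finally have "(vec_l2_norm (?F *\<^sub>v (V *\<^sub>v v) - ?F *\<^sub>v v))\<^sup>2 \<le> (\<delta> * vec_l2_norm v)\<^sup>2" .
  then show "vec_l2_norm (?D *\<^sub>v v) \<le> \<delta> * vec_l2_norm v"
    unfolding D by (rule power2_le_imp_le) (simp add: \<delta>)
qed

text \<open>Only the block of the core circuit at clean ancillas is known. The weight outside needs
  no estimate of its own: the core preserves the norm, so that weight is the norm of the input minus
  the weight inside the block, and \<open>norm_diff_sq_le\<close> has the form in which the two
  combine to \<delta>^2.\<close>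

lemma simulation_error_qft:
  assumes X: "unitary_mat (2 ^ L) X" and H: "wf_circuit L (L + a) H"
    and V: "V \<in> carrier_mat (2 ^ L) (2 ^ L)"
    and FV: "\<And>l j. l < 2 ^ L \<Longrightarrow> j < 2 ^ L \<Longrightarrow> (qft_mat L * V) $$ (l, j) = e l * qft_mat L $$ (l, j)"
    and core: "\<And>i k. i < 2 ^ L \<Longrightarrow> k < 2 ^ L \<Longrightarrow>
      (circuit_op (L + a) X H * adjoin_ancillas L a) $$ (i, k) = (if i = k then g k else 0)"
    and e: "\<And>l. l < 2 ^ L \<Longrightarrow> cmod (e l) = 1" "\<And>l. l < 2 ^ L \<Longrightarrow> cmod (g l - e l) \<le> \<delta>\<^sup>2 / 2" and \<delta>: "0 \<le> \<delta>"
  shows "simulation_error L a X (qft L @ H @ inv_circuit (qft L)) V \<le> \<delta>"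
  unfolding simulation_error_def performed_op_def
proof (rule mat_op_norm_le[OF \<delta>])
  let ?E = "adjoin_ancillas L a" and ?F = "qft_mat L" and ?n = "L + a"
  let ?Q = "circuit_op ?n X (qft L)" and ?Qi = "circuit_op ?n X (inv_circuit (qft L))" and ?M = "circuit_op ?n X H"
  let ?G = "circuit_op ?n X (qft L @ H @ inv_circuit (qft L))"
  let ?D = "?E * V - ?G * ?E"
  note cc = circuit_op_carrier[of ?n X]
  fix v :: "complex vec" assume "v \<in> carrier_vec (dim_col ?D)"
  then have v: "v \<in> carrier_vec (2 ^ L)"
    by (simp add: carrier_matD[OF adjoin_carrier])
  have wfq: "wf_circuit L ?n (qft L)"
    by (simp add: wf_qft)
  have Xc: "X \<in> carrier_mat (2 ^ L) (2 ^ L)"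
    using X by (simp add: unitary_mat_def)
  have QQ: "mat_adjoint ?Q * ?Q = 1\<^sub>m (2 ^ ?n)" "?Q * ?Qi = 1\<^sub>m (2 ^ ?n)"
    using circuit_op_unitary[OF wfq X] mat_adjoint_circuit_op[OF wfq Xc] by (auto simp: unitary_mat_def)
  have MM: "mat_adjoint ?M * ?M = 1\<^sub>m (2 ^ ?n)"
    using circuit_op_unitary[OF H X] by (auto simp: unitary_mat_def)
  have F: "mat_adjoint ?F * ?F = 1\<^sub>m (2 ^ L)"
    using qft_mat_unitary by (simp add: unitary_mat_def)
  define u where "u = ?F *\<^sub>v v"
  define b where "b = ?F *\<^sub>v (V *\<^sub>v v)"
  define y where "y = ?M *\<^sub>v (?E *\<^sub>v u)"
  have Vv: "V *\<^sub>v v \<in> carrier_vec (2 ^ L)" and u: "u \<in> carrier_vec (2 ^ L)" and b: "b \<in> carrier_vec (2 ^ L)"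
    using V v by (auto simp: u_def b_def intro!: mult_mat_vec_carrier[OF qft_mat_carrier])
  have Ec: "?E *\<^sub>v w \<in> carrier_vec (2 ^ ?n)" if "w \<in> carrier_vec (2 ^ L)" for w
    using that by (rule mult_mat_vec_carrier[OF adjoin_carrier])
  have y: "y \<in> carrier_vec (2 ^ ?n)"
    unfolding y_def by (rule mult_mat_vec_carrier[OF cc Ec[OF u]])
  have Qiy: "?Qi *\<^sub>v y \<in> carrier_vec (2 ^ ?n)"
    by (rule mult_mat_vec_carrier[OF cc y])
  have QE: "?Q *\<^sub>v (?E *\<^sub>v w) = ?E *\<^sub>v (?F *\<^sub>v w)" if "w \<in> carrier_vec (2 ^ L)" for w
    using qft_adjoin[of L a X] assoc_mult_mat_vec[OF cc adjoin_carrier that]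
      assoc_mult_mat_vec[OF adjoin_carrier qft_mat_carrier that] by metis
  have Gv: "(?G * ?E) *\<^sub>v v = ?Qi *\<^sub>v y"
  proof -
    have "?G = ?Qi * ?M * ?Q"
      by (simp add: circuit_op_append)
    then have "(?G * ?E) *\<^sub>v v = (?Qi * ?M * ?Q) *\<^sub>v (?E *\<^sub>v v)"
      using assoc_mult_mat_vec[OF cc adjoin_carrier v] by metis
    also have "\<dots> = (?Qi * ?M) *\<^sub>v (?E *\<^sub>v u)"
      unfolding u_def QE[OF v, symmetric]
      by (rule assoc_mult_mat_vec[OF mult_carrier_mat[OF cc cc] cc Ec[OF v]])
    also have "\<dots> = ?Qi *\<^sub>v y"
      unfolding y_def by (rule assoc_mult_mat_vec[OF cc cc Ec[OF u]])
    finally show ?thesis .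
  qed
  have "?D *\<^sub>v v = (?E * V) *\<^sub>v v - (?G * ?E) *\<^sub>v v"
    by (rule minus_mult_distrib_mat_vec[OF mult_carrier_mat[OF adjoin_carrier V] mult_carrier_mat[OF cc adjoin_carrier] v])
  also have "\<dots> = ?E *\<^sub>v (V *\<^sub>v v) - ?Qi *\<^sub>v y"
    using Gv assoc_mult_mat_vec[OF adjoin_carrier V v] by simp
  finally have Dv: "?D *\<^sub>v v = ?E *\<^sub>v (V *\<^sub>v v) - ?Qi *\<^sub>v y" .
  \<comment> \<open>Applying the unitary forward transform removes the inverse transform at the end
    of the circuit and diagonalises the target.\<close>
  have "?Q *\<^sub>v (?D *\<^sub>v v) = ?Q *\<^sub>v (?E *\<^sub>v (V *\<^sub>v v)) - ?Q *\<^sub>v (?Qi *\<^sub>v y)"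
    unfolding Dv by (rule mult_minus_distrib_mat_vec[OF cc Ec[OF Vv] Qiy])
  also have "?Q *\<^sub>v (?E *\<^sub>v (V *\<^sub>v v)) = ?E *\<^sub>v b"
    unfolding b_def by (rule QE[OF Vv])
  also have "?Q *\<^sub>v (?Qi *\<^sub>v y) = y"
    using assoc_mult_mat_vec[OF cc cc y, of "qft L" "inv_circuit (qft L)"] QQ(2) y by simp
  finally have QD: "?Q *\<^sub>v (?D *\<^sub>v v) = ?E *\<^sub>v b - y" .
  have "?D *\<^sub>v v \<in> carrier_vec (2 ^ ?n)"
    unfolding Dv using Ec[OF Vv] Qiy by simp
  then have D: "vec_l2_norm (?D *\<^sub>v v) = vec_l2_norm (?E *\<^sub>v b - y)"
    using isometry_norm[OF cc QQ(1)] QD by metis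
  have yi: "y $ i = g i * u $ i" if i: "i < 2 ^ L" for i
  proof -
    have "y $ i = ((?M * ?E) *\<^sub>v u) $ i"
      unfolding y_def using assoc_mult_mat_vec[OF cc adjoin_carrier u] by simp
    also have "\<dots> = (\<Sum>k<2 ^ L. (?M * ?E) $$ (i, k) * u $ k)"
      using less_pow_add[OF i, of a] u
      by (simp add: scalar_prod_def atLeast0LessThan carrier_matD[OF cc] carrier_matD[OF adjoin_carrier])
    also have "\<dots> = (\<Sum>k<2 ^ L. if k = i then g i * u $ i else 0)"
      using core[OF i] by (intro sum.cong refl) auto
    finally show ?thesis
      using i by simp
  qed
  have bi: "b $ i = e i * u $ i" if "i < 2 ^ L" for i
    unfolding b_def u_def by (rule diag_mult_vec[OF FV qft_mat_carrier V v that])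
  define U where "U = (\<Sum>i<2 ^ L. (cmod (u $ i))\<^sup>2)"
  have Uu: "U = (vec_l2_norm u)\<^sup>2"
    using u by (simp add: U_def vec_l2_norm_sq)
  have U: "U = (vec_l2_norm v)\<^sup>2"
    unfolding Uu u_def by (simp only: isometry_norm[OF qft_mat_carrier F v])
  have "(\<Sum>i<2 ^ ?n. (cmod (y $ i))\<^sup>2) = (vec_l2_norm y)\<^sup>2"
    using y by (simp add: vec_l2_norm_sq)
  also have "vec_l2_norm y = vec_l2_norm u"
    unfolding y_def using isometry_norm[OF cc MM Ec[OF u]] isometry_norm[OF adjoin_carrier adjoin_isometry u] by simp
  finally have ysum: "(\<Sum>i<2 ^ ?n. (cmod (y $ i))\<^sup>2) = U"
    unfolding Uu .
  have set_split: "{..<(2::nat) ^ ?n} = {..<2 ^ L} \<union> {2 ^ L..<2 ^ ?n}"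
    using ivl_disj_un_one(2)[of "2 ^ L" "(2::nat) ^ ?n"] by simp
  have split: "(\<Sum>i<(2::nat) ^ ?n. f i) = (\<Sum>i<2 ^ L. f i) + (\<Sum>i\<in>{2 ^ L..<2 ^ ?n}. f i)"
    for f :: "nat \<Rightarrow> real"
    unfolding set_split by (rule sum.union_disjoint) auto
  have "(vec_l2_norm (?E *\<^sub>v b - y))\<^sup>2 = (\<Sum>i<2 ^ ?n. (cmod ((?E *\<^sub>v b) $ i - y $ i))\<^sup>2)"
    using y by (simp add: vec_l2_norm_sq carrier_matD[OF adjoin_carrier])
  also have "\<dots> = (\<Sum>i<2 ^ L. (cmod (b $ i - y $ i))\<^sup>2) + (\<Sum>i\<in>{2 ^ L..<2 ^ ?n}. (cmod (y $ i))\<^sup>2)"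
    unfolding split
  proof (intro arg_cong2[where f = "(+)"] sum.cong refl)
    show "(cmod ((?E *\<^sub>v b) $ i - y $ i))\<^sup>2 = (cmod (b $ i - y $ i))\<^sup>2" if "i \<in> {..<2 ^ L}" for i
      using that by (simp only: lessThan_iff adjoin_mult_vec[OF b less_pow_add] if_True)
    show "(cmod ((?E *\<^sub>v b) $ i - y $ i))\<^sup>2 = (cmod (y $ i))\<^sup>2" if "i \<in> {2 ^ L..<2 ^ ?n}" for i
      using that adjoin_mult_vec[OF b, of i a] by (simp del: index_mult_mat_vec)
  qed
  finally have total: "(vec_l2_norm (?E *\<^sub>v b - y))\<^sup>2 =
      (\<Sum>i<2 ^ L. (cmod (b $ i - y $ i))\<^sup>2) + (\<Sum>i\<in>{2 ^ L..<2 ^ ?n}. (cmod (y $ i))\<^sup>2)" .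
  have "(\<Sum>i<2 ^ L. (cmod (b $ i - y $ i))\<^sup>2) \<le> (\<Sum>i<2 ^ L. (cmod (y $ i))\<^sup>2 + (\<delta>\<^sup>2 - 1) * (cmod (u $ i))\<^sup>2)"
  proof (rule sum_mono)
    fix i :: nat assume "i \<in> {..<2 ^ L}"
    then have i: "i < 2 ^ L" by simp
    have "b $ i - y $ i = (e i - g i) * u $ i"
      by (simp add: bi[OF i] yi[OF i] algebra_simps)
    then have "(cmod (b $ i - y $ i))\<^sup>2 = (cmod (e i - g i))\<^sup>2 * (cmod (u $ i))\<^sup>2"
      by (simp add: norm_mult power_mult_distrib)
    also have "\<dots> \<le> ((cmod (g i))\<^sup>2 + (2 * (\<delta>\<^sup>2 / 2) - 1)) * (cmod (u $ i))\<^sup>2"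
      by (intro mult_right_mono norm_diff_sq_le e i) simp
    also have "\<dots> = (cmod (y $ i))\<^sup>2 + (\<delta>\<^sup>2 - 1) * (cmod (u $ i))\<^sup>2"
      by (simp add: yi[OF i] norm_mult power_mult_distrib algebra_simps)
    finally show "(cmod (b $ i - y $ i))\<^sup>2 \<le> (cmod (y $ i))\<^sup>2 + (\<delta>\<^sup>2 - 1) * (cmod (u $ i))\<^sup>2" .
  qed
  also have "(\<Sum>i<2 ^ L. (cmod (y $ i))\<^sup>2 + (\<delta>\<^sup>2 - 1) * (cmod (u $ i))\<^sup>2) =
      (\<Sum>i<2 ^ L. (cmod (y $ i))\<^sup>2) + (\<delta>\<^sup>2 - 1) * U"
    by (simp add: sum.distrib U_def sum_distrib_left)
  \<comment> \<open>The weight of y inside the block and the leaked weight have been merged into its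
    full norm, which equals U and cancels the -1.\<close>
  finally have "(vec_l2_norm (?E *\<^sub>v b - y))\<^sup>2 \<le> (\<Sum>i<2 ^ ?n. (cmod (y $ i))\<^sup>2) + (\<delta>\<^sup>2 - 1) * U"
    unfolding total split by linarith
  also have "\<dots> = (\<delta> * vec_l2_norm v)\<^sup>2"
    unfolding ysum by (simp add: U power_mult_distrib algebra_simps)
  finally have "(vec_l2_norm (?E *\<^sub>v b - y))\<^sup>2 \<le> (\<delta> * vec_l2_norm v)\<^sup>2" .
  then show "vec_l2_norm (?D *\<^sub>v v) \<le> \<delta> * vec_l2_norm v"
    unfolding D by (rule power2_le_imp_le) (simp add: \<delta>)
qed

section \<open>The simulation circuit\<close>

lemma sqrt2_pow: "complex_of_real (sqrt 2) ^ L = of_real (sqrt (2 ^ L))"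
  by (simp add: real_sqrt_power)

text \<open>Cauchy-Schwarz against the constant vector of norm sqrt N; this is what puts x into
  [-1, 1].\<close>

lemma norm_circulant_eig_le:
  assumes "c \<in> carrier_vec (2 ^ L)" "vec_l2_norm c = 1"
  shows "cmod (circulant_eig L c k) \<le> sqrt (2 ^ L)"
proof -
  have "cmod (circulant_eig L c k) \<le> (\<Sum>m<2 ^ L. \<bar>cmod (c $ m)\<bar> * \<bar>1\<bar>)"
    unfolding circulant_eig_def by (rule order_trans[OF norm_sum]) (simp add: norm_mult)
  also have "\<dots> \<le> L2_set (\<lambda>m. cmod (c $ m)) {..<2 ^ L} * L2_set (\<lambda>m. 1) {..<(2::nat) ^ L}"
    by (rule L2_set_mult_ineq)
  also have "\<dots> = sqrt (2 ^ L)"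
    using assms by (simp add: vec_l2_norm_def L2_set_def)
  finally show ?thesis .
qed

text \<open>The chord has length 2 |sin (y / 2)|, at most that of the arc.\<close>

lemma norm_exp_minus_one_le: "cmod (exp (- \<i> * of_real y) - 1) \<le> \<bar>y\<bar>"
proof -
  have "(cmod (exp (- \<i> * of_real y) - 1))\<^sup>2 = (cos y - 1)\<^sup>2 + (sin y)\<^sup>2"
    by (simp add: cmod_power2 Re_exp Im_exp)
  also have "\<dots> = 2 * (1 - cos (2 * (y / 2)))"
    using sin_cos_squared_add[of y] by (simp add: power2_eq_square algebra_simps)
  also have "\<dots> = 4 * (sin (y / 2))\<^sup>2"
    unfolding cos_double_sin by simp
  also have "\<dots> \<le> 4 * (y / 2)\<^sup>2"
    using abs_sin_x_le_abs_x[of "y / 2"] by (simp add: abs_le_square_iff[symmetric])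
  finally have "(cmod (exp (- \<i> * of_real y) - 1))\<^sup>2 \<le> \<bar>y\<bar>\<^sup>2"
    by (simp add: power_divide)
  then show ?thesis
    by (rule power2_le_imp_le) simp
qed

context black_box
begin

text \<open>The ancillas are L for the oracle register, the walk bit, the signal qubit, and L + 2
  for the ladder with its seed.\<close>

lemma width_eq: "width = L + (2 * L + 4)"
  by (simp add: width_def)

lemma rep_basis:
  assumes "k < 2 ^ L"
  shows "rep width (unit_vec (2 ^ width) k) (sel sig (basis k) (\<lambda>b. 0))"
proof -
  have k: "k < 2 ^ width" "\<not> bit k sig"
    unfolding width_eq using less_pow_add[OF assms, of "2 * L + 4"] bit_ge[OF assms] by (auto simp: sig_def)
  have "sel sig (basis k) (\<lambda>b. 0) (bit i) = of_bool (i = k)" for i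
  proof (cases "bit i sig")
    case False
    then have "bit i sig = bit k sig"
      using k(2) by simp
    then have "(\<forall>q. q \<noteq> sig \<longrightarrow> bit i q = bit k q) \<longleftrightarrow> bit i = bit k"
      unfolding fun_eq_iff by metis
    then show ?thesis
      using False by (auto simp: sel_def basis_def dest: bit_inj)
  qed (use k(2) in \<open>auto simp: sel_def\<close>)
  then show ?thesis
    using k(1) by (auto simp: rep_def)
qed

lemma wf_core:
  assumes "\<forall>(\<alpha>, \<beta>)\<in>set xs. (cmod \<alpha>)\<^sup>2 + (cmod \<beta>)\<^sup>2 = 1"
  shows "wf_circuit L width (core D xs)"
proof -
  have "wf_circuit L width (concat (replicate D (inv_circuit walk)))"
    using wf_walk by (induction D) auto
  then show ?thesis
    using wf_qsp_circuit[OF assms] by (simp add: core_def)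
qed

lemma count_core:
  "gate_count (core D xs) = (15 + 12 * L + 2 * L * L) * length xs + (14 + 12 * L + 2 * L * L) * D"
  "call_count (core D xs) = 2 * length xs + 2 * D"
proof -
  have "gate_count (concat (replicate D (inv_circuit walk))) = (14 + 12 * L + 2 * L * L) * D"
    "call_count (concat (replicate D (inv_circuit walk))) = 2 * D"
    by (induction D) (auto simp: count_walk)
  then show "gate_count (core D xs) = (15 + 12 * L + 2 * L * L) * length xs + (14 + 12 * L + 2 * L * L) * D"
    "call_count (core D xs) = 2 * length xs + 2 * D"
    by (simp_all add: core_def count_qsp_circuit)
qed

lemma core_entry:
  assumes ik: "i < 2 ^ L" "k < 2 ^ L"
    and wf: "\<forall>(\<alpha>, \<beta>)\<in>set xs. (cmod \<alpha>)\<^sup>2 + (cmod \<beta>)\<^sup>2 = 1"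
    and g: "op_poly (sem X walk) (fst (qsp_polys xs)) (basis k) = (\<lambda>b. g * (sem X walk ^^ D) (basis k) b)"
  shows "(circuit_op (L + (2 * L + 4)) X (core D xs) * adjoin_ancillas L (2 * L + 4)) $$ (i, k) = (if i = k then g else 0)"
proof -
  let ?M = "circuit_op width X (core D xs)" and ?E = "adjoin_ancillas L (2 * L + 4)"
  have i: "i < 2 ^ width" "\<not> bit i sig"
    unfolding width_eq using less_pow_add[OF ik(1), of "2 * L + 4"] bit_ge[OF ik(1)] by (auto simp: sig_def)
  have "indep sig (basis k)"
    by (auto simp: indep_def basis_def)
  have "rep width (?M *\<^sub>v unit_vec (2 ^ width) k) (sem X (core D xs) (sel sig (basis k) (\<lambda>b. 0)))"
    by (rule rep_circuit_op[OF rep_basis[OF ik(2)] wf_core[OF wf]])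
  then have "(?M *\<^sub>v unit_vec (2 ^ width) k) $ i = sem X (core D xs) (sel sig (basis k) (\<lambda>b. 0)) (bit i)"
    using i(1) unfolding rep_def by blast
  also have "\<dots> = g * basis k (bit i)"
    by (rule sem_core[where D = D and b = "bit i", OF \<open>indep sig (basis k)\<close> g i(2)])
  also have "g * basis k (bit i) = (if i = k then g else 0)"
  proof -
    have "sel sig (basis k) (\<lambda>b. 0) (bit i) = unit_vec (2 ^ width) k $ i"
      using rep_basis[OF ik(2)] i(1) unfolding rep_def by metis
    then show ?thesis
      using i less_pow_add[OF ik(2), of "2 * L + 4"] by (auto simp: sel_def width_eq)
  qed
  also have "(?M *\<^sub>v unit_vec (2 ^ width) k) $ i = (?M * ?E) $$ (i, k)"
    using ik i(1) col_adjoin[OF ik(2), of "2 * L + 4"]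
    by (simp add: carrier_matD[OF circuit_op_carrier] carrier_matD[OF adjoin_carrier] width_eq)
  finally show ?thesis
    unfolding width_eq .
qed

lemma amp_eq_circulant_eig:
  assumes "X *\<^sub>v unit_vec (2 ^ L) 0 = c"
  shows "amp k = circulant_eig L c k / of_real (sqrt (2 ^ L))"
proof -
  have "X $$ (j, 0) = c $ j" if "j < 2 ^ L" for j
    using that X_carrier by (simp flip: assms)
  then show ?thesis
    by (simp add: amp_def circulant_eig_def sqrt2_pow)
qed

end

definition evolution_sequence ::
    "real \<Rightarrow> real \<Rightarrow> nat \<Rightarrow> (complex \<times> complex) list \<Rightarrow> (real \<Rightarrow> complex) \<Rightarrow> bool" where
  "evolution_sequence T \<delta> D xs g \<longleftrightarrow> length xs = Suc (2 * D) \<and> (\<forall>(\<alpha>, \<beta>)\<in>set xs. (cmod \<alpha>)\<^sup>2 + (cmod \<beta>)\<^sup>2 = 1) \<and>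
    (\<forall>x. \<bar>x\<bar> \<le> 1 \<longrightarrow> cmod (g x - exp (- \<i> * of_real (T * x))) \<le> \<delta>\<^sup>2 / 2) \<and>
    (\<forall>(U :: state \<Rightarrow> state) e x. lin U \<longrightarrow> (\<forall>b. U (U e) b + e b = 2 * of_real x * U e b) \<longrightarrow>
      op_poly U (fst (qsp_polys xs)) e = (\<lambda>b. g x * (U ^^ D) e b))"

definition sim_degree :: "nat \<Rightarrow> real \<Rightarrow> real \<Rightarrow> nat" where
  "sim_degree L t \<delta> = nat \<lceil>16 * (sqrt (2 ^ L) * t / \<delta> powr (3 / 2))\<rceil>"

text \<open>Selected from L, t and \<delta> alone: the specifying property ranges over all operators
  U, so neither c nor the oracle enters the choice.\<close>

definition sim_angles :: "nat \<Rightarrow> real \<Rightarrow> real \<Rightarrow> (complex \<times> complex) list" where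
  "sim_angles L t \<delta> = (SOME xs. \<exists>g. evolution_sequence (sqrt (2 ^ L) * t) \<delta> (sim_degree L t \<delta>) xs g)"

definition sim_circuit :: "nat \<Rightarrow> real \<Rightarrow> real \<Rightarrow> circuit" where
  "sim_circuit L t \<delta> = (if sqrt (2 ^ L) * t \<le> \<delta> then []
     else qft L @ black_box.core L (sim_degree L t \<delta>) (sim_angles L t \<delta>) @ inv_circuit (qft L))"

lemma sim_angles:
  assumes "0 < \<delta>" "\<delta> < 1" "\<delta> < sqrt (2 ^ L) * t"
  shows "\<exists>g. evolution_sequence (sqrt (2 ^ L) * t) \<delta> (sim_degree L t \<delta>) (sim_angles L t \<delta>) g"
  unfolding sim_angles_def
proof (rule someI_ex)
  have "16 * (sqrt (2 ^ L) * t / \<delta> powr (3 / 2)) \<le> real (sim_degree L t \<delta>)"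
    unfolding sim_degree_def by (rule real_nat_ceiling_ge)
  from evolution_angles[where 'a = "nat \<Rightarrow> bool", OF assms this]
  show "\<exists>xs g. evolution_sequence (sqrt (2 ^ L) * t) \<delta> (sim_degree L t \<delta>) xs g"
    unfolding evolution_sequence_def .
qed

text \<open>Circuits and their counts mention the oracle only symbolically, so for counting the
  locale is entered with the identity as oracle.\<close>

lemma black_box_one: "black_box L (1\<^sub>m (2 ^ L))"
  by unfold_locales (simp add: unitary_mat_def)

lemma sim_circuit_resources:
  assumes L: "L \<ge> 1" and t: "t > 0" and \<delta>: "0 < \<delta>" "\<delta> < 1"
  defines "B \<equiv> sqrt (2 ^ L) * t / \<delta> powr (3 / 2)"
  shows "wf_circuit L (L + (2 * L + 4)) (sim_circuit L t \<delta>)"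
    and "real (gate_count (sim_circuit L t \<delta>)) \<le> 1989 * (B * (real L)\<^sup>2)"
    and "real (call_count (sim_circuit L t \<delta>)) \<le> 136 * B"
proof -
  interpret black_box L "1\<^sub>m (2 ^ L)"
    by (rule black_box_one)
  let ?D = "sim_degree L t \<delta>" and ?xs = "sim_angles L t \<delta>"
  have B0: "0 \<le> B"
    using t \<delta> by (simp add: B_def)
  have "wf_circuit L (L + (2 * L + 4)) (sim_circuit L t \<delta>) \<and>
      real (gate_count (sim_circuit L t \<delta>)) \<le> 1989 * (B * (real L)\<^sup>2) \<and>
      real (call_count (sim_circuit L t \<delta>)) \<le> 136 * B"
  proof (cases "sqrt (2 ^ L) * t \<le> \<delta>")
    case True
    then show ?thesis
      using B0 by (simp add: sim_circuit_def)
  next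
    case False
    then have T: "\<delta> < sqrt (2 ^ L) * t"
      by simp
    obtain g where g: "evolution_sequence (sqrt (2 ^ L) * t) \<delta> ?D ?xs g"
      using sim_angles[OF \<delta> T] by auto
    have len: "length ?xs = Suc (2 * ?D)" and u: "\<forall>(\<alpha>, \<beta>)\<in>set ?xs. (cmod \<alpha>)\<^sup>2 + (cmod \<beta>)\<^sup>2 = 1"
      using g by (auto simp: evolution_sequence_def)
    have c: "sim_circuit L t \<delta> = qft L @ core ?D ?xs @ inv_circuit (qft L)"
      using False by (simp add: sim_circuit_def)
    \<comment> \<open>With \<delta> < T this gives 1 \<le> B, which absorbs the rounding in the
      degree: D \<le> 16 B + 1 \<le> 17 B.\<close>
    have "\<delta> powr (3 / 2) \<le> \<delta>"
      using powr_mono'[of 1 "3 / 2" \<delta>] \<delta> by simp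
    then have "1 \<le> B"
      unfolding B_def using T \<delta> by (simp add: le_divide_eq)
    then have "1 \<le> ?D"
      unfolding sim_degree_def B_def[symmetric] by linarith
    have D: "real ?D \<le> 17 * B"
      unfolding sim_degree_def B_def[symmetric] using \<open>1 \<le> B\<close> by linarith
    have "gate_count (sim_circuit L t \<delta>) \<le>
        2 * (L * L) + (15 + 12 * L + 2 * L * L) * Suc (2 * ?D) + (14 + 12 * L + 2 * L * L) * ?D"
      using count_qft(1)[of L] by (simp add: c count_core len)
    moreover have "L \<le> L * L" "1 \<le> L * L"
      using L by simp_all
    then have L15: "15 + 12 * L \<le> 27 * (L * L)" "14 + 12 * L \<le> 26 * (L * L)"
      by linarith+
    have "2 * (L * L) \<le> 2 * (L * L * ?D)"
      using \<open>1 \<le> ?D\<close> by simp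
    moreover have "(15 + 12 * L + 2 * L * L) * Suc (2 * ?D) \<le> (29 * (L * L)) * (3 * ?D)"
      by (rule mult_le_mono) (use L15 \<open>1 \<le> ?D\<close> in auto)
    moreover have "(14 + 12 * L + 2 * L * L) * ?D \<le> (28 * (L * L)) * ?D"
      by (rule mult_le_mono1) (use L15 in auto)
    \<comment> \<open>117 = 2 + 29 * 3 + 28; with the factor 17 from D it becomes 1989.\<close>
    moreover have "2 * (L * L * ?D) + (29 * (L * L)) * (3 * ?D) + (28 * (L * L)) * ?D = 117 * (?D * (L * L))"
      by simp
    ultimately have "gate_count (sim_circuit L t \<delta>) \<le> 117 * (?D * (L * L))"
      by linarith
    then have "real (gate_count (sim_circuit L t \<delta>)) \<le> real (117 * (?D * (L * L)))"
      by (rule of_nat_mono)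
    also have "\<dots> = 117 * (real ?D * (real L)\<^sup>2)"
      by (simp add: power2_eq_square)
    also have "\<dots> \<le> 117 * (17 * B * (real L)\<^sup>2)"
      using D by (intro mult_left_mono mult_right_mono) auto
    finally have gates: "real (gate_count (sim_circuit L t \<delta>)) \<le> 1989 * (B * (real L)\<^sup>2)"
      by simp
    \<comment> \<open>Two calls for each of the 2 D + 1 steps and for each of the D inverse walks: 6
      D + 2 \<le> 8 D \<le> 8 * 17 * B.\<close>
    have "real (call_count (sim_circuit L t \<delta>)) = 6 * real ?D + 2"
      by (simp add: c count_core len count_qft)
    also have "\<dots> \<le> 136 * B"
      using D \<open>1 \<le> ?D\<close> by linarith
    finally have calls: "real (call_count (sim_circuit L t \<delta>)) \<le> 136 * B" .
    have "wf_circuit L (L + (2 * L + 4)) (sim_circuit L t \<delta>)"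
      using wf_core[OF u] wf_qft[of L "L + (2 * L + 4)" L] by (simp add: c width_eq)
    then show ?thesis
      using gates calls by simp
  qed
  then show "wf_circuit L (L + (2 * L + 4)) (sim_circuit L t \<delta>)"
    "real (gate_count (sim_circuit L t \<delta>)) \<le> 1989 * (B * (real L)\<^sup>2)"
    "real (call_count (sim_circuit L t \<delta>)) \<le> 136 * B"
    by auto
qed

lemma sim_circuit_error:
  assumes t: "t > 0" and \<delta>: "0 < \<delta>" "\<delta> < 1"
    and c: "c \<in> carrier_vec (2 ^ L)" "vec_l2_norm c = 1" "hermitian_mat (circulant_mat c)"
    and X: "unitary_mat (2 ^ L) X" "X *\<^sub>v unit_vec (2 ^ L) 0 = c"
  shows "simulation_error L (2 * L + 4) X (sim_circuit L t \<delta>)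
    (mat_exp ((- \<i> * complex_of_real t) \<cdot>\<^sub>m circulant_mat c)) \<le> \<delta>"
proof -
  interpret black_box L X
    by unfold_locales (rule X(1))
  let ?V = "mat_exp ((- \<i> * complex_of_real t) \<cdot>\<^sub>m circulant_mat c)"
  define T where "T = sqrt (2 ^ L) * t"
  define e where "e = (\<lambda>l. exp (- \<i> * of_real (T * Re (amp l))))"
  have V: "?V \<in> carrier_mat (2 ^ L) (2 ^ L)"
    using c(1) by (simp add: mat_exp_def circulant_mat_def)
  have amp: "amp l = circulant_eig L c l / of_real (sqrt (2 ^ L))" for l
    by (rule amp_eq_circulant_eig[OF X(2)])
  have x: "\<bar>Re (amp l)\<bar> \<le> 1" for l
  proof -
    have "\<bar>Re (amp l)\<bar> \<le> cmod (amp l)"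
      by (rule abs_Re_le_cmod)
    also have "\<dots> \<le> 1"
      unfolding amp using norm_circulant_eig_le[OF c(1,2), of l] by (simp add: norm_divide)
    finally show ?thesis .
  qed
  have FV: "(qft_mat L * ?V) $$ (l, j) = e l * qft_mat L $$ (l, j)" if "l < 2 ^ L" "j < 2 ^ L" for l j
  proof -
    \<comment> \<open>The eigenvalue is real, so the real part seen by the walk determines
      it.\<close>
    have "circulant_eig L c l = of_real (sqrt (2 ^ L) * Re (amp l))"
      unfolding amp using circulant_eig_real[OF c(1,3) that(1)] by (auto elim!: Reals_cases)
    then have "- \<i> * complex_of_real t * circulant_eig L c l = - \<i> * of_real (T * Re (amp l))"
      by (simp add: T_def)
    then show ?thesis
      using qft_circulant_exp[OF c(1) that, of "- \<i> * complex_of_real t"] by (simp only: e_def)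
  qed
  show ?thesis
  proof (cases "T \<le> \<delta>")
    case True
    have "cmod (e l - 1) \<le> \<delta>" for l
    proof -
      have "cmod (e l - 1) \<le> \<bar>T * Re (amp l)\<bar>"
        unfolding e_def by (rule norm_exp_minus_one_le)
      also have "\<dots> \<le> T * 1"
        unfolding abs_mult using x t by (intro mult_mono) (auto simp: T_def)
      finally show ?thesis
        using True by simp
    qed
    moreover have "sim_circuit L t \<delta> = []"
      using True by (simp add: sim_circuit_def T_def)
    ultimately show ?thesis
      using simulation_error_trivial[OF V FV] \<delta> by simp
  next
    case False
    let ?D = "sim_degree L t \<delta>" and ?xs = "sim_angles L t \<delta>"
    obtain g where g: "evolution_sequence T \<delta> ?D ?xs g"
      using sim_angles[of \<delta> L t] False \<delta> by (auto simp: T_def)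
    then have u: "\<forall>(\<alpha>, \<beta>)\<in>set ?xs. (cmod \<alpha>)\<^sup>2 + (cmod \<beta>)\<^sup>2 = 1"
      by (simp add: evolution_sequence_def)
    have "sim_circuit L t \<delta> = qft L @ core ?D ?xs @ inv_circuit (qft L)"
      using False by (simp add: sim_circuit_def T_def)
    moreover have "simulation_error L (2 * L + 4) X (qft L @ core ?D ?xs @ inv_circuit (qft L)) ?V \<le> \<delta>"
    proof (rule simulation_error_qft[OF X(1) _ V FV, where g = "\<lambda>l. g (Re (amp l))"])
      show "wf_circuit L (L + (2 * L + 4)) (core ?D ?xs)"
        using wf_core[OF u] by (simp add: width_eq)
      show "(circuit_op (L + (2 * L + 4)) X (core ?D ?xs) * adjoin_ancillas L (2 * L + 4)) $$ (i, k) =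
          (if i = k then g (Re (amp k)) else 0)" if "i < 2 ^ L" "k < 2 ^ L" for i k
      proof (rule core_entry[OF that u])
        have "lin (sem X walk)"
          by (rule lin_walk)
        moreover have "\<forall>b. sem X walk (sem X walk (basis k)) b + basis k b = 2 * of_real (Re (amp k)) * sem X walk (basis k) b"
          using walk_relation[OF that(2)] by blast
        ultimately show "op_poly (sem X walk) (fst (qsp_polys ?xs)) (basis k) =
            (\<lambda>b. g (Re (amp k)) * (sem X walk ^^ ?D) (basis k) b)"
          using g unfolding evolution_sequence_def by blast
      qed
      show "cmod (e l) = 1" for l
        by (simp add: e_def norm_exp_eq_Re)
      show "cmod (g (Re (amp l)) - e l) \<le> \<delta>\<^sup>2 / 2" for l
        using g x[of l] unfolding evolution_sequence_def e_def by blast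
    qed (use \<delta> in auto)
    ultimately show ?thesis
      by simp
  qed
qed

theorem theorem2:
  shows "\<exists>(anc :: nat \<Rightarrow> real \<Rightarrow> real \<Rightarrow> nat) (alg :: nat \<Rightarrow> real \<Rightarrow> real \<Rightarrow> circuit)
    (K\<^sub>1 :: real) (K\<^sub>2 :: real). K\<^sub>1 > 0 \<and> K\<^sub>2 > 0 \<and>
    (\<forall>(L :: nat) (N :: nat) (t :: real) (\<delta> :: real).
      L \<ge> 1 \<longrightarrow> N = 2 ^ L \<longrightarrow> t > 0 \<longrightarrow> 0 < \<delta> \<longrightarrow> \<delta> < 1 \<longrightarrow>
        wf_circuit L (L + anc L t \<delta>) (alg L t \<delta>) \<and>
        real (gate_count (alg L t \<delta>))
          \<le> K\<^sub>1 * (sqrt (real N) * t * (log 2 (real N))\<^sup>2 / \<delta> powr (3 / 2)) \<and>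
        real (call_count (alg L t \<delta>))
          \<le> K\<^sub>2 * (sqrt (real N) * t / \<delta> powr (3 / 2)) \<and>
        (\<forall>(c :: complex vec) (X :: complex mat).
          c \<in> carrier_vec N \<longrightarrow> vec_l2_norm c = 1 \<longrightarrow> hermitian_mat (circulant_mat c) \<longrightarrow>
          unitary_mat N X \<longrightarrow> X *\<^sub>v unit_vec N 0 = c \<longrightarrow>
            simulation_error L (anc L t \<delta>) X (alg L t \<delta>)
              (mat_exp ((- \<i> * complex_of_real t) \<cdot>\<^sub>m circulant_mat c)) \<le> \<delta>))"
proof (rule exI[where x = "\<lambda>L t \<delta>. 2 * L + 4"], rule exI[where x = sim_circuit],
    rule exI[where x = 1989], rule exI[where x = 136], intro conjI allI impI)
  fix L N :: nat and t \<delta> :: real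
  assume L: "L \<ge> 1" and N: "N = 2 ^ L" and t: "t > 0" and \<delta>: "0 < \<delta>" "\<delta> < 1"
  note res = sim_circuit_resources[OF L t \<delta>]
  have N': "real N = 2 ^ L" "log 2 (real N) = real L"
    by (simp_all add: N)
  show "wf_circuit L (L + (2 * L + 4)) (sim_circuit L t \<delta>)"
    by (rule res(1))
  show "real (gate_count (sim_circuit L t \<delta>)) \<le> 1989 * (sqrt (real N) * t * (log 2 (real N))\<^sup>2 / \<delta> powr (3 / 2))"
    unfolding N'(2) unfolding N'(1) using res(2) by (simp only: times_divide_eq_left)
  show "real (call_count (sim_circuit L t \<delta>)) \<le> 136 * (sqrt (real N) * t / \<delta> powr (3 / 2))"
    using res(3) by (simp only: N')
  fix c :: "complex vec" and X :: "complex mat"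
  assume "c \<in> carrier_vec N" "vec_l2_norm c = 1" "hermitian_mat (circulant_mat c)"
    "unitary_mat N X" "X *\<^sub>v unit_vec N 0 = c"
  then show "simulation_error L (2 * L + 4) X (sim_circuit L t \<delta>)
      (mat_exp ((- \<i> * complex_of_real t) \<cdot>\<^sub>m circulant_mat c)) \<le> \<delta>"
    unfolding N by (rule sim_circuit_error[OF t \<delta>])
qed simp_all

end
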